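(* Let $H$ satisfy (C3), (CNH), (CVX). Fix $T>0$, a Lipschitz $W:\mathbb{R}\to\mathbb{R}$, and define $U_o^*(x)=\sup\{W(q(T))-\int_0^TL(q(s),\dot q(s))\,ds:\ q\in\mathcal{R}_T,\ q(0)=x\}$. Then the following are equivalent: (1) $U_o^*\in I^{HJ}_T(W)$; (2) $I^{HJ}_T(W)\neq\emptyset$; (3) the set $\mathcal{G}=\{(x_o,x_T)\in\mathbb{R}^2:\ \exists q\in\mathcal{R}_T,\ q(0)=x_o,\ q(T)=x_T,\ U_o^*(x_o)=W(x_T)-\int_0^TL(q(s),\dot q(s))\,ds\}$ satisfies: if $(x_o,x_T'),(x_o,x_T'')\in\mathcal{G}$ then $(x_o,x_T)\in\mathcal{G}$ for every $x_T\in[x_T',x_T'']$. Moreover, any of these conditions implies that the map $\pi_{W'}$ is well defined and nondecreasing.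
   Context: (C3) $H\in C^3(\mathbb{R}^2;\mathbb{R})$; (CNH) there exists $X>0$ with $\partial_xH(x,p)=0$ whenever $|x|\ge X$; (CVX) for each $x$, $p\mapsto\partial_pH(x,p)$ is an increasing $C^1$-diffeomorphism of $\mathbb{R}$ onto itself. $L(x,v)=\sup_p(pv-H(x,p))$. (HS) denotes the system $\dot q=\partial_pH(q,p)$, $\dot p=-\partial_xH(q,p)$; its solutions are global. $\mathcal{R}_T$ is the set of $q\in C^1([0,T];\mathbb{R})$ for which there exists $p\in C^1([0,T];\mathbb{R})$ with $(q,p)$ solving (HS). $S^{HJ}_tU_o$ is the viscosity solution at time $t$ of $\partial_tU+H(x,\partial_xU)=0$, $U(0)=U_o$ (Crandall–Lions sense), well defined for Lipschitz $U_o$; $I^{HJ}_T(W)=\{U_o \text{ Lipschitz}: S^{HJ}_TU_o=W\}$. For $w\in L^\infty$ admitting a left trace $w(x-)$ at every $x$, $\pi_w(x)=q(0)$ where $(q,p)$ solves (HS) with $q(T)=x$, $p(T)=w(x-)$. *)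

theory Defs
  imports "HOL-Analysis.Analysis"
begin

fun Ck2 :: "nat \<Rightarrow> (real \<times> real \<Rightarrow> real) \<Rightarrow> bool" where
  "Ck2 0 f = continuous_on UNIV f"
| "Ck2 (Suc k) f = (\<exists>f1 f2.
      (\<forall>z. (f has_derivative (\<lambda>h. f1 z * fst h + f2 z * snd h)) (at z))
      \<and> Ck2 k f1 \<and> Ck2 k f2)"

definition dHx :: "(real \<Rightarrow> real \<Rightarrow> real) \<Rightarrow> real \<Rightarrow> real \<Rightarrow> real" where
  "dHx H x p = deriv (\<lambda>y. H y p) x"

definition dHp :: "(real \<Rightarrow> real \<Rightarrow> real) \<Rightarrow> real \<Rightarrow> real \<Rightarrow> real" where
  "dHp H x p = deriv (\<lambda>r. H x r) p"

definition C3 :: "(real \<Rightarrow> real \<Rightarrow> real) \<Rightarrow> bool" where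
  "C3 H \<longleftrightarrow> Ck2 3 (\<lambda>(x, p). H x p)"

definition CNH :: "(real \<Rightarrow> real \<Rightarrow> real) \<Rightarrow> bool" where
  "CNH H \<longleftrightarrow> (\<exists>X>0. \<forall>x p. \<bar>x\<bar> \<ge> X \<longrightarrow> dHx H x p = 0)"

definition CVX :: "(real \<Rightarrow> real \<Rightarrow> real) \<Rightarrow> bool" where
  "CVX H \<longleftrightarrow> (\<forall>x. strict_mono (dHp H x) \<and> bij (dHp H x)
      \<and> dHp H x C1_differentiable_on UNIV \<and> inv (dHp H x) C1_differentiable_on UNIV)"

definition Lag :: "(real \<Rightarrow> real \<Rightarrow> real) \<Rightarrow> real \<Rightarrow> real \<Rightarrow> real" where
  "Lag H x v = (SUP p. p * v - H x p)"

definition HS_sol :: "(real \<Rightarrow> real \<Rightarrow> real) \<Rightarrow> real \<Rightarrow> (real \<Rightarrow> real) \<Rightarrow> (real \<Rightarrow> real) \<Rightarrow> bool" where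
  "HS_sol H T q p \<longleftrightarrow> (\<forall>t\<in>{0..T}.
      (q has_real_derivative dHp H (q t) (p t)) (at t within {0..T}) \<and>
      (p has_real_derivative - dHx H (q t) (p t)) (at t within {0..T}))"

definition RT :: "(real \<Rightarrow> real \<Rightarrow> real) \<Rightarrow> real \<Rightarrow> (real \<Rightarrow> real) set" where
  "RT H T = {q. q C1_differentiable_on {0..T} \<and> (\<exists>p. p C1_differentiable_on {0..T} \<and> HS_sol H T q p)}"

definition action :: "(real \<Rightarrow> real \<Rightarrow> real) \<Rightarrow> real \<Rightarrow> (real \<Rightarrow> real) \<Rightarrow> real" where
  "action H T q = integral {0..T} (\<lambda>s. Lag H (q s) (vector_derivative q (at s within {0..T})))"

definition Uostar :: "(real \<Rightarrow> real \<Rightarrow> real) \<Rightarrow> real \<Rightarrow> (real \<Rightarrow> real) \<Rightarrow> real \<Rightarrow> real" where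
  "Uostar H T W x = Sup {W (q T) - action H T q | q. q \<in> RT H T \<and> q 0 = x}"

definition Gset :: "(real \<Rightarrow> real \<Rightarrow> real) \<Rightarrow> real \<Rightarrow> (real \<Rightarrow> real) \<Rightarrow> (real \<times> real) set" where
  "Gset H T W = {(xo, xT). \<exists>q\<in>RT H T. q 0 = xo \<and> q T = xT \<and>
       Uostar H T W xo = W xT - action H T q}"

definition test_C1 :: "(real \<times> real \<Rightarrow> real) \<Rightarrow> bool" where
  "test_C1 \<phi> \<longleftrightarrow> (\<exists>\<phi>t \<phi>x. continuous_on UNIV \<phi>t \<and> continuous_on UNIV \<phi>x \<and>
      (\<forall>z. (\<phi> has_derivative (\<lambda>h. \<phi>t z * fst h + \<phi>x z * snd h)) (at z)))"

definition pdt :: "(real \<times> real \<Rightarrow> real) \<Rightarrow> real \<times> real \<Rightarrow> real" where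
  "pdt \<phi> z = deriv (\<lambda>s. \<phi> (s, snd z)) (fst z)"

definition pdx :: "(real \<times> real \<Rightarrow> real) \<Rightarrow> real \<times> real \<Rightarrow> real" where
  "pdx \<phi> z = deriv (\<lambda>y. \<phi> (fst z, y)) (snd z)"

(* Crandall-Lions viscosity solution of  U_t + H(x,U_x) = 0 on (0,\<infinity>)\<times>R, U(0)=Uo,
   in the class of functions that are Lipschitz on [0,\<tau>]\<times>R for every \<tau> > 0
   (the class where the Crandall-Lions solution with Lipschitz data lives and is unique) *)
definition HJ_visc_sol :: "(real \<Rightarrow> real \<Rightarrow> real) \<Rightarrow> (real \<Rightarrow> real) \<Rightarrow> (real \<Rightarrow> real \<Rightarrow> real) \<Rightarrow> bool" where
  "HJ_visc_sol H Uo U \<longleftrightarrow>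
     (\<forall>x. U 0 x = Uo x) \<and>
     (\<forall>\<tau>>0. \<exists>C. C-lipschitz_on ({0..\<tau>} \<times> UNIV) (\<lambda>(t, x). U t x)) \<and>
     (\<forall>t x \<phi>. t > 0 \<longrightarrow> test_C1 \<phi> \<longrightarrow>
        (\<exists>e>0. \<forall>z\<in>ball (t, x) e. U (fst z) (snd z) - \<phi> z \<le> U t x - \<phi> (t, x)) \<longrightarrow>
        pdt \<phi> (t, x) + H x (pdx \<phi> (t, x)) \<le> 0) \<and>
     (\<forall>t x \<phi>. t > 0 \<longrightarrow> test_C1 \<phi> \<longrightarrow>
        (\<exists>e>0. \<forall>z\<in>ball (t, x) e. U (fst z) (snd z) - \<phi> z \<ge> U t x - \<phi> (t, x)) \<longrightarrow>
        pdt \<phi> (t, x) + H x (pdx \<phi> (t, x)) \<ge> 0)"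

definition SHJ :: "(real \<Rightarrow> real \<Rightarrow> real) \<Rightarrow> real \<Rightarrow> (real \<Rightarrow> real) \<Rightarrow> real \<Rightarrow> real" where
  "SHJ H t Uo = (THE V. \<exists>U. HJ_visc_sol H Uo U \<and> V = U t)"

definition IHJ :: "(real \<Rightarrow> real \<Rightarrow> real) \<Rightarrow> real \<Rightarrow> (real \<Rightarrow> real) \<Rightarrow> (real \<Rightarrow> real) set" where
  "IHJ H T W = {Uo. (\<exists>C. C-lipschitz_on UNIV Uo) \<and> SHJ H T Uo = W}"

(* w admits left trace l at x (essential left limit; w is only defined a.e.) *)
definition left_trace :: "(real \<Rightarrow> real) \<Rightarrow> real \<Rightarrow> real \<Rightarrow> bool" where
  "left_trace w x l \<longleftrightarrow> (\<forall>e>0. \<exists>d>0. AE y in lborel. x - d < y \<and> y < x \<longrightarrow> \<bar>w y - l\<bar> < e)"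

definition pi_map :: "(real \<Rightarrow> real \<Rightarrow> real) \<Rightarrow> real \<Rightarrow> (real \<Rightarrow> real) \<Rightarrow> real \<Rightarrow> real" where
  "pi_map H T w x = (THE y. \<exists>q p. HS_sol H T q p \<and> q T = x \<and>
       p T = (THE l. left_trace w x l) \<and> q 0 = y)"

end

theory Submission
  imports Defs "HOL-Complex_Analysis.Great_Picard"
begin

text \<open>
  The viscosity solution with Lipschitz datum \<open>Uo\<close> is the value function
  \<open>u t y = min {Uo (\<gamma> 0) + \<integral> L(\<gamma>, \<gamma>')}\<close> over curves ending at \<open>y\<close>, and the minimum is attained at a solution of (HS).
  Minimizers are obtained without regularity theory: the minimizing paths of a discretized problem obey the
  symplectic Euler scheme for (HS), whose energy drifts by \<open>O(h\<^sup>2)\<close> per step, so momenta stay bounded and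
  Arzela--Ascoli yields a solution of (HS) in the limit. At interior times of a minimizer \<open>u t\<close> is
  differentiable with derivative the momentum, so minimizers that meet before the final time coincide; in
  one dimension they are therefore ordered. Reversing time, \<open>Uostar\<close> is minus the value function for
  \<open>H(x, -p)\<close> with datum \<open>-W\<close>, and the set of condition (3) consists of the end points of its minimizers.

  Since \<open>Uostar\<close> lies below every datum reaching \<open>W\<close>, while its own evolution lies above \<open>W\<close>, (2) implies (1).
  If (1) holds, a minimizer ending between \<open>xT'\<close> and \<open>xT''\<close> is squeezed between two
  minimizers starting at \<open>xo\<close>, which is (3). Given (3), the set has closed graph, stays near the diagonal and has
  interval sections, so a supremum argument shows that every \<open>xT\<close> occurs, which is (1).
  For the last claim, the position at time \<open>T / 2\<close> of the minimizers is strictly increasing in the end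
  point; outside its countably many jumps \<open>W\<close> is differentiable with derivative the final momentum,
  and its left limits select the minimizers whose initial points define \<open>pi_map\<close>.
\<close>

section \<open>Uniform estimates for the Hamiltonian\<close>

text \<open>The obstacle is that \<open>Lag\<close> is merely superlinear and the datum merely
  Lipschitz, so neither compactness of minimizing sequences nor regularity of minimizers comes for
  free. Both rest on one a priori bound: optimality at the starting point forces an initial momentum
  of size at most \<open>K\<close>, (HS) conserves \<open>H\<close>, and \<open>H\<close> is
  coercive in p uniformly in x; hence minimizers stay in a strip
  \<open>\<bar>p\<bar> \<le> Rad\<close>. There \<open>Lag\<close> may be replaced by
  \<open>tLag Rad\<close>, Lipschitz in the velocity, for which the discrete problem is solved by
  compactness. The constants then hold for all minimizers at once, as limits of minimizers require.
  Regularity of \<open>u\<close> is read off from perturbations of minimizers by affine functions.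
  They give one-sided quadratic bounds; at interior times the bounds from the two sides meet, while
  at the final time only the upper one is available, which is why \<open>W\<close> may have corners.
  Infima over C1 curves, over curves with a corner and over (HS) solutions all coincide, and this
  ties \<open>u\<close>, dynamic programming and \<open>Uostar\<close> together.\<close>

text \<open>The bounds are uniform in \<open>x\<close> because (CNH) makes \<open>H\<close> independent of \<open>x\<close> outside a compact interval.
  The hypotheses are stable under replacing \<open>H(x, p)\<close> by \<open>H(x, -p)\<close>.\<close>

locale ham =
  fixes H :: "real \<Rightarrow> real \<Rightarrow> real"
  assumes joint: "\<And>x p. ((\<lambda>z. H (fst z) (snd z)) has_derivative
        (\<lambda>h. dHx H x p * fst h + dHp H x p * snd h)) (at (x, p))"
    and bnd: "\<And>B. \<exists>D. \<forall>x p. \<bar>p\<bar> \<le> B \<longrightarrow> \<bar>H x p\<bar> \<le> D \<and> \<bar>dHx H x p\<bar> \<le> D \<and> \<bar>dHp H x p\<bar> \<le> D"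
    and lip: "\<And>B. \<exists>D. \<forall>x p y r. \<bar>p\<bar> \<le> B \<longrightarrow> \<bar>r\<bar> \<le> B \<longrightarrow>
        \<bar>dHx H x p - dHx H y r\<bar> \<le> D * (\<bar>x - y\<bar> + \<bar>p - r\<bar>) \<and>
        \<bar>dHp H x p - dHp H y r\<bar> \<le> D * (\<bar>x - y\<bar> + \<bar>p - r\<bar>)"
    and umono: "\<And>B. \<exists>c>0. \<forall>x p r. \<bar>p\<bar> \<le> B \<longrightarrow> \<bar>r\<bar> \<le> B \<longrightarrow> p \<le> r \<longrightarrow>
        c * (r - p) \<le> dHp H x r - dHp H x p"
    and coer: "\<And>M. \<exists>r>0. \<forall>x. dHp H x r > M \<and> dHp H x (- r) < - M"

lemma box_lipschitz:
  fixes f :: "real \<times> real \<Rightarrow> real"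
  assumes f: "\<And>z. (f has_derivative (\<lambda>h. f1 z * fst h + f2 z * snd h)) (at z)"
    and c: "continuous_on UNIV f1" "continuous_on UNIV f2"
  shows "\<exists>D. \<forall>x p y r. \<bar>x\<bar> \<le> X \<longrightarrow> \<bar>y\<bar> \<le> X \<longrightarrow> \<bar>p\<bar> \<le> B \<longrightarrow> \<bar>r\<bar> \<le> B \<longrightarrow>
     \<bar>f (x, p) - f (y, r)\<bar> \<le> D * (\<bar>x - y\<bar> + \<bar>p - r\<bar>)"
proof -
  let ?S = "{-X..X} \<times> {-B..B}"
  have S: "compact ?S" "convex ?S" by (auto intro: compact_Times convex_Times)
  have "continuous_on ?S (\<lambda>z. \<bar>f1 z\<bar> + \<bar>f2 z\<bar>)"
    by (intro continuous_intros continuous_on_subset[OF c(1)] continuous_on_subset[OF c(2)]) auto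
  then have "bounded ((\<lambda>z. \<bar>f1 z\<bar> + \<bar>f2 z\<bar>) ` ?S)"
    using S(1) compact_continuous_image compact_imp_bounded by blast
  then obtain D where D: "\<And>z. z \<in> ?S \<Longrightarrow> \<bar>f1 z\<bar> + \<bar>f2 z\<bar> \<le> D" "D > 0"
    unfolding bounded_pos by force
  have on: "onorm (\<lambda>h. f1 z * fst h + f2 z * snd h) \<le> D" if "z \<in> ?S" for z
  proof (rule onorm_le)
    fix h :: "real \<times> real"
    have "norm (f1 z * fst h + f2 z * snd h) \<le> \<bar>f1 z\<bar> * \<bar>fst h\<bar> + \<bar>f2 z\<bar> * \<bar>snd h\<bar>"
      by (metis abs_mult abs_triangle_ineq real_norm_def)
    also have "\<dots> \<le> \<bar>f1 z\<bar> * norm h + \<bar>f2 z\<bar> * norm h"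
      by (intro add_mono mult_left_mono)
        (use norm_fst_le[of "fst h" "snd h"] norm_snd_le[of "snd h" "fst h"] in auto)
    also have "\<dots> \<le> D * norm h" using D(1)[OF that] by (simp add: mult_right_mono flip: distrib_right)
    finally show "norm (f1 z * fst h + f2 z * snd h) \<le> D * norm h" .
  qed
  show ?thesis
  proof (intro exI[of _ D] allI impI)
    fix x p y r assume a: "\<bar>x\<bar> \<le> X" "\<bar>y\<bar> \<le> X" "\<bar>p\<bar> \<le> B" "\<bar>r\<bar> \<le> B"
    have "norm (f (x, p) - f (y, r)) \<le> D * norm ((x, p) - (y, r))"
      by (rule differentiable_bound[OF S(2) has_derivative_at_withinI[OF f] on]) (use a in auto)
    also have "\<dots> \<le> D * (\<bar>x - y\<bar> + \<bar>p - r\<bar>)"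
      using D(2) norm_Pair_le[of "x - y" "p - r"] by (intro mult_left_mono) (auto)
    finally show "\<bar>f (x, p) - f (y, r)\<bar> \<le> D * (\<bar>x - y\<bar> + \<bar>p - r\<bar>)" by simp
  qed
qed

lemma box_bounded:
  fixes f :: "real \<times> real \<Rightarrow> real"
  assumes "continuous_on UNIV f"
  shows "\<exists>D. \<forall>x p. \<bar>x\<bar> \<le> X \<longrightarrow> \<bar>p\<bar> \<le> B \<longrightarrow> \<bar>f (x, p)\<bar> \<le> D"
proof -
  have "compact (f ` ({-X..X} \<times> {-B..B}))"
    by (intro compact_continuous_image compact_Times continuous_on_subset[OF assms]) auto
  then have "bounded (f ` ({-X..X} \<times> {-B..B}))" by (rule compact_imp_bounded)
  then obtain D where "\<forall>y\<in>f ` ({-X..X} \<times> {-B..B}). norm y \<le> D"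
    unfolding bounded_iff by blast
  then have "\<bar>f (x, p)\<bar> \<le> D" if "\<bar>x\<bar> \<le> X" "\<bar>p\<bar> \<le> B" for x p using that by (auto simp: abs_le_iff)
  then show ?thesis by blast
qed

lemma Ck2_1D:
  assumes "Ck2 1 f"
  obtains f1 f2 where "\<And>z. (f has_derivative (\<lambda>h. f1 z * fst h + f2 z * snd h)) (at z)"
    "continuous_on UNIV f1" "continuous_on UNIV f2"
  using assms unfolding One_nat_def Ck2.simps by blast

lemma Ck2_continuous: "Ck2 k f \<Longrightarrow> continuous_on UNIV f"
proof (cases k)
  case (Suc m)
  assume "Ck2 k f"
  with Suc obtain f1 f2 where "\<And>z. (f has_derivative (\<lambda>h. f1 z * fst h + f2 z * snd h)) (at z)"
    by auto
  then show ?thesis using has_derivative_continuous continuous_at_imp_continuous_on by blast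
qed simp

lemma Ck2_Suc_imp: "Ck2 (Suc k) f \<Longrightarrow> Ck2 k f"
proof (induction k arbitrary: f)
  case 0
  show ?case using Ck2_continuous[OF 0] by simp
next
  case (Suc k)
  then obtain f1 f2 where f: "\<forall>z. (f has_derivative (\<lambda>h. f1 z * fst h + f2 z * snd h)) (at z)"
    "Ck2 (Suc k) f1" "Ck2 (Suc k) f2" unfolding Ck2.simps(2)[of "Suc k"] by blast
  then have "Ck2 k f1" "Ck2 k f2" using Suc.IH by blast+
  with f(1) show ?case unfolding Ck2.simps(2)[of k] by blast
qed

lemma partial_derivs:
  fixes f :: "real \<times> real \<Rightarrow> real"
  assumes "(f has_derivative (\<lambda>h. a * fst h + b * snd h)) (at (x, p))"
  shows "((\<lambda>y. f (y, p)) has_real_derivative a) (at x)" "((\<lambda>r. f (x, r)) has_real_derivative b) (at p)"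
proof -
  have "((\<lambda>y. f (y, p)) has_derivative (\<lambda>h. a * fst (h, 0::real) + b * snd (h, 0::real))) (at x)"
    by (rule has_derivative_compose[of "\<lambda>y. (y, p)", OF _ assms]) (auto intro!: derivative_eq_intros)
  then show "((\<lambda>y. f (y, p)) has_real_derivative a) (at x)" by (simp add: has_field_derivative_def)
  have "((\<lambda>r. f (x, r)) has_derivative (\<lambda>h. a * fst (0::real, h) + b * snd (0::real, h))) (at p)"
    by (rule has_derivative_compose[of "\<lambda>r. (x, r)", OF _ assms]) (auto intro!: derivative_eq_intros)
  then show "((\<lambda>r. f (x, r)) has_real_derivative b) (at p)" by (simp add: has_field_derivative_def)
qed

lemma ham_of_hyps:
  assumes C3: "C3 H" and CNH: "CNH H" and CVX: "CVX H"
  shows "ham H"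
proof -
  obtain f1 f2 where f: "\<And>z. ((\<lambda>(x, p). H x p) has_derivative (\<lambda>h. f1 z * fst h + f2 z * snd h)) (at z)"
    and k: "Ck2 (Suc 1) f1" "Ck2 (Suc 1) f2"
    using C3 unfolding C3_def numeral_3_eq_3 Ck2.simps(2)[of "Suc (Suc 0)"] One_nat_def by blast
  have k1: "Ck2 1 f1" "Ck2 1 f2" using Ck2_Suc_imp k by blast+
  obtain f11 f12 where f1: "\<And>z. (f1 has_derivative (\<lambda>h. f11 z * fst h + f12 z * snd h)) (at z)"
    "continuous_on UNIV f11" "continuous_on UNIV f12" using Ck2_1D[OF k1(1)] by blast
  obtain f21 f22 where f2: "\<And>z. (f2 has_derivative (\<lambda>h. f21 z * fst h + f22 z * snd h)) (at z)"
    "continuous_on UNIV f21" "continuous_on UNIV f22" using Ck2_1D[OF k1(2)] by blast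
  have d: "((\<lambda>y. H y p) has_real_derivative f1 (x, p)) (at x)"
      "((\<lambda>r. H x r) has_real_derivative f2 (x, p)) (at p)" for x p
    using partial_derivs[OF f[of "(x, p)"]] by auto
  have fx: "f1 (x, p) = dHx H x p" and fp: "f2 (x, p) = dHp H x p" for x p
    unfolding dHx_def dHp_def using d DERIV_imp_deriv by metis+
  obtain X where X: "X > 0" "\<And>x p. \<bar>x\<bar> \<ge> X \<Longrightarrow> dHx H x p = 0" using CNH unfolding CNH_def by blast
  \<comment> \<open>Clamping x to [-X, X] reduces every uniform estimate to a compact box:
    \<open>H\<close>, \<open>dHp H\<close> and \<open>dHx H\<close> take the same values at x and at
    \<open>cl x\<close>.\<close>
  define cl where "cl x = max (-X) (min X x)" for x
  have clX: "\<bar>cl x\<bar> \<le> X" and cl1: "\<bar>cl x - cl y\<bar> \<le> \<bar>x - y\<bar>" for x y using X(1) by (auto simp: cl_def)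
  have Hcl: "H x p = H (cl x) p" for x p
  proof -
    have z: "((\<lambda>y. H y p) has_real_derivative 0) (at y within A)" if "\<bar>y\<bar> \<ge> X" for y A
      using d(1)[where p=p and x=y] X(2)[OF that, of p] has_field_derivative_at_within by (simp add: fx)
    have 1: "\<exists>c. \<forall>x\<in>{X..}. H x p = c"
      by (rule has_field_derivative_zero_constant) (use X(1) in \<open>auto intro!: z\<close>)
    have 2: "\<exists>c. \<forall>x\<in>{..-X}. H x p = c"
      by (rule has_field_derivative_zero_constant) (use X(1) in \<open>auto intro!: z\<close>)
    show ?thesis
    proof (cases "\<bar>x\<bar> \<le> X")
      case True then show ?thesis by (simp add: cl_def)
    next
      case False
      then consider "x > X" | "x < -X" by linarith
      then show ?thesis
        by cases (use 1 2 X(1) in \<open>force simp: cl_def\<close>)+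
    qed
  qed
  have pcl: "dHp H x p = dHp H (cl x) p" for x p
  proof -
    have "H x = H (cl x)" using Hcl[of x] by blast
    then show ?thesis unfolding dHp_def by simp
  qed
  have xcl: "dHx H x p = dHx H (cl x) p" for x p
    using X(2)[of x p] X(2)[of "cl x" p] X(1)
    by (cases "\<bar>x\<bar> \<le> X") (auto simp: cl_def max_def min_def)
  \<comment> \<open>Strict monotonicity of \<open>dHp H x\<close> only yields a nonnegative
    derivative. That it never vanishes comes from the differentiable inverse: by the chain rule the
    two derivatives have product 1.\<close>
  have pos: "f22 (x, p) > 0" for x p
  proof -
    have D: "((\<lambda>r. dHp H x r) has_real_derivative f22 (x, p)) (at p)"
      using partial_derivs(2)[OF f2(1)[of "(x, p)"]] by (simp add: fp)
    have sm: "strict_mono (dHp H x)" and bij: "bij (dHp H x)" and inv: "inv (dHp H x) C1_differentiable_on UNIV"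
      using CVX by (auto simp: CVX_def)
    obtain e where e: "(inv (dHp H x) has_vector_derivative e) (at (dHp H x p))"
      using inv unfolding C1_differentiable_on_def by blast
    have "((\<lambda>r. inv (dHp H x) (dHp H x r)) has_real_derivative e * f22 (x, p)) (at p)"
      by (rule DERIV_chain2[OF _ D]) (use e in \<open>simp add: has_real_derivative_iff_has_vector_derivative\<close>)
    moreover have "inv (dHp H x) (dHp H x r) = r" for r using bij by (simp add: bij_is_inj)
    ultimately have "((\<lambda>r. r) has_real_derivative e * f22 (x, p)) (at p)" by simp
    then have "e * f22 (x, p) = 1" by (rule DERIV_unique) (rule DERIV_ident)
    then have "f22 (x, p) \<noteq> 0" by auto
    moreover have "f22 (x, p) \<ge> 0"
    proof (rule ccontr)
      assume "\<not> 0 \<le> f22 (x, p)"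
      then obtain dd where "dd > 0" "\<And>h. 0 < h \<Longrightarrow> h < dd \<Longrightarrow> dHp H x p > dHp H x (p + h)"
        using DERIV_neg_dec_right[OF D] by auto
      then have "dHp H x (p + dd/2) < dHp H x p" by simp
      then show False using sm \<open>dd > 0\<close> by (smt (verit) field_sum_of_halves strict_mono_less)
    qed
    ultimately show ?thesis by simp
  qed
  have cH: "continuous_on UNIV (\<lambda>(x, p). H x p)"
    using f has_derivative_continuous continuous_at_imp_continuous_on by blast
  show ?thesis
  proof
    show "((\<lambda>z. H (fst z) (snd z)) has_derivative (\<lambda>h. dHx H x p * fst h + dHp H x p * snd h)) (at (x, p))" for x p
      using f[of "(x, p)"] by (simp add: fx fp case_prod_unfold)
  next
    fix B :: real
    obtain D1 where D1: "\<And>x p. \<bar>x\<bar> \<le> X \<Longrightarrow> \<bar>p\<bar> \<le> B \<Longrightarrow> \<bar>H x p\<bar> \<le> D1"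
      using box_bounded[OF cH, of X B] by auto
    obtain D2 where D2: "\<And>x p. \<bar>x\<bar> \<le> X \<Longrightarrow> \<bar>p\<bar> \<le> B \<Longrightarrow> \<bar>dHx H x p\<bar> \<le> D2"
      using box_bounded[OF Ck2_continuous[OF k1(1)], of X B] by (auto simp: fx)
    obtain D3 where D3: "\<And>x p. \<bar>x\<bar> \<le> X \<Longrightarrow> \<bar>p\<bar> \<le> B \<Longrightarrow> \<bar>dHp H x p\<bar> \<le> D3"
      using box_bounded[OF Ck2_continuous[OF k1(2)], of X B] by (auto simp: fp)
    show "\<exists>D. \<forall>x p. \<bar>p\<bar> \<le> B \<longrightarrow> \<bar>H x p\<bar> \<le> D \<and> \<bar>dHx H x p\<bar> \<le> D \<and> \<bar>dHp H x p\<bar> \<le> D"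
    proof (intro exI[of _ "max D1 (max D2 D3)"] allI impI)
      fix x p assume "\<bar>p\<bar> \<le> B"
      then show "\<bar>H x p\<bar> \<le> max D1 (max D2 D3) \<and> \<bar>dHx H x p\<bar> \<le> max D1 (max D2 D3) \<and> \<bar>dHp H x p\<bar> \<le> max D1 (max D2 D3)"
        using D1[OF clX, of p x] D2[OF clX, of p x] D3[OF clX, of p x] Hcl[of x p] xcl[of x p] pcl[of x p] by auto
    qed
    obtain E1 where E1: "\<And>x p y r. \<bar>x\<bar> \<le> X \<Longrightarrow> \<bar>y\<bar> \<le> X \<Longrightarrow> \<bar>p\<bar> \<le> B \<Longrightarrow> \<bar>r\<bar> \<le> B \<Longrightarrow>
        \<bar>dHx H x p - dHx H y r\<bar> \<le> E1 * (\<bar>x - y\<bar> + \<bar>p - r\<bar>)"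
      using box_lipschitz[OF f1, of X B] unfolding fx by blast
    obtain E2 where E2: "\<And>x p y r. \<bar>x\<bar> \<le> X \<Longrightarrow> \<bar>y\<bar> \<le> X \<Longrightarrow> \<bar>p\<bar> \<le> B \<Longrightarrow> \<bar>r\<bar> \<le> B \<Longrightarrow>
        \<bar>dHp H x p - dHp H y r\<bar> \<le> E2 * (\<bar>x - y\<bar> + \<bar>p - r\<bar>)"
      using box_lipschitz[OF f2, of X B] unfolding fp by blast
    show "\<exists>D. \<forall>x p y r. \<bar>p\<bar> \<le> B \<longrightarrow> \<bar>r\<bar> \<le> B \<longrightarrow>
        \<bar>dHx H x p - dHx H y r\<bar> \<le> D * (\<bar>x - y\<bar> + \<bar>p - r\<bar>) \<and>
        \<bar>dHp H x p - dHp H y r\<bar> \<le> D * (\<bar>x - y\<bar> + \<bar>p - r\<bar>)"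
    proof (intro exI[of _ "\<bar>E1\<bar> + \<bar>E2\<bar>"] allI impI)
      fix x p y r assume a: "\<bar>p\<bar> \<le> B" "\<bar>r\<bar> \<le> B"
      have *: "E * (\<bar>cl x - cl y\<bar> + \<bar>p - r\<bar>) \<le> (\<bar>E1\<bar> + \<bar>E2\<bar>) * (\<bar>x - y\<bar> + \<bar>p - r\<bar>)" if "E \<in> {E1, E2}" for E
        by (rule mult_mono) (use that cl1[of x y] in auto)
      show "\<bar>dHx H x p - dHx H y r\<bar> \<le> (\<bar>E1\<bar> + \<bar>E2\<bar>) * (\<bar>x - y\<bar> + \<bar>p - r\<bar>) \<and>
        \<bar>dHp H x p - dHp H y r\<bar> \<le> (\<bar>E1\<bar> + \<bar>E2\<bar>) * (\<bar>x - y\<bar> + \<bar>p - r\<bar>)"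
        using order_trans[OF E1[OF clX clX a, of x y] *] order_trans[OF E2[OF clX clX a, of x y] *]
        unfolding xcl[of x p, symmetric] pcl[of x p, symmetric] xcl[of y r, symmetric] pcl[of y r, symmetric]
        by simp
    qed
    have "compact ({-X..X} \<times> {-B..B})" by (intro compact_Times) auto
    show "\<exists>c>0. \<forall>x p r. \<bar>p\<bar> \<le> B \<longrightarrow> \<bar>r\<bar> \<le> B \<longrightarrow> p \<le> r \<longrightarrow> c * (r - p) \<le> dHp H x r - dHp H x p"
    proof (cases "B \<ge> 0")
      case False then show ?thesis by (intro exI[of _ 1]) auto
    next
      case True
      \<comment> \<open>The modulus of convexity on the strip is the minimum of the continuous
        positive function \<open>f22\<close> over a compact box.\<close>
      have "\<exists>z\<in>{-X..X} \<times> {-B..B}. \<forall>w\<in>{-X..X} \<times> {-B..B}. f22 z \<le> f22 w"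
        by (rule continuous_attains_inf) (use True X(1) \<open>compact _\<close> continuous_on_subset[OF f2(3)] in auto)
      then obtain z where z: "\<And>w. w \<in> {-X..X} \<times> {-B..B} \<Longrightarrow> f22 z \<le> f22 w" by blast
      show ?thesis
      proof (intro exI[of _ "f22 z"] conjI allI impI)
        show "f22 z > 0" using pos[of "fst z" "snd z"] by simp
        fix x p r assume a: "\<bar>p\<bar> \<le> B" "\<bar>r\<bar> \<le> B" "p \<le> r"
        show "f22 z * (r - p) \<le> dHp H x r - dHp H x p"
        proof (cases "p = r")
          case False
          then have "p < r" using a by simp
          then obtain \<xi> where \<xi>: "p < \<xi>" "\<xi> < r" "dHp H (cl x) r - dHp H (cl x) p = (r - p) * f22 (cl x, \<xi>)"
            using MVT2[of p r "dHp H (cl x)" "\<lambda>s. f22 (cl x, s)"] partial_derivs(2)[OF f2(1)] by (auto simp: fp)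
          have "f22 z \<le> f22 (cl x, \<xi>)" by (rule z) (use clX[of x] a \<xi> in auto)
          then show ?thesis using \<xi> \<open>p < r\<close> pcl[of x] by (simp add: mult.commute)
        qed simp
      qed
    qed
  next
    fix M :: real
    have sm: "strict_mono (dHp H x)" and surj: "surj (dHp H x)" for x
      using CVX by (auto simp: CVX_def bij_is_surj)
    \<comment> \<open>Surjectivity is given for each x separately. Uniformity is by contradiction:
      bad points accumulate at some \<open>l\<close>, and momenta \<open>a\<close>, \<open>b\<close>
      that carry \<open>dHp H l\<close> beyond M and -M still do so near \<open>l\<close>.\<close>
    have "\<exists>n::nat. \<forall>x. \<bar>x\<bar> \<le> X \<longrightarrow> dHp H x (real (Suc n)) > M \<and> dHp H x (- real (Suc n)) < - M"
    proof (rule ccontr)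
      assume "\<not> ?thesis"
      then have "\<forall>n. \<exists>x. \<bar>x\<bar> \<le> X \<and> \<not> (dHp H x (real (Suc n)) > M \<and> dHp H x (- real (Suc n)) < - M)" by blast
      then obtain x where x: "\<And>n. \<bar>x n\<bar> \<le> X" "\<And>n. \<not> (dHp H (x n) (real (Suc n)) > M \<and> dHp H (x n) (- real (Suc n)) < - M)" by metis
      have "\<forall>n. x n \<in> {-X..X}" using x(1) by (auto simp: abs_le_iff) (metis minus_le_iff)
      then obtain l r where lr: "strict_mono (r::nat\<Rightarrow>nat)" "(x \<circ> r) \<longlonglongrightarrow> l"
        using compact_Icc[of "-X" X] unfolding compact_def by blast
      obtain a where a: "dHp H l a = M + 1" using surj by (metis surjD)
      obtain b where b: "dHp H l b = - M - 1" using surj by (metis surjD)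
      have lim: "(\<lambda>n. dHp H (x (r n)) s) \<longlonglongrightarrow> dHp H l s" for s
      proof -
        have "isCont f2 (l, s)" using Ck2_continuous[OF k1(2)] continuous_on_eq_continuous_at by blast
        moreover have "(\<lambda>n. (x (r n), s)) \<longlonglongrightarrow> (l, s)" using lr(2) by (auto intro!: tendsto_intros simp: o_def)
        ultimately have "(\<lambda>n. f2 (x (r n), s)) \<longlonglongrightarrow> f2 (l, s)" using isCont_tendsto_compose by blast
        then show ?thesis by (simp add: fp)
      qed
      have "eventually (\<lambda>n. dHp H (x (r n)) a > M) sequentially"
        by (rule order_tendstoD(1)[OF lim]) (simp add: a)
      moreover have "eventually (\<lambda>n. dHp H (x (r n)) b < - M) sequentially"
        by (rule order_tendstoD(2)[OF lim]) (simp add: b)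
      moreover have "eventually (\<lambda>n. real n \<ge> max a (- b)) sequentially"
        by (rule eventually_at_top_linorderI[of "nat \<lceil>max a (- b)\<rceil>"]) linarith
      ultimately have "eventually (\<lambda>n. False) sequentially"
      proof eventually_elim
        case (elim n)
        have rn: "real n \<le> real (r n)" using seq_suble[OF lr(1)] by simp
        have "dHp H (x (r n)) (real (Suc (r n))) \<ge> dHp H (x (r n)) a"
          using elim rn by (intro monoD[OF strict_mono_mono[OF sm]]) auto
        moreover have "dHp H (x (r n)) (- real (Suc (r n))) \<le> dHp H (x (r n)) b"
          using elim rn by (intro monoD[OF strict_mono_mono[OF sm]]) auto
        ultimately show False using x(2)[of "r n"] elim by auto
      qed
      then show False by simp
    qed
    then obtain n where "\<And>x. \<bar>x\<bar> \<le> X \<Longrightarrow> dHp H x (real (Suc n)) > M \<and> dHp H x (- real (Suc n)) < - M" by blast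
    then show "\<exists>r>0. \<forall>x. dHp H x r > M \<and> dHp H x (- r) < - M"
      using clX pcl by (intro exI[of _ "real (Suc n)"]) (metis of_nat_0_less_iff zero_less_Suc)
  qed
qed

section \<open>The Lagrangian\<close>

context ham begin

abbreviation Hx where "Hx \<equiv> dHx H"
abbreviation Hp where "Hp \<equiv> dHp H"

lemma H_dx: "((\<lambda>y. H y p) has_real_derivative Hx x p) (at x)"
  and H_dp: "(H x has_real_derivative Hp x p) (at p)"
  using partial_derivs[OF joint[of x p]] by simp_all

lemma bounds:
  obtains D where "D > 0" "\<And>x p. \<bar>p\<bar> \<le> B \<Longrightarrow> \<bar>H x p\<bar> \<le> D" "\<And>x p. \<bar>p\<bar> \<le> B \<Longrightarrow> \<bar>Hx x p\<bar> \<le> D"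
    "\<And>x p. \<bar>p\<bar> \<le> B \<Longrightarrow> \<bar>Hp x p\<bar> \<le> D"
proof -
  obtain D where "\<forall>x p. \<bar>p\<bar> \<le> B \<longrightarrow> \<bar>H x p\<bar> \<le> D \<and> \<bar>Hx x p\<bar> \<le> D \<and> \<bar>Hp x p\<bar> \<le> D"
    using bnd by blast
  then show ?thesis by (intro that[of "max D 1"]) (auto simp: le_max_iff_disj)
qed

lemma lipschitz:
  obtains D where "D > 0"
    "\<And>x p y r. \<bar>p\<bar> \<le> B \<Longrightarrow> \<bar>r\<bar> \<le> B \<Longrightarrow> \<bar>Hx x p - Hx y r\<bar> \<le> D * (\<bar>x - y\<bar> + \<bar>p - r\<bar>)"
    "\<And>x p y r. \<bar>p\<bar> \<le> B \<Longrightarrow> \<bar>r\<bar> \<le> B \<Longrightarrow> \<bar>Hp x p - Hp y r\<bar> \<le> D * (\<bar>x - y\<bar> + \<bar>p - r\<bar>)"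
    "\<And>x p y r. \<bar>p\<bar> \<le> B \<Longrightarrow> \<bar>r\<bar> \<le> B \<Longrightarrow> \<bar>H x p - H y r\<bar> \<le> D * (\<bar>x - y\<bar> + \<bar>p - r\<bar>)"
proof -
  obtain D where D: "\<forall>x p y r. \<bar>p\<bar> \<le> B \<longrightarrow> \<bar>r\<bar> \<le> B \<longrightarrow>
        \<bar>Hx x p - Hx y r\<bar> \<le> D * (\<bar>x - y\<bar> + \<bar>p - r\<bar>) \<and>
        \<bar>Hp x p - Hp y r\<bar> \<le> D * (\<bar>x - y\<bar> + \<bar>p - r\<bar>)"
    using lip by blast
  obtain E where E: "E > 0" "\<And>x p. \<bar>p\<bar> \<le> B \<Longrightarrow> \<bar>Hx x p\<bar> \<le> E" "\<And>x p. \<bar>p\<bar> \<le> B \<Longrightarrow> \<bar>Hp x p\<bar> \<le> E"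
    using bounds by metis
  have mono: "D * (\<bar>x - y\<bar> + \<bar>p - r\<bar>) \<le> max D E * (\<bar>x - y\<bar> + \<bar>p - r\<bar>)"
    "E * (\<bar>x - y\<bar> + \<bar>p - r\<bar>) \<le> max D E * (\<bar>x - y\<bar> + \<bar>p - r\<bar>)" for x y p r :: real
    by (auto intro!: mult_right_mono)
  show ?thesis
  proof (rule that[of "max D E"])
    fix x p y r assume a: "\<bar>p\<bar> \<le> B" "\<bar>r\<bar> \<le> B"
    show "\<bar>Hx x p - Hx y r\<bar> \<le> max D E * (\<bar>x - y\<bar> + \<bar>p - r\<bar>)"
         "\<bar>Hp x p - Hp y r\<bar> \<le> max D E * (\<bar>x - y\<bar> + \<bar>p - r\<bar>)"
      using D a mono(1) order_trans by blast+
    have "norm (H x p - H y p) \<le> E * norm (x - y)"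
      by (rule field_differentiable_bound[of UNIV "\<lambda>x. H x p" "\<lambda>x. Hx x p"]) (use H_dx E a in auto)
    moreover have "norm (H y p - H y r) \<le> E * norm (p - r)"
      by (rule field_differentiable_bound[of "{-B..B}" "H y" "Hp y"])
        (use has_field_derivative_at_within[OF H_dp] E a in auto)
    ultimately have "\<bar>H x p - H y r\<bar> \<le> E * (\<bar>x - y\<bar> + \<bar>p - r\<bar>)"
      unfolding real_norm_def distrib_left by linarith
    with mono(2) show "\<bar>H x p - H y r\<bar> \<le> max D E * (\<bar>x - y\<bar> + \<bar>p - r\<bar>)"
      using order_trans by blast
  qed (use E in auto)
qed

lemma Hp_less: "p < r \<Longrightarrow> Hp x p < Hp x r"
proof -
  assume pr: "p < r"
  obtain c where "c > 0" "c * (r - p) \<le> Hp x r - Hp x p"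
    using umono[of "max \<bar>p\<bar> \<bar>r\<bar>"] pr by (smt (verit, best) max.cobounded1 max.cobounded2)
  then show ?thesis using pr by (smt (verit) mult_pos_pos)
qed

lemma Hp_le_iff: "Hp x p \<le> Hp x r \<longleftrightarrow> p \<le> r"
  using Hp_less by (metis linorder_not_less order_less_le)

text \<open>Recovered from the Lipschitz bounds on strips, taken with one unit of room around
  \<open>p\<close>.\<close>

lemma continuous_Hp_Hx:
  "continuous_on UNIV (\<lambda>z. Hp (fst z) (snd z))" "continuous_on UNIV (\<lambda>z. Hx (fst z) (snd z))"
  "continuous_on UNIV (\<lambda>z. H (fst z) (snd z))"
proof -
  have aux: "isCont (\<lambda>z. f (fst z) (snd z)) (x, p)"
    if f: "\<And>B. \<exists>D>0. \<forall>x p y r. \<bar>p\<bar> \<le> B \<longrightarrow> \<bar>r\<bar> \<le> B \<longrightarrow> \<bar>f x p - f y r\<bar> \<le> D * (\<bar>x - y\<bar> + \<bar>p - r\<bar>)"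
    for f :: "real \<Rightarrow> real \<Rightarrow> real" and x p
  proof -
    obtain D where D: "D > 0" "\<And>x s y r. \<bar>s\<bar> \<le> \<bar>p\<bar> + 1 \<Longrightarrow> \<bar>r\<bar> \<le> \<bar>p\<bar> + 1 \<Longrightarrow> \<bar>f x s - f y r\<bar> \<le> D * (\<bar>x - y\<bar> + \<bar>s - r\<bar>)"
      using f[of "\<bar>p\<bar> + 1"] by blast
    have "((\<lambda>z. f (fst z) (snd z) - f x p) \<longlongrightarrow> 0) (at (x, p))"
    proof (rule Lim_null_comparison)
      have "eventually (\<lambda>z. \<bar>snd z - p\<bar> < 1) (at (x, p))"
        using tendsto_snd[OF tendsto_ident_at[of "(x,p)" UNIV]] by (auto dest!: tendstoD[of _ _ _ 1] simp: dist_real_def)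
      then show "\<forall>\<^sub>F z in at (x, p). norm (f (fst z) (snd z) - f x p) \<le> D * (\<bar>fst z - x\<bar> + \<bar>snd z - p\<bar>)"
        by (rule eventually_mono) (use D(2) in auto)
      have "((\<lambda>z. D * (\<bar>fst z - x\<bar> + \<bar>snd z - p\<bar>)) \<longlongrightarrow> D * (\<bar>fst (x, p) - x\<bar> + \<bar>snd (x,p) - p\<bar>)) (at (x, p))"
        by (intro tendsto_intros)
      then show "((\<lambda>z. D * (\<bar>fst z - x\<bar> + \<bar>snd z - p\<bar>)) \<longlongrightarrow> 0) (at (x, p))" by simp
    qed
    then show ?thesis by (simp add: isCont_def LIM_zero_iff)
  qed
  have "isCont (\<lambda>z. Hp (fst z) (snd z)) (x, p)" "isCont (\<lambda>z. Hx (fst z) (snd z)) (x, p)"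
    "isCont (\<lambda>z. H (fst z) (snd z)) (x, p)" for x p
    by (rule aux; metis lipschitz)+
  then show "continuous_on UNIV (\<lambda>z. Hp (fst z) (snd z))" "continuous_on UNIV (\<lambda>z. Hx (fst z) (snd z))"
    "continuous_on UNIV (\<lambda>z. H (fst z) (snd z))"
    by (auto simp: continuous_on_eq_continuous_at)
qed

lemma continuous_on_ham [continuous_intros]:
  assumes "continuous_on S f" "continuous_on S g"
  shows "continuous_on S (\<lambda>x. Hp (f x) (g x))" "continuous_on S (\<lambda>x. Hx (f x) (g x))"
    "continuous_on S (\<lambda>x. H (f x) (g x))"
  using continuous_on_compose2[OF continuous_Hp_Hx(1) continuous_on_Pair[OF assms]]
    continuous_on_compose2[OF continuous_Hp_Hx(2) continuous_on_Pair[OF assms]]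
    continuous_on_compose2[OF continuous_Hp_Hx(3) continuous_on_Pair[OF assms]] by simp_all

lemma tendsto_ham [tendsto_intros]:
  assumes "(f \<longlongrightarrow> a) F" "(g \<longlongrightarrow> b) F"
  shows "((\<lambda>x. Hp (f x) (g x)) \<longlongrightarrow> Hp a b) F" "((\<lambda>x. Hx (f x) (g x)) \<longlongrightarrow> Hx a b) F"
    "((\<lambda>x. H (f x) (g x)) \<longlongrightarrow> H a b) F"
proof -
  have "isCont (\<lambda>z. Hp (fst z) (snd z)) (a, b)" "isCont (\<lambda>z. Hx (fst z) (snd z)) (a, b)"
    "isCont (\<lambda>z. H (fst z) (snd z)) (a, b)"
    using continuous_Hp_Hx by (auto simp: continuous_on_eq_continuous_at)
  from this[THEN isCont_tendsto_compose, OF tendsto_Pair[OF assms]]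
  show "((\<lambda>x. Hp (f x) (g x)) \<longlongrightarrow> Hp a b) F" "((\<lambda>x. Hx (f x) (g x)) \<longlongrightarrow> Hx a b) F"
    "((\<lambda>x. H (f x) (g x)) \<longlongrightarrow> H a b) F" by simp_all
qed

lemma Hp_surj: "\<exists>p. Hp x p = v"
proof -
  obtain r where r: "r > 0" "\<And>x. Hp x r > \<bar>v\<bar>" "\<And>x. Hp x (- r) < - \<bar>v\<bar>" using coer by blast
  have "\<exists>p. - r \<le> p \<and> p \<le> r \<and> Hp x p = v"
    by (rule IVT') (use r(1) r(2,3)[of x] in \<open>auto intro!: continuous_intros\<close>)
  then show ?thesis by blast
qed

text \<open>The inverse of the Legendre map \<open>Hp x\<close>; as a function of v it is the
  derivative of \<open>Lag H x\<close>.\<close>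

definition mom :: "real \<Rightarrow> real \<Rightarrow> real" where
  "mom x v = (THE p. Hp x p = v)"

lemma Hp_inj: "Hp x p = Hp x r \<Longrightarrow> p = r"
  using Hp_less by (metis less_irrefl linorder_neqE_linordered_idom)

lemma Hp_mom [simp]: "Hp x (mom x v) = v"
proof -
  obtain p where "Hp x p = v" using Hp_surj by blast
  then have "\<exists>!p. Hp x p = v" using Hp_inj by blast
  then show ?thesis unfolding mom_def by (rule theI')
qed

lemma mom_Hp [simp]: "mom x (Hp x p) = p"
  by (rule Hp_inj) (rule Hp_mom)

lemma mom_bound:
  obtains r where "r > 0" "\<And>x v. \<bar>v\<bar> \<le> M \<Longrightarrow> \<bar>mom x v\<bar> \<le> r"
proof -
  obtain r where r: "r > 0" "\<And>x. Hp x r > M" "\<And>x. Hp x (- r) < - M" using coer by blast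
  have "\<bar>mom x v\<bar> \<le> r" if "\<bar>v\<bar> \<le> M" for x v
  proof -
    have "Hp x (mom x v) \<le> Hp x r" "Hp x (- r) \<le> Hp x (mom x v)"
      using that r(2,3)[of x] by auto
    then show ?thesis unfolding Hp_le_iff by linarith
  qed
  with r(1) show ?thesis using that by blast
qed

text \<open>Convexity of \<open>H x\<close>, from the increasing derivative and the mean value
  theorem. It identifies the maximizer in the Legendre transform.\<close>

lemma H_tangent: "H x p \<ge> H x r + Hp x r * (p - r)"
proof -
  consider "p < r" | "p = r" | "p > r" by linarith
  then show ?thesis
  proof cases
    case 1
    then obtain z where "p < z" "z < r" "H x r - H x p = (r - p) * Hp x z"
      using MVT2[of p r "H x" "Hp x"] H_dp by auto
    moreover have "(r - p) * Hp x z \<le> (r - p) * Hp x r"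
      using calculation 1 by (intro mult_left_mono) (auto simp: Hp_le_iff)
    ultimately show ?thesis by (simp add: algebra_simps)
  next
    case 3
    then obtain z where "r < z" "z < p" "H x p - H x r = (p - r) * Hp x z"
      using MVT2[of r p "H x" "Hp x"] H_dp by auto
    moreover have "(p - r) * Hp x z \<ge> (p - r) * Hp x r"
      using calculation 3 by (intro mult_left_mono) (auto simp: Hp_le_iff)
    ultimately show ?thesis by (simp add: algebra_simps)
  qed simp
qed

lemma Lag_mom: "Lag H x v = mom x v * v - H x (mom x v)"
proof -
  have "p * v - H x p \<le> mom x v * v - H x (mom x v)" for p
    using H_tangent[of x "mom x v" p] by (simp add: algebra_simps)
  then show ?thesis unfolding Lag_def by (intro cSup_eq_maximum) auto
qed

lemma Lag_ge: "p * v - H x p \<le> Lag H x v"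
  using H_tangent[of x "mom x v" p] by (simp add: algebra_simps Lag_mom)

text \<open>The Lagrangian in the variables (x, p); its integral along a solution of (HS) is the
  action.\<close>

definition ell :: "real \<Rightarrow> real \<Rightarrow> real" where
  "ell x p = p * Hp x p - H x p"

lemma Lag_Hp: "Lag H x (Hp x p) = ell x p"
  by (simp add: Lag_mom ell_def)

text \<open>Restricting the Legendre transform to \<open>\<bar>p\<bar> \<le> R\<close> gives a Lagrangian below \<^term>\<open>Lag H\<close> that is
  globally Lipschitz, and which agrees with it wherever the optimal momentum has size at most \<open>R\<close>.\<close>

definition tmom :: "real \<Rightarrow> real \<Rightarrow> real \<Rightarrow> real" where
  "tmom R x v = max (- R) (min R (mom x v))"

definition tLag :: "real \<Rightarrow> real \<Rightarrow> real \<Rightarrow> real" where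
  "tLag R x v = tmom R x v * v - H x (tmom R x v)"

lemma tmom_bound: "R \<ge> 0 \<Longrightarrow> \<bar>tmom R x v\<bar> \<le> R"
  unfolding tmom_def by auto

text \<open>As \<open>p * v - H x p\<close> is concave in p, its maximizer over [-R, R] is the
  projection of the unconstrained maximizer \<open>mom x v\<close>. The proof checks the variational
  inequality of this projection and combines it with \<open>H_tangent\<close>.\<close>

lemma tLag_ge:
  assumes "\<bar>p\<bar> \<le> R" shows "p * v - H x p \<le> tLag R x v"
proof -
  have *: "H x p \<ge> H x r + Hp x r * (p - r)" for r by (rule H_tangent)
  have "0 \<le> (v - Hp x (tmom R x v)) * (tmom R x v - p)"
  proof -
    consider "\<bar>mom x v\<bar> \<le> R" | "mom x v > R" | "mom x v < - R" by linarith
    then show ?thesis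
    proof cases
      case 1 then have "tmom R x v = mom x v" by (auto simp: tmom_def)
      then show ?thesis by simp
    next
      case 2 then have "tmom R x v = R" using assms by (auto simp: tmom_def)
      moreover have "Hp x R \<le> v" using 2 Hp_le_iff[of x R "mom x v"] by simp
      ultimately show ?thesis using assms by simp
    next
      case 3 then have "tmom R x v = - R" using assms by (auto simp: tmom_def)
      moreover have "v \<le> Hp x (- R)" using 3 Hp_le_iff[of x "mom x v" "- R"] by simp
      ultimately show ?thesis using assms by (simp add: mult_nonpos_nonpos)
    qed
  qed
  then show ?thesis using *[of "tmom R x v"] by (simp add: tLag_def algebra_simps)
qed

text \<open>The strict inequality says that the clamp is inactive, so the truncated maximizer is the
  true one and determines the velocity.\<close>

lemma tmom_less:
  assumes "\<bar>tmom R x v\<bar> < R" shows "v = Hp x (tmom R x v)"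
proof -
  have "tmom R x v = mom x v" using assms unfolding tmom_def by linarith
  then show ?thesis by simp
qed

lemma tLag_ell:
  assumes "\<bar>tmom R x v\<bar> < R" shows "tLag R x v = ell x (tmom R x v)"
  unfolding tLag_def ell_def using tmom_less[OF assms] by simp

text \<open>Strong convexity inverted: on a strip
  \<open>c * \<bar>p - s\<bar> \<le> \<bar>Hp x p - Hp x s\<bar>\<close>, which controls
  \<open>mom\<close> in v; comparing \<open>Hp x\<close> with \<open>Hp y\<close> adds the
  dependence on x.\<close>

lemma mom_lipschitz:
  obtains C where "C > 0" "\<And>x y v w. \<bar>v\<bar> \<le> M \<Longrightarrow> \<bar>w\<bar> \<le> M \<Longrightarrow> \<bar>mom x v - mom y w\<bar> \<le> C * (\<bar>x - y\<bar> + \<bar>v - w\<bar>)"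
proof -
  obtain r where r: "r > 0" "\<And>x v. \<bar>v\<bar> \<le> M \<Longrightarrow> \<bar>mom x v\<bar> \<le> r" using mom_bound[of M] by metis
  obtain c where c: "c > 0" "\<And>x p s. \<bar>p\<bar> \<le> r \<Longrightarrow> \<bar>s\<bar> \<le> r \<Longrightarrow> p \<le> s \<Longrightarrow> c * (s - p) \<le> Hp x s - Hp x p"
    using umono by blast
  obtain D where D: "D > 0" "\<And>x p y s. \<bar>p\<bar> \<le> r \<Longrightarrow> \<bar>s\<bar> \<le> r \<Longrightarrow> \<bar>Hp x p - Hp y s\<bar> \<le> D * (\<bar>x - y\<bar> + \<bar>p - s\<bar>)"
    using lipschitz by metis
  have ch: "c * \<bar>p - s\<bar> \<le> \<bar>Hp x p - Hp x s\<bar>" if "\<bar>p\<bar> \<le> r" "\<bar>s\<bar> \<le> r" for x p s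
    using c(2)[of p s x] c(2)[of s p x] that by (cases "p \<le> s") (auto simp: algebra_simps abs_if)
  show ?thesis
  proof (rule that[of "(D + 1) / c"])
    show "(D + 1) / c > 0" using c D by simp
    fix x y v w assume a: "\<bar>v\<bar> \<le> M" "\<bar>w\<bar> \<le> M"
    have "c * \<bar>mom x v - mom y w\<bar> \<le> \<bar>Hp x (mom x v) - Hp x (mom y w)\<bar>"
      by (rule ch) (use r a in auto)
    also have "\<dots> \<le> \<bar>v - w\<bar> + \<bar>Hp x (mom y w) - Hp y (mom y w)\<bar>" by simp
    also have "\<dots> \<le> \<bar>v - w\<bar> + D * \<bar>x - y\<bar>" using D(2)[of "mom y w" "mom y w" x y] r a by simp
    also have "\<dots> \<le> (D + 1) * (\<bar>x - y\<bar> + \<bar>v - w\<bar>)" using D(1) by (simp add: algebra_simps)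
    finally show "\<bar>mom x v - mom y w\<bar> \<le> (D + 1) / c * (\<bar>x - y\<bar> + \<bar>v - w\<bar>)"
      using c(1) by (simp add: field_simps)
  qed
qed

lemma tmom_lipschitz:
  assumes "\<bar>mom x v - mom y w\<bar> \<le> C"
  shows "\<bar>tmom R x v - tmom R y w\<bar> \<le> C"
  using assms unfolding tmom_def by (auto simp: max_def min_def)

text \<open>A semiconcavity estimate with explicit gradient \<open>(- Hx, tmom)\<close>. Testing the
  supremum at (x, v) with the maximizer r of (y, w) leaves
  \<open>r * (w - v) - (H y r - H x r)\<close>, and exchanging r for \<open>tmom R x v\<close> costs
  a quadratic error because \<open>tmom\<close> is Lipschitz. An upper bound suffices, since it is
  applied to competitors of minimizers.\<close>

lemma tLag_upper:
  assumes "R \<ge> 0"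
  obtains C where "C > 0" "\<And>x y v w. \<bar>v\<bar> \<le> M \<Longrightarrow> \<bar>w\<bar> \<le> M \<Longrightarrow>
    tLag R y w \<le> tLag R x v + tmom R x v * (w - v) - Hx x (tmom R x v) * (y - x) + C * (\<bar>y - x\<bar> + \<bar>w - v\<bar>)\<^sup>2"
proof -
  obtain C where C: "C > 0" "\<And>x y v w. \<bar>v\<bar> \<le> M \<Longrightarrow> \<bar>w\<bar> \<le> M \<Longrightarrow> \<bar>mom x v - mom y w\<bar> \<le> C * (\<bar>x - y\<bar> + \<bar>v - w\<bar>)"
    using mom_lipschitz by metis
  obtain D where D: "D > 0" "\<And>x p y s. \<bar>p\<bar> \<le> R \<Longrightarrow> \<bar>s\<bar> \<le> R \<Longrightarrow> \<bar>Hx x p - Hx y s\<bar> \<le> D * (\<bar>x - y\<bar> + \<bar>p - s\<bar>)"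
    using lipschitz by metis
  show ?thesis
  proof (rule that[of "C + D * (1 + C)"])
    show "C + D * (1 + C) > 0" using C(1) D(1) by (simp add: add_pos_pos)
    fix x y v w assume a: "\<bar>v\<bar> \<le> M" "\<bar>w\<bar> \<le> M"
    define p where "p = tmom R x v"
    define r where "r = tmom R y w"
    define d where "d = \<bar>y - x\<bar> + \<bar>w - v\<bar>"
    have pr: "\<bar>p\<bar> \<le> R" "\<bar>r\<bar> \<le> R" unfolding p_def r_def using tmom_bound[OF assms] by auto
    have rp: "\<bar>r - p\<bar> \<le> C * d" unfolding p_def r_def d_def
      by (rule tmom_lipschitz) (use C(2) a in auto)
    have d0: "d \<ge> 0" "\<bar>y - x\<bar> \<le> d" "\<bar>w - v\<bar> \<le> d" unfolding d_def by auto
    have H1: "\<bar>H y r - H x r - Hx x p * (y - x)\<bar> \<le> D * (1 + C) * d\<^sup>2"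
    proof -
      have "norm (H y r - H x r - (Hx x p * y - Hx x p * x)) \<le> (D * (1 + C) * d) * norm (y - x)"
      proof -
        have "norm ((H y r - Hx x p * y) - (H x r - Hx x p * x)) \<le> (D * (1 + C) * d) * norm (y - x)"
        proof (rule field_differentiable_bound[of "closed_segment x y" "\<lambda>z. H z r - Hx x p * z" "\<lambda>z. Hx z r - Hx x p"])
          fix z assume "z \<in> closed_segment x y"
          then have z: "\<bar>z - x\<bar> \<le> d" using d0 segment_bound1[of z x y] by auto
          show "((\<lambda>z. H z r - Hx x p * z) has_field_derivative Hx z r - Hx x p) (at z within closed_segment x y)"
            by (auto intro!: derivative_eq_intros has_field_derivative_at_within[OF H_dx])
          have "\<bar>Hx z r - Hx x p\<bar> \<le> D * (\<bar>z - x\<bar> + \<bar>r - p\<bar>)" using D(2) pr by blast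
          also have "\<dots> \<le> D * (d + C * d)" using D(1) z rp by (intro mult_left_mono) auto
          finally show "norm (Hx z r - Hx x p) \<le> D * (1 + C) * d" by (simp add: algebra_simps)
        qed auto
        then show ?thesis by (simp add: algebra_simps)
      qed
      also have "\<dots> \<le> (D * (1 + C) * d) * d" using d0 C(1) D(1) by (intro mult_left_mono) auto
      finally show ?thesis by (simp add: algebra_simps power2_eq_square)
    qed
    have H2: "(r - p) * (w - v) \<le> C * d\<^sup>2"
    proof -
      have "(r - p) * (w - v) \<le> \<bar>r - p\<bar> * \<bar>w - v\<bar>" by (metis abs_ge_self abs_mult)
      also have "\<dots> \<le> (C * d) * d" using rp d0 C(1) by (intro mult_mono) auto
      finally show ?thesis by (simp add: power2_eq_square)
    qed
    have "tLag R y w = r * v - H x r + r * (w - v) - (H y r - H x r)"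
      by (simp add: tLag_def r_def algebra_simps)
    also have "\<dots> \<le> tLag R x v + r * (w - v) - (H y r - H x r)" using tLag_ge[OF pr(2), of v x] by simp
    also have "\<dots> = tLag R x v + p * (w - v) + (r - p) * (w - v) - (H y r - H x r)" by (simp add: algebra_simps)
    also have "\<dots> \<le> tLag R x v + p * (w - v) - Hx x p * (y - x) + (C + D * (1 + C)) * d\<^sup>2"
      using H1 H2 by (simp add: algebra_simps abs_le_iff)
    finally show "tLag R y w \<le> tLag R x v + tmom R x v * (w - v) - Hx x (tmom R x v) * (y - x)
        + (C + D * (1 + C)) * (\<bar>y - x\<bar> + \<bar>w - v\<bar>)\<^sup>2" unfolding p_def d_def .
  qed
qed

text \<open>For velocities up to M the optimal momenta stay below some r, and truncating at that r
  changes nothing.\<close>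

lemma Lag_upper:
  obtains C where "C > 0" "\<And>x y v w. \<bar>v\<bar> \<le> M \<Longrightarrow> \<bar>w\<bar> \<le> M \<Longrightarrow>
    Lag H y w \<le> Lag H x v + mom x v * (w - v) - Hx x (mom x v) * (y - x) + C * (\<bar>y - x\<bar> + \<bar>w - v\<bar>)\<^sup>2"
proof -
  obtain r where r: "r > 0" "\<And>x v. \<bar>v\<bar> \<le> M \<Longrightarrow> \<bar>mom x v\<bar> \<le> r" using mom_bound[of M] by metis
  then have m: "tmom r x v = mom x v" if "\<bar>v\<bar> \<le> M" for x v using that unfolding tmom_def
    by (smt (verit, best))
  then have "tLag r x v = Lag H x v" if "\<bar>v\<bar> \<le> M" for x v using that by (simp add: tLag_def Lag_mom)
  with m show ?thesis using tLag_upper[of r M] r(1) that by (smt (verit, best))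
qed

text \<open>A supremum of affine functions of v with slopes at most R. This keeps the discrete value
  functions Lipschitz with a constant independent of the time step.\<close>

lemma tLag_lipschitz_v:
  assumes "R \<ge> 0" shows "\<bar>tLag R x v - tLag R x w\<bar> \<le> R * \<bar>v - w\<bar>"
proof -
  have *: "tLag R x v - tLag R x w \<le> R * \<bar>v - w\<bar>" for v w
  proof -
    have "tLag R x w \<ge> tmom R x v * w - H x (tmom R x v)" by (rule tLag_ge) (rule tmom_bound[OF assms])
    then have "tLag R x v - tLag R x w \<le> tmom R x v * (v - w)" by (simp add: tLag_def algebra_simps)
    also have "\<dots> \<le> \<bar>tmom R x v\<bar> * \<bar>v - w\<bar>" by (metis abs_ge_self abs_mult)
    also have "\<dots> \<le> R * \<bar>v - w\<bar>" using tmom_bound[OF assms] by (simp add: mult_right_mono)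
    finally show ?thesis .
  qed
  from *[of v w] *[of w v] show ?thesis by (simp add: abs_le_iff abs_minus_commute)
qed

lemma continuous_mom: "continuous_on UNIV (\<lambda>z. mom (fst z) (snd z))"
proof -
  have "isCont (\<lambda>z. mom (fst z) (snd z)) (x, p)" for x p
  proof -
    obtain C where C: "C > 0" "\<And>x y v w. \<bar>v\<bar> \<le> \<bar>p\<bar> + 1 \<Longrightarrow> \<bar>w\<bar> \<le> \<bar>p\<bar> + 1 \<Longrightarrow> \<bar>mom x v - mom y w\<bar> \<le> C * (\<bar>x - y\<bar> + \<bar>v - w\<bar>)"
      using mom_lipschitz by metis
    have "((\<lambda>z. mom (fst z) (snd z) - mom x p) \<longlongrightarrow> 0) (at (x, p))"
    proof (rule Lim_null_comparison)
      have "eventually (\<lambda>z. \<bar>snd z - p\<bar> < 1) (at (x, p))"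
        using tendsto_snd[OF tendsto_ident_at[of "(x,p)" UNIV]] by (auto dest!: tendstoD[of _ _ _ 1] simp: dist_real_def)
      then show "\<forall>\<^sub>F z in at (x, p). norm (mom (fst z) (snd z) - mom x p) \<le> C * (\<bar>fst z - x\<bar> + \<bar>snd z - p\<bar>)"
        by (rule eventually_mono) (use C(2) in auto)
      have "((\<lambda>z. C * (\<bar>fst z - x\<bar> + \<bar>snd z - p\<bar>)) \<longlongrightarrow> C * (\<bar>fst (x, p) - x\<bar> + \<bar>snd (x,p) - p\<bar>)) (at (x, p))"
        by (intro tendsto_intros)
      then show "((\<lambda>z. C * (\<bar>fst z - x\<bar> + \<bar>snd z - p\<bar>)) \<longlongrightarrow> 0) (at (x, p))" by simp
    qed
    then show ?thesis by (simp add: isCont_def LIM_zero_iff)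
  qed
  then show ?thesis by (auto simp: continuous_on_eq_continuous_at)
qed

lemma continuous_on_mom [continuous_intros]:
  assumes "continuous_on S f" "continuous_on S g"
  shows "continuous_on S (\<lambda>x. mom (f x) (g x))"
  using continuous_on_compose2[OF continuous_mom continuous_on_Pair[OF assms]] by auto

lemma continuous_on_Lag [continuous_intros]:
  assumes "continuous_on S f" "continuous_on S g"
  shows "continuous_on S (\<lambda>x. Lag H (f x) (g x))" "continuous_on S (\<lambda>x. tLag R (f x) (g x))"
    "continuous_on S (\<lambda>x. ell (f x) (g x))"
  unfolding Lag_mom tLag_def tmom_def ell_def by (intro continuous_intros assms)+

end

section \<open>The discretized minimization problem\<close>

lemma taylor_lipschitz_deriv:
  fixes f :: "real \<Rightarrow> real"
  assumes "\<And>z. z \<in> closed_segment x y \<Longrightarrow> (f has_real_derivative f' z) (at z)"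
    and "\<And>z. z \<in> closed_segment x y \<Longrightarrow> \<bar>f' z - f' x\<bar> \<le> L * \<bar>z - x\<bar>" and L: "L \<ge> 0"
  shows "\<bar>f y - f x - f' x * (y - x)\<bar> \<le> L * (y - x)\<^sup>2"
proof -
  have "norm ((f y - f' x * y) - (f x - f' x * x)) \<le> (L * \<bar>y - x\<bar>) * norm (y - x)"
  proof (rule field_differentiable_bound[of "closed_segment x y" "\<lambda>z. f z - f' x * z" "\<lambda>z. f' z - f' x"])
    fix z assume z: "z \<in> closed_segment x y"
    show "((\<lambda>z. f z - f' x * z) has_field_derivative f' z - f' x) (at z within closed_segment x y)"
      by (auto intro!: derivative_eq_intros has_field_derivative_at_within[OF assms(1)[OF z]])
    have "L * \<bar>z - x\<bar> \<le> L * \<bar>y - x\<bar>"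
      using segment_bound1[OF z] L by (intro mult_left_mono) auto
    then show "norm (f' z - f' x) \<le> L * \<bar>y - x\<bar>" using assms(2)[OF z] by simp
  qed auto
  then show ?thesis by (simp add: algebra_simps power2_eq_square flip: abs_mult)
qed

text \<open>First-order optimality in a form that tolerates a Lipschitz term: divide by small d of
  either sign. With K = 0 it yields an equation, with K the Lipschitz constant of the datum a bound
  on the initial momentum.\<close>

lemma linear_coeff_bound:
  fixes a C K e :: real
  assumes "\<And>d. \<bar>d\<bar> \<le> e \<Longrightarrow> 0 \<le> K * \<bar>d\<bar> + a * d + C * d\<^sup>2" and e: "e > 0" and C: "C \<ge> 0"
  shows "\<bar>a\<bar> \<le> K"
proof (rule field_le_epsilon)
  fix \<epsilon> :: real assume "\<epsilon> > 0"
  define t where "t = min e (\<epsilon> / (C + 1))"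
  have t: "t > 0" "t \<le> e" "C * t \<le> \<epsilon>"
  proof -
    show "t > 0" "t \<le> e" using e \<open>\<epsilon> > 0\<close> C by (auto simp: t_def)
    have "C * t \<le> (C + 1) * t" using \<open>t > 0\<close> by (simp add: algebra_simps)
    also have "\<dots> \<le> (C + 1) * (\<epsilon> / (C + 1))" using C by (intro mult_left_mono) (auto simp: t_def)
    finally show "C * t \<le> \<epsilon>" using C by simp
  qed
  have "0 \<le> K * t - \<bar>a\<bar> * t + C * t\<^sup>2"
    using assms(1)[of t] assms(1)[of "- t"] t by (cases "a \<ge> 0") (auto simp: abs_if)
  then have "0 \<le> t * (K - \<bar>a\<bar> + C * t)" by (simp add: algebra_simps power2_eq_square)
  then have "0 \<le> K - \<bar>a\<bar> + C * t" using t(1) by (simp add: zero_le_mult_iff)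
  then show "\<bar>a\<bar> \<le> K + \<epsilon>" using t(3) by linarith
qed

context ham begin

text \<open>Beyond the r where \<open>Hp\<close> exceeds 1 in modulus, convexity makes
  \<open>H\<close> grow at least linearly in p, uniformly in x.\<close>

lemma coercive_H:
  obtains R where "R > 0" "\<And>x p. H x p \<le> E \<Longrightarrow> \<bar>p\<bar> \<le> R"
proof -
  obtain r where r: "r > 0" "\<And>x. Hp x r > 1" "\<And>x. Hp x (- r) < - 1" using coer by blast
  obtain D where D: "D > 0" "\<And>x p. \<bar>p\<bar> \<le> r \<Longrightarrow> \<bar>H x p\<bar> \<le> D" using bounds by metis
  have "\<bar>p\<bar> \<le> \<bar>E\<bar> + D + r" if a: "H x p \<le> E" for x p
  proof -
    consider "\<bar>p\<bar> \<le> r" | "p > r" | "p < - r" by linarith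
    then show ?thesis
    proof cases
      case 2
      have "H x r + Hp x r * (p - r) \<le> H x p" by (rule H_tangent)
      moreover have "p - r \<le> Hp x r * (p - r)" using 2 r(2)[of x] mult_right_mono[of 1 "Hp x r" "p - r"] by simp
      moreover have "\<bar>H x r\<bar> \<le> D" using D(2)[of r x] r(1) by simp
      ultimately show ?thesis using 2 a r(1) by linarith
    next
      case 3
      have "H x (- r) + Hp x (- r) * (p + r) \<le> H x p" using H_tangent[of x "- r" p] by simp
      moreover have "- (p + r) \<le> Hp x (- r) * (p + r)"
        using 3 r(3)[of x] mult_right_mono_neg[of "Hp x (- r)" "-1" "p + r"] by simp
      moreover have "\<bar>H x (- r)\<bar> \<le> D" using D(2)[of "- r" x] r(1) by simp
      ultimately show ?thesis using 3 a r(1) by linarith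
    qed (use D(1) in auto)
  qed
  then show ?thesis using that[of "\<bar>E\<bar> + D + r"] D(1) r(1) by auto
qed

end

section \<open>The Cauchy problem: constants and the discrete value function\<close>

locale cauchy = ham +
  fixes Uo :: "real \<Rightarrow> real" and K :: real
  assumes Uo_lip: "\<And>x y. \<bar>Uo x - Uo y\<bar> \<le> K * \<bar>x - y\<bar>"
begin

lemma K_nonneg: "K \<ge> 0"
  using Uo_lip[of 1 0] abs_ge_zero[of "Uo 1 - Uo 0"] by simp

definition E0 :: real where
  "E0 = (SOME E. \<forall>x p. \<bar>p\<bar> \<le> K \<longrightarrow> H x p \<le> E)"

text \<open>The room is sized for the discrete problem. One unit of energy above \<open>E0\<close>
  absorbs the drift of the Euler scheme and one unit of momentum below \<open>Rad\<close> the change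
  over a single step, so truncation at \<open>Rad\<close> stays inactive; \<open>Rad > K\<close>
  makes each one-step minimization coercive.\<close>

definition Rad :: real where
  "Rad = (SOME R. R > K \<and> R > 1 \<and> (\<forall>x p. H x p \<le> E0 + 1 \<longrightarrow> \<bar>p\<bar> \<le> R - 1))"

definition Bd :: real where
  "Bd = (SOME D. D > 0 \<and> (\<forall>x p. \<bar>p\<bar> \<le> Rad \<longrightarrow> \<bar>H x p\<bar> \<le> D \<and> \<bar>Hx x p\<bar> \<le> D \<and> \<bar>Hp x p\<bar> \<le> D))"

definition Lp :: real where
  "Lp = (SOME D. D > 0 \<and> (\<forall>x p y r. \<bar>p\<bar> \<le> Rad \<longrightarrow> \<bar>r\<bar> \<le> Rad \<longrightarrow>
      \<bar>Hx x p - Hx y r\<bar> \<le> D * (\<bar>x - y\<bar> + \<bar>p - r\<bar>) \<and> \<bar>Hp x p - Hp y r\<bar> \<le> D * (\<bar>x - y\<bar> + \<bar>p - r\<bar>) \<and>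
      \<bar>H x p - H y r\<bar> \<le> D * (\<bar>x - y\<bar> + \<bar>p - r\<bar>)))"

lemma E0: "\<bar>p\<bar> \<le> K \<Longrightarrow> H x p \<le> E0"
proof -
  obtain D where "\<And>x p. \<bar>p\<bar> \<le> K \<Longrightarrow> \<bar>H x p\<bar> \<le> D" using bounds by metis
  then have "\<exists>E. \<forall>x p. \<bar>p\<bar> \<le> K \<longrightarrow> H x p \<le> E" by (intro exI[of _ D]) (auto simp: abs_le_iff)
  from someI_ex[OF this, folded E0_def] show "\<bar>p\<bar> \<le> K \<Longrightarrow> H x p \<le> E0" by blast
qed

lemma Rad: "Rad > K" "Rad > 1" "H x p \<le> E0 + 1 \<Longrightarrow> \<bar>p\<bar> \<le> Rad - 1"
proof -
  obtain R where "R > 0" "\<And>x p. H x p \<le> E0 + 1 \<Longrightarrow> \<bar>p\<bar> \<le> R" using coercive_H by metis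
  then have "\<exists>R. R > K \<and> R > 1 \<and> (\<forall>x p. H x p \<le> E0 + 1 \<longrightarrow> \<bar>p\<bar> \<le> R - 1)"
    by (intro exI[of _ "R + K + 1"]) (use K_nonneg in force)
  from someI_ex[OF this, folded Rad_def] show "Rad > K" "Rad > 1" "H x p \<le> E0 + 1 \<Longrightarrow> \<bar>p\<bar> \<le> Rad - 1" by blast+
qed

lemma Bd: "Bd > 0" "\<bar>p\<bar> \<le> Rad \<Longrightarrow> \<bar>H x p\<bar> \<le> Bd" "\<bar>p\<bar> \<le> Rad \<Longrightarrow> \<bar>Hx x p\<bar> \<le> Bd"
  "\<bar>p\<bar> \<le> Rad \<Longrightarrow> \<bar>Hp x p\<bar> \<le> Bd"
proof -
  have "\<exists>D. D > 0 \<and> (\<forall>x p. \<bar>p\<bar> \<le> Rad \<longrightarrow> \<bar>H x p\<bar> \<le> D \<and> \<bar>Hx x p\<bar> \<le> D \<and> \<bar>Hp x p\<bar> \<le> D)"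
    using bounds[of Rad] by metis
  from someI_ex[OF this, folded Bd_def] show "Bd > 0" "\<bar>p\<bar> \<le> Rad \<Longrightarrow> \<bar>H x p\<bar> \<le> Bd"
    "\<bar>p\<bar> \<le> Rad \<Longrightarrow> \<bar>Hx x p\<bar> \<le> Bd" "\<bar>p\<bar> \<le> Rad \<Longrightarrow> \<bar>Hp x p\<bar> \<le> Bd" by blast+
qed

lemma Lp: "Lp > 0"
  "\<bar>p\<bar> \<le> Rad \<Longrightarrow> \<bar>r\<bar> \<le> Rad \<Longrightarrow> \<bar>Hx x p - Hx y r\<bar> \<le> Lp * (\<bar>x - y\<bar> + \<bar>p - r\<bar>)"
  "\<bar>p\<bar> \<le> Rad \<Longrightarrow> \<bar>r\<bar> \<le> Rad \<Longrightarrow> \<bar>Hp x p - Hp y r\<bar> \<le> Lp * (\<bar>x - y\<bar> + \<bar>p - r\<bar>)"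
  "\<bar>p\<bar> \<le> Rad \<Longrightarrow> \<bar>r\<bar> \<le> Rad \<Longrightarrow> \<bar>H x p - H y r\<bar> \<le> Lp * (\<bar>x - y\<bar> + \<bar>p - r\<bar>)"
proof -
  obtain D where "D > 0"
    "\<And>x p y r. \<bar>p\<bar> \<le> Rad \<Longrightarrow> \<bar>r\<bar> \<le> Rad \<Longrightarrow> \<bar>Hx x p - Hx y r\<bar> \<le> D * (\<bar>x - y\<bar> + \<bar>p - r\<bar>)"
    "\<And>x p y r. \<bar>p\<bar> \<le> Rad \<Longrightarrow> \<bar>r\<bar> \<le> Rad \<Longrightarrow> \<bar>Hp x p - Hp y r\<bar> \<le> D * (\<bar>x - y\<bar> + \<bar>p - r\<bar>)"
    "\<And>x p y r. \<bar>p\<bar> \<le> Rad \<Longrightarrow> \<bar>r\<bar> \<le> Rad \<Longrightarrow> \<bar>H x p - H y r\<bar> \<le> D * (\<bar>x - y\<bar> + \<bar>p - r\<bar>)"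
    using lipschitz[of Rad] by metis
  then have "\<exists>D. D > 0 \<and> (\<forall>x p y r. \<bar>p\<bar> \<le> Rad \<longrightarrow> \<bar>r\<bar> \<le> Rad \<longrightarrow>
      \<bar>Hx x p - Hx y r\<bar> \<le> D * (\<bar>x - y\<bar> + \<bar>p - r\<bar>) \<and> \<bar>Hp x p - Hp y r\<bar> \<le> D * (\<bar>x - y\<bar> + \<bar>p - r\<bar>) \<and>
      \<bar>H x p - H y r\<bar> \<le> D * (\<bar>x - y\<bar> + \<bar>p - r\<bar>))"
    by (intro exI[of _ D] conjI allI impI)
  note * = someI_ex[OF this, folded Lp_def]
  show "Lp > 0" using * by (rule conjunct1)
  show "\<bar>p\<bar> \<le> Rad \<Longrightarrow> \<bar>r\<bar> \<le> Rad \<Longrightarrow> \<bar>Hx x p - Hx y r\<bar> \<le> Lp * (\<bar>x - y\<bar> + \<bar>p - r\<bar>)"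
  "\<bar>p\<bar> \<le> Rad \<Longrightarrow> \<bar>r\<bar> \<le> Rad \<Longrightarrow> \<bar>Hp x p - Hp y r\<bar> \<le> Lp * (\<bar>x - y\<bar> + \<bar>p - r\<bar>)"
  "\<bar>p\<bar> \<le> Rad \<Longrightarrow> \<bar>r\<bar> \<le> Rad \<Longrightarrow> \<bar>H x p - H y r\<bar> \<le> Lp * (\<bar>x - y\<bar> + \<bar>p - r\<bar>)"
    using * by blast+
qed

abbreviation "\<Lambda> \<equiv> tLag Rad"
abbreviation "\<pi> \<equiv> tmom Rad"

lemma Rad_nonneg: "Rad \<ge> 0" using Rad(2) by simp

lemma \<pi>_bound: "\<bar>\<pi> x v\<bar> \<le> Rad" by (rule tmom_bound[OF Rad_nonneg])

lemma tLag_growth: "\<Lambda> x v \<ge> Rad * \<bar>v\<bar> - Bd"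
proof (cases "v \<ge> 0")
  case True then show ?thesis using tLag_ge[of Rad Rad v x] Bd(2)[of Rad x] Rad_nonneg by auto
next
  case False then show ?thesis using tLag_ge[of "- Rad" Rad v x] Bd(2)[of "- Rad" x] Rad_nonneg by auto
qed

lemma tLag_zero: "\<Lambda> x 0 \<le> Bd"
  unfolding tLag_def using Bd(2)[OF \<pi>_bound, of x x 0] by simp

text \<open>Discrete dynamic programming with time step h. Freezing the Lagrangian at the left end
  of each step is what produces the symplectic Euler scheme, with old position and new
  momentum.\<close>

primrec Vd :: "real \<Rightarrow> nat \<Rightarrow> real \<Rightarrow> real" where
  "Vd h 0 = Uo"
| "Vd h (Suc k) = (\<lambda>y. INF x. Vd h k x + h * \<Lambda> x ((y - x) / h))"

text \<open>The running cost grows with slope \<open>Rad\<close> in the distance from y, while the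
  datum falls with slope at most \<open>K < Rad\<close>. Outside the radius \<open>r\<close> the
  objective exceeds its value at y; inside, compactness applies.\<close>

lemma step_attained:
  assumes h: "h > 0" and c: "continuous_on UNIV V" and lower: "\<And>x. V x \<ge> Uo x - c"
  shows "\<exists>x. \<forall>z. V x + h * \<Lambda> x ((y - x) / h) \<le> V z + h * \<Lambda> z ((y - z) / h)"
proof -
  define f where "f z = V z + h * \<Lambda> z ((y - z) / h)" for z
  have cf: "continuous_on UNIV f" unfolding f_def by (intro continuous_intros c) (use h in auto)
  have lb: "f z \<ge> Uo y + (Rad - K) * \<bar>y - z\<bar> - c - h * Bd" for z
  proof -
    have "h * \<Lambda> z ((y - z) / h) \<ge> h * (Rad * \<bar>(y - z) / h\<bar> - Bd)"
      using h by (intro mult_left_mono tLag_growth) auto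
    then have "h * \<Lambda> z ((y - z) / h) \<ge> Rad * \<bar>y - z\<bar> - h * Bd" using h by (simp add: algebra_simps)
    moreover have "Uo z \<ge> Uo y - K * \<bar>y - z\<bar>" using Uo_lip[of y z] by (simp add: abs_le_iff)
    ultimately show ?thesis using lower[of z] unfolding f_def by (simp add: algebra_simps)
  qed
  define r where "r = (f y - Uo y + c + h * Bd) / (Rad - K)"
  have RK: "Rad - K > 0" using Rad(1) by simp
  have r0: "r \<ge> 0" using lb[of y] RK unfolding r_def by simp
  have "\<exists>x\<in>{y - r..y + r}. \<forall>z\<in>{y - r..y + r}. f x \<le> f z"
    by (rule continuous_attains_inf) (use r0 continuous_on_subset[OF cf] in auto)
  then obtain x where x: "\<And>z. z \<in> {y - r..y + r} \<Longrightarrow> f x \<le> f z" by blast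
  have "f x \<le> f z" for z
  proof (cases "z \<in> {y - r..y + r}")
    case False
    then have "\<bar>y - z\<bar> > r" by auto
    then have "(Rad - K) * \<bar>y - z\<bar> > (Rad - K) * r" using RK by (rule mult_strict_left_mono)
    then have "f z > f y" using lb[of z] RK by (simp add: r_def)
    then show ?thesis using x[of y] r0 by auto
  qed (rule x)
  then show ?thesis unfolding f_def by blast
qed

lemma INF_attained:
  fixes f :: "real \<Rightarrow> real"
  assumes "\<exists>x. \<forall>z. f x \<le> f z"
  shows "\<exists>x. (INF x. f x) = f x" "(INF x. f x) \<le> f z"
proof -
  obtain x where x: "\<And>z. f x \<le> f z" using assms by blast
  then have e: "(INF x. f x) = f x" by (intro cInf_eq_minimum) auto
  then show "\<exists>x. (INF x. f x) = f x" by blast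
  show "(INF x. f x) \<le> f z" using e x by simp
qed

text \<open>One induction for both claims, because attainment at the next stage needs continuity and
  a lower bound of \<open>Vd h k\<close>. The constant stays \<open>Rad\<close> since moving the end
  point changes only the last velocity.\<close>

lemma Vd_props:
  assumes h: "h > 0"
  shows "(\<forall>y. Vd h k y \<ge> Uo y - real k * (h * Bd)) \<and> (\<forall>x y. \<bar>Vd h k x - Vd h k y\<bar> \<le> Rad * \<bar>x - y\<bar>)"
proof (induction k)
  case 0
  have "\<bar>Uo x - Uo y\<bar> \<le> Rad * \<bar>x - y\<bar>" for x y
    using Uo_lip[of x y] Rad(1) by (smt (verit) abs_ge_zero mult_right_mono)
  then show ?case by simp
next
  case (Suc k)
  have "continuous_on UNIV (Vd h k)"
    by (rule lipschitz_on_continuous_on[of Rad]) (use Suc Rad_nonneg in \<open>auto simp: lipschitz_on_def dist_real_def\<close>)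
  then have att: "\<exists>x. \<forall>z. Vd h k x + h * \<Lambda> x ((y - x) / h) \<le> Vd h k z + h * \<Lambda> z ((y - z) / h)" for y
    by (rule step_attained[OF h]) (use Suc in auto)
  note a = INF_attained[OF att]
  have l: "Vd h (Suc k) x \<le> Vd h (Suc k) y + Rad * \<bar>x - y\<bar>" for x y
  proof -
    obtain z where z: "Vd h (Suc k) y = Vd h k z + h * \<Lambda> z ((y - z) / h)" using a(1)[of y] by auto
    have "Vd h (Suc k) x \<le> Vd h k z + h * \<Lambda> z ((x - z) / h)" using a(2)[of x z] by simp
    also have "h * \<Lambda> z ((x - z) / h) \<le> h * (\<Lambda> z ((y - z) / h) + Rad * \<bar>(x - z) / h - (y - z) / h\<bar>)"
      using tLag_lipschitz_v[OF Rad_nonneg, of z "(x - z) / h" "(y - z) / h"] h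
      by (intro mult_left_mono) (auto simp: abs_le_iff)
    also have "\<bar>(x - z) / h - (y - z) / h\<bar> = \<bar>x - y\<bar> / h" using h by (simp flip: diff_divide_distrib)
    finally show ?thesis using z h by (simp add: algebra_simps)
  qed
  have "Vd h (Suc k) y \<ge> Uo y - real (Suc k) * (h * Bd)" for y
  proof -
    obtain z where z: "Vd h (Suc k) y = Vd h k z + h * \<Lambda> z ((y - z) / h)" using a(1)[of y] by auto
    have "h * \<Lambda> z ((y - z) / h) \<ge> h * (Rad * \<bar>(y - z) / h\<bar> - Bd)"
      using h by (intro mult_left_mono tLag_growth) auto
    then have "h * \<Lambda> z ((y - z) / h) \<ge> Rad * \<bar>y - z\<bar> - h * Bd" using h by (simp add: algebra_simps)
    moreover have "Uo z \<ge> Uo y - K * \<bar>y - z\<bar>" using Uo_lip[of y z] by (simp add: abs_le_iff)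
    moreover have "K * \<bar>y - z\<bar> \<le> Rad * \<bar>y - z\<bar>" using Rad(1) by (intro mult_right_mono) auto
    moreover have "Vd h k z \<ge> Uo z - real k * (h * Bd)" using Suc by blast
    ultimately show ?thesis using z by (simp add: algebra_simps)
  qed
  moreover have "\<bar>Vd h (Suc k) x - Vd h (Suc k) y\<bar> \<le> Rad * \<bar>x - y\<bar>" for x y
    using l[of x y] l[of y x] by (simp add: abs_le_iff abs_minus_commute)
  ultimately show ?case by blast
qed

lemma Vd_lip: "h > 0 \<Longrightarrow> \<bar>Vd h k x - Vd h k y\<bar> \<le> Rad * \<bar>x - y\<bar>"
  using Vd_props by blast

lemma Vd_Suc:
  assumes h: "h > 0"
  shows "\<exists>x. Vd h (Suc k) y = Vd h k x + h * \<Lambda> x ((y - x) / h)"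
    and "Vd h (Suc k) y \<le> Vd h k x + h * \<Lambda> x ((y - x) / h)"
proof -
  have "continuous_on UNIV (Vd h k)"
    by (rule lipschitz_on_continuous_on[of Rad]) (use Vd_lip[OF h] Rad_nonneg in \<open>auto simp: lipschitz_on_def dist_real_def\<close>)
  then have att: "\<exists>x. \<forall>z. Vd h k x + h * \<Lambda> x ((y - x) / h) \<le> Vd h k z + h * \<Lambda> z ((y - z) / h)"
    by (rule step_attained[OF h]) (use Vd_props[OF h] in auto)
  note a = INF_attained[OF att]
  show "\<exists>x. Vd h (Suc k) y = Vd h k x + h * \<Lambda> x ((y - x) / h)" using a(1) by simp
  show "Vd h (Suc k) y \<le> Vd h k x + h * \<Lambda> x ((y - x) / h)" using a(2)[of x] by simp
qed

declare Vd.simps(2) [simp del]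

text \<open>Resting for one step gives the upper bound. For the lower one, the growth
  \<open>Rad * \<bar>y - z\<bar>\<close> of the cost cancels the possible decrease of the
  \<open>Rad\<close>-Lipschitz function \<open>Vd h k\<close>.\<close>

lemma Vd_time:
  assumes h: "h > 0"
  shows "\<bar>Vd h (Suc k) y - Vd h k y\<bar> \<le> h * Bd"
proof -
  have "Vd h (Suc k) y \<le> Vd h k y + h * \<Lambda> y 0" using Vd_Suc(2)[OF h, of k y y] by simp
  also have "h * \<Lambda> y 0 \<le> h * Bd" using h by (intro mult_left_mono tLag_zero) auto
  finally have 1: "Vd h (Suc k) y \<le> Vd h k y + h * Bd" by simp
  obtain z where z: "Vd h (Suc k) y = Vd h k z + h * \<Lambda> z ((y - z) / h)" using Vd_Suc(1)[OF h] by blast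
  have "h * \<Lambda> z ((y - z) / h) \<ge> h * (Rad * \<bar>(y - z) / h\<bar> - Bd)"
    using h by (intro mult_left_mono tLag_growth) auto
  then have "h * \<Lambda> z ((y - z) / h) \<ge> Rad * \<bar>y - z\<bar> - h * Bd" using h by (simp add: algebra_simps)
  then have "Vd h (Suc k) y \<ge> Vd h k y - h * Bd" using z Vd_lip[OF h, of k y z] by (simp add: abs_le_iff)
  with 1 show ?thesis by (simp add: abs_le_iff)
qed

lemma Vd_path:
  assumes h: "h > 0"
  shows "\<exists>x. x N = y \<and> (\<forall>k<N. Vd h (Suc k) (x (Suc k)) = Vd h k (x k) + h * \<Lambda> (x k) ((x (Suc k) - x k) / h))"
proof (induction N arbitrary: y)
  case (Suc N)
  obtain z where z: "Vd h (Suc N) y = Vd h N z + h * \<Lambda> z ((y - z) / h)" using Vd_Suc(1)[OF h] by blast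
  obtain x where "x N = z" "\<forall>k<N. Vd h (Suc k) (x (Suc k)) = Vd h k (x k) + h * \<Lambda> (x k) ((x (Suc k) - x k) / h)"
    using Suc by blast
  with z show ?case by (intro exI[of _ "x(Suc N := y)"]) (auto simp: less_Suc_eq)
qed auto

text \<open>Moving the single node \<open>x (Suc k)\<close> by d changes the velocity of the step
  before by d/h, that of the step after by -d/h, and the base point of the latter. Minimality
  excludes a first-order gain, so \<open>linear_coeff_bound\<close> with K = 0 gives the momentum
  step.\<close>

lemma discrete_Euler_Lagrange:
  assumes h: "h > 0" and k: "Suc k < N"
    and path: "\<And>k. k < N \<Longrightarrow> Vd h (Suc k) (x (Suc k)) = Vd h k (x k) + h * \<Lambda> (x k) ((x (Suc k) - x k) / h)"
  defines "p \<equiv> \<lambda>k. \<pi> (x k) ((x (Suc k) - x k) / h)"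
  shows "p k = p (Suc k) + h * Hx (x (Suc k)) (p (Suc k))"
proof -
  define v where "v k = (x (Suc k) - x k) / h" for k
  define M where "M = \<bar>v k\<bar> + \<bar>v (Suc k)\<bar> + 1"
  obtain C where C: "C > 0" "\<And>x y v w. \<bar>v\<bar> \<le> M \<Longrightarrow> \<bar>w\<bar> \<le> M \<Longrightarrow>
    \<Lambda> y w \<le> \<Lambda> x v + \<pi> x v * (w - v) - Hx x (\<pi> x v) * (y - x) + C * (\<bar>y - x\<bar> + \<bar>w - v\<bar>)\<^sup>2"
    using tLag_upper[OF Rad_nonneg, of M] by metis
  have pv: "p k = \<pi> (x k) (v k)" for k by (simp add: p_def v_def)
  have "\<bar>p k - p (Suc k) - h * Hx (x (Suc k)) (p (Suc k))\<bar> \<le> 0"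
  \<comment> \<open>The quadratic constant adds the errors of \<open>tLag_upper\<close> on the two
    affected steps: the increment is d/h on the first, d together with d/h on the second. The extra
    1 in \<open>M\<close> covers the perturbed velocities.\<close>
  proof (rule linear_coeff_bound[of "h" _ _ "h * C * (1/h)\<^sup>2 + h * C * (1 + 1/h)\<^sup>2"])
    fix d assume d: "\<bar>d\<bar> \<le> h"
    have dh: "\<bar>d / h\<bar> \<le> 1" using d h by (simp add: field_simps)
    have q: "\<bar>d / h\<bar>\<^sup>2 = (1 / h)\<^sup>2 * d\<^sup>2" "(\<bar>d\<bar> + \<bar>d / h\<bar>)\<^sup>2 = (1 + 1 / h)\<^sup>2 * d\<^sup>2"
    proof -
      show "\<bar>d / h\<bar>\<^sup>2 = (1 / h)\<^sup>2 * d\<^sup>2" by (simp add: power_divide)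
      have "\<bar>d\<bar> + \<bar>d / h\<bar> = (1 + 1 / h) * \<bar>d\<bar>" using h by (simp add: algebra_simps)
      then show "(\<bar>d\<bar> + \<bar>d / h\<bar>)\<^sup>2 = (1 + 1 / h)\<^sup>2 * d\<^sup>2" by (simp add: power_mult_distrib)
    qed
    let ?z = "x (Suc k) + d"
    have e1: "(?z - x k) / h = v k + d / h" "(x (Suc (Suc k)) - ?z) / h = v (Suc k) - d / h"
      by (simp_all add: v_def add_divide_distrib diff_divide_distrib)
    have Mb: "\<bar>v k\<bar> \<le> M" "\<bar>v k + d / h\<bar> \<le> M" "\<bar>v (Suc k)\<bar> \<le> M" "\<bar>v (Suc k) - d / h\<bar> \<le> M"
      unfolding M_def using dh by linarith+
    have "Vd h (Suc k) ?z \<le> Vd h k (x k) + h * \<Lambda> (x k) (v k + d / h)"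
      using Vd_Suc(2)[OF h, of k ?z "x k"] e1 by simp
    moreover have "Vd h (Suc (Suc k)) (x (Suc (Suc k))) \<le> Vd h (Suc k) ?z + h * \<Lambda> ?z (v (Suc k) - d / h)"
      using Vd_Suc(2)[OF h, of "Suc k" "x (Suc (Suc k))" ?z] e1 by simp
    moreover have "Vd h (Suc (Suc k)) (x (Suc (Suc k))) = Vd h k (x k) + h * \<Lambda> (x k) (v k) + h * \<Lambda> (x (Suc k)) (v (Suc k))"
      using path[of k] path[of "Suc k"] k by (simp add: v_def)
    moreover have "\<Lambda> (x k) (v k + d / h) \<le> \<Lambda> (x k) (v k) + p k * (d / h) + C * (\<bar>d / h\<bar>)\<^sup>2"
      using C(2)[OF Mb(1,2), of "x k" "x k"] by (simp add: pv)
    moreover have "\<Lambda> ?z (v (Suc k) - d / h) \<le> \<Lambda> (x (Suc k)) (v (Suc k)) - p (Suc k) * (d / h)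
        - Hx (x (Suc k)) (p (Suc k)) * d + C * (\<bar>d\<bar> + \<bar>d / h\<bar>)\<^sup>2"
      using C(2)[OF Mb(3,4), of ?z "x (Suc k)"] by (simp add: pv)
    ultimately have A: "0 \<le> h * \<Lambda> (x k) (v k + d / h) - h * \<Lambda> (x k) (v k) + (h * \<Lambda> ?z (v (Suc k) - d / h) - h * \<Lambda> (x (Suc k)) (v (Suc k)))"
      and B: "\<Lambda> (x k) (v k + d / h) - \<Lambda> (x k) (v k) \<le> p k * (d / h) + C * (\<bar>d / h\<bar>)\<^sup>2"
      "\<Lambda> ?z (v (Suc k) - d / h) - \<Lambda> (x (Suc k)) (v (Suc k)) \<le>
        - p (Suc k) * (d / h) - Hx (x (Suc k)) (p (Suc k)) * d + C * (\<bar>d\<bar> + \<bar>d / h\<bar>)\<^sup>2"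
      by linarith+
    note A
    also have "h * \<Lambda> (x k) (v k + d / h) - h * \<Lambda> (x k) (v k) + (h * \<Lambda> ?z (v (Suc k) - d / h) - h * \<Lambda> (x (Suc k)) (v (Suc k)))
      \<le> h * (p k * (d / h) + C * (\<bar>d / h\<bar>)\<^sup>2) +
        h * (- p (Suc k) * (d / h) - Hx (x (Suc k)) (p (Suc k)) * d + C * (\<bar>d\<bar> + \<bar>d / h\<bar>)\<^sup>2)"
      using mult_left_mono[OF B(1), of h] mult_left_mono[OF B(2), of h] h unfolding right_diff_distrib by linarith
    also have "\<dots> = (p k - p (Suc k) - h * Hx (x (Suc k)) (p (Suc k))) * d + h * C * (\<bar>d / h\<bar>)\<^sup>2 + h * C * (\<bar>d\<bar> + \<bar>d / h\<bar>)\<^sup>2"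
      using h by (simp add: algebra_simps)
    finally show "0 \<le> 0 * \<bar>d\<bar> + (p k - p (Suc k) - h * Hx (x (Suc k)) (p (Suc k))) * d
        + (h * C * (1/h)\<^sup>2 + h * C * (1 + 1/h)\<^sup>2) * d\<^sup>2"
      unfolding q by (simp add: distrib_right mult.assoc)
  qed (use h C(1) in auto)
  then show ?thesis by simp
qed

text \<open>Here the free node is the starting point, so the datum moves as well and contributes
  \<open>K * \<bar>d\<bar>\<close>. The bounded quantity is the momentum obtained by continuing the
  recursion one step backwards, to time 0.\<close>

lemma discrete_initial_momentum:
  assumes h: "h > 0"
    and path: "Vd h 1 (x 1) = Uo (x 0) + h * \<Lambda> (x 0) ((x 1 - x 0) / h)"
  defines "p \<equiv> \<pi> (x 0) ((x 1 - x 0) / h)"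
  shows "\<bar>p + h * Hx (x 0) p\<bar> \<le> K"
proof -
  define v where "v = (x 1 - x 0) / h"
  define M where "M = \<bar>v\<bar> + 1"
  obtain C where C: "C > 0" "\<And>x y v w. \<bar>v\<bar> \<le> M \<Longrightarrow> \<bar>w\<bar> \<le> M \<Longrightarrow>
    \<Lambda> y w \<le> \<Lambda> x v + \<pi> x v * (w - v) - Hx x (\<pi> x v) * (y - x) + C * (\<bar>y - x\<bar> + \<bar>w - v\<bar>)\<^sup>2"
    using tLag_upper[OF Rad_nonneg, of M] by metis
  have pv: "p = \<pi> (x 0) v" by (simp add: p_def v_def)
  have "\<bar>- (p + h * Hx (x 0) p)\<bar> \<le> K"
  proof (rule linear_coeff_bound[of "h" _ _ "h * C * (1 + 1/h)\<^sup>2"])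
    fix d assume d: "\<bar>d\<bar> \<le> h"
    have dh: "\<bar>d / h\<bar> \<le> 1" using d h by (simp add: field_simps)
    have q: "\<bar>d / h\<bar>\<^sup>2 = (1 / h)\<^sup>2 * d\<^sup>2" "(\<bar>d\<bar> + \<bar>d / h\<bar>)\<^sup>2 = (1 + 1 / h)\<^sup>2 * d\<^sup>2"
    proof -
      show "\<bar>d / h\<bar>\<^sup>2 = (1 / h)\<^sup>2 * d\<^sup>2" by (simp add: power_divide)
      have "\<bar>d\<bar> + \<bar>d / h\<bar> = (1 + 1 / h) * \<bar>d\<bar>" using h by (simp add: algebra_simps)
      then show "(\<bar>d\<bar> + \<bar>d / h\<bar>)\<^sup>2 = (1 + 1 / h)\<^sup>2 * d\<^sup>2" by (simp add: power_mult_distrib)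
    qed
    let ?z = "x 0 + d"
    have e1: "(x 1 - ?z) / h = v - d / h" by (simp_all add: v_def add_divide_distrib diff_divide_distrib)
    have Mb: "\<bar>v\<bar> \<le> M" "\<bar>v - d / h\<bar> \<le> M" unfolding M_def using dh by linarith+
    have "Vd h 1 (x 1) \<le> Uo ?z + h * \<Lambda> ?z (v - d / h)"
      using Vd_Suc(2)[OF h, of 0 "x 1" ?z] e1 by simp
    moreover have "Uo ?z \<le> Uo (x 0) + K * \<bar>d\<bar>" using Uo_lip[of ?z "x 0"] by (simp add: abs_le_iff)
    moreover have "\<Lambda> ?z (v - d / h) \<le> \<Lambda> (x 0) v - p * (d / h) - Hx (x 0) p * d + C * (\<bar>d\<bar> + \<bar>d / h\<bar>)\<^sup>2"
      using C(2)[OF Mb, of ?z "x 0"] by (simp add: pv)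
    then have "h * \<Lambda> ?z (v - d / h) \<le> h * (\<Lambda> (x 0) v - p * (d / h) - Hx (x 0) p * d + C * (\<bar>d\<bar> + \<bar>d / h\<bar>)\<^sup>2)"
      using h by (intro mult_left_mono) auto
    ultimately have "0 \<le> K * \<bar>d\<bar> + h * (- p * (d / h) - Hx (x 0) p * d + C * (\<bar>d\<bar> + \<bar>d / h\<bar>)\<^sup>2)"
      using path h by (simp add: v_def algebra_simps)
    also have "\<dots> = K * \<bar>d\<bar> + (- (p + h * Hx (x 0) p)) * d + h * C * (\<bar>d\<bar> + \<bar>d / h\<bar>)\<^sup>2"
      using h by (simp add: algebra_simps)
    finally show "0 \<le> K * \<bar>d\<bar> + (- (p + h * Hx (x 0) p)) * d + (h * C * (1 + 1/h)\<^sup>2) * d\<^sup>2"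
      unfolding q by (simp add: distrib_right mult.assoc)
  qed (use h C(1) in auto)
  then show ?thesis by simp
qed

text \<open>The expansions around (x, p), one in x and one in p, share the first-order term
  \<open>h * Hx x p * Hp x p\<close>; only two Taylor remainders are left. Over T/h steps the energy
  rises by at most O(h).\<close>

lemma energy_step:
  assumes "\<bar>p\<bar> \<le> Rad" "\<bar>p + h * Hx x p\<bar> \<le> Rad"
  shows "H (x + h * Hp x p) p \<le> H x (p + h * Hx x p) + 2 * Lp * Bd\<^sup>2 * h\<^sup>2"
proof -
  have "\<bar>H (x + h * Hp x p) p - H x p - Hx x p * (x + h * Hp x p - x)\<bar> \<le> Lp * (x + h * Hp x p - x)\<^sup>2"
    by (rule taylor_lipschitz_deriv[where f="\<lambda>z. H z p"])
      (use Lp(1) Lp(2)[OF assms(1) assms(1)] H_dx in auto)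
  moreover have "\<bar>H x (p + h * Hx x p) - H x p - Hp x p * (p + h * Hx x p - p)\<bar> \<le> Lp * (p + h * Hx x p - p)\<^sup>2"
  proof (rule taylor_lipschitz_deriv)
    fix z assume "z \<in> closed_segment p (p + h * Hx x p)"
    then have "\<bar>z\<bar> \<le> Rad" using assms by (auto simp: closed_segment_eq_real_ivl split: if_splits)
    then show "\<bar>Hp x z - Hp x p\<bar> \<le> Lp * \<bar>z - p\<bar>" using Lp(3)[of z p x x] assms by simp
  qed (use Lp(1) H_dp in auto)
  moreover have "Lp * (h * Hp x p)\<^sup>2 \<le> Lp * (Bd\<^sup>2 * h\<^sup>2)" "Lp * (h * Hx x p)\<^sup>2 \<le> Lp * (Bd\<^sup>2 * h\<^sup>2)"
    using Lp(1) Bd(3,4)[OF assms(1), of x] power_mono[of "\<bar>Hp x p\<bar>" Bd 2] power_mono[of "\<bar>Hx x p\<bar>" Bd 2]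
    by (auto simp: power_mult_distrib mult.commute intro!: mult_left_mono mult_right_mono)
  ultimately show ?thesis by (simp add: algebra_simps abs_le_iff)
qed

lemma discrete_extremal:
  assumes h: "h > 0" "h * Bd < 1" "real N * h * h * (2 * Lp * Bd\<^sup>2) \<le> 1" and N: "N > 0"
  obtains x p where "x N = y" "\<bar>p 0\<bar> \<le> K" "\<And>k. k \<le> N \<Longrightarrow> \<bar>p k\<bar> \<le> Rad - 1"
    "\<And>k. k < N \<Longrightarrow> x (Suc k) = x k + h * Hp (x k) (p (Suc k))"
    "\<And>k. k < N \<Longrightarrow> p k = p (Suc k) + h * Hx (x k) (p (Suc k))"
    "\<And>k. k < N \<Longrightarrow> Vd h (Suc k) (x (Suc k)) = Vd h k (x k) + h * ell (x k) (p (Suc k))"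
proof -
  obtain x where x: "x N = y"
    and path: "\<And>k. k < N \<Longrightarrow> Vd h (Suc k) (x (Suc k)) = Vd h k (x k) + h * \<Lambda> (x k) ((x (Suc k) - x k) / h)"
    using Vd_path[OF h(1)] by metis
  define P where "P k = \<pi> (x k) ((x (Suc k) - x k) / h)" for k
  \<comment> \<open>Index shift: \<open>p (Suc k)\<close> is optimal on the step from k to k + 1,
    and \<open>p 0\<close> results from running the recursion backwards across the first
    step.\<close>
  define p where "p k = (case k of 0 \<Rightarrow> P 0 + h * Hx (x 0) (P 0) | Suc k \<Rightarrow> P k)" for k
  have PR: "\<bar>P k\<bar> \<le> Rad" for k unfolding P_def by (rule \<pi>_bound)
  have p0: "\<bar>p 0\<bar> \<le> K"
    using discrete_initial_momentum[OF h(1), of x] path[of 0] N by (simp add: p_def P_def)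
  have rec: "p k = p (Suc k) + h * Hx (x k) (p (Suc k))" if "k < N" for k
    using discrete_Euler_Lagrange[OF h(1) _ path, of "k - 1"] that by (cases k) (auto simp: p_def P_def)
  have close: "\<bar>p k - p (Suc k)\<bar> < 1" if "k < N" for k
  proof -
    have "\<bar>p k - p (Suc k)\<bar> = h * \<bar>Hx (x k) (p (Suc k))\<bar>" using rec[OF that] h(1) by (simp add: abs_mult)
    also have "\<dots> \<le> h * Bd" using h(1) PR[of k] by (intro mult_left_mono Bd) (auto simp: p_def)
    finally show ?thesis using h(2) by simp
  qed
  have st: "x (Suc k) = x k + h * Hp (x k) (p (Suc k)) \<and> Vd h (Suc k) (x (Suc k)) = Vd h k (x k) + h * ell (x k) (p (Suc k))"
    if "k < N" "\<bar>p k\<bar> \<le> Rad - 1" for k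
  proof -
    have "\<bar>P k\<bar> < Rad" using close[OF that(1)] that(2) by (simp add: p_def)
    then have "(x (Suc k) - x k) / h = Hp (x k) (P k)" "\<Lambda> (x k) ((x (Suc k) - x k) / h) = ell (x k) (P k)"
      unfolding P_def by (rule tmom_less, intro tLag_ell)
    then show ?thesis using path[OF that(1)] h(1) by (simp add: p_def field_simps)
  qed
  \<comment> \<open>Bootstrap: the bound at k keeps the next momentum strictly below
    \<open>Rad\<close>, so the step is a genuine Euler step; its energy stays below
    \<open>E0 + 1\<close>, which returns the bound at k + 1.\<close>
  have en: "H (x k) (p k) \<le> E0 + real k * (2 * Lp * Bd\<^sup>2 * h\<^sup>2) \<and> \<bar>p k\<bar> \<le> Rad - 1" if "k \<le> N" for k
    using that
  proof (induction k)
    case 0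
    have "H (x 0) (p 0) \<le> E0" using E0 p0 by blast
    then show ?case using Rad(3)[of "x 0" "p 0"] by simp
  next
    case (Suc k)
    then have IH: "H (x k) (p k) \<le> E0 + real k * (2 * Lp * Bd\<^sup>2 * h\<^sup>2)" "\<bar>p k\<bar> \<le> Rad - 1" and k: "k < N" by auto
    have "H (x (Suc k)) (p (Suc k)) \<le> H (x k) (p k) + 2 * Lp * Bd\<^sup>2 * h\<^sup>2"
      using energy_step[of "p (Suc k)" h "x k"] PR[of k] st[OF k IH(2)] rec[OF k] IH(2) by (simp add: p_def)
    then have e: "H (x (Suc k)) (p (Suc k)) \<le> E0 + real (Suc k) * (2 * Lp * Bd\<^sup>2 * h\<^sup>2)"
      using IH(1) by (simp add: algebra_simps)
    have "real (Suc k) * (2 * Lp * Bd\<^sup>2 * h\<^sup>2) \<le> real N * (2 * Lp * Bd\<^sup>2 * h\<^sup>2)"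
      using Suc.prems Lp(1) by (intro mult_right_mono) auto
    also have "\<dots> \<le> 1" using h(3) by (simp add: power2_eq_square mult_ac)
    finally have "H (x (Suc k)) (p (Suc k)) \<le> E0 + 1" using e by linarith
    then show ?case using e Rad(3) by blast
  qed
  show ?thesis
  proof (rule that[of x p])
    fix k assume "k < N"
    then have "\<bar>p k\<bar> \<le> Rad - 1" using en[of k] by simp
    with st[OF \<open>k < N\<close>] show "x (Suc k) = x k + h * Hp (x k) (p (Suc k))"
      "Vd h (Suc k) (x (Suc k)) = Vd h k (x k) + h * ell (x k) (p (Suc k))" by blast+
  qed (use x p0 en rec in blast)+
qed

end

section \<open>Existence of minimizers\<close>

text \<open>The velocity is carried along as a second function, so that perturbations come with
  their derivative. Derivatives are within the interval, hence one-sided at its ends, and every pair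
  qualifies on a single point.\<close>

definition C1c :: "real \<Rightarrow> real \<Rightarrow> (real \<Rightarrow> real) \<Rightarrow> (real \<Rightarrow> real) \<Rightarrow> bool" where
  "C1c a b \<gamma> g \<longleftrightarrow> (\<forall>t\<in>{a..b}. (\<gamma> has_real_derivative g t) (at t within {a..b})) \<and> continuous_on {a..b} g"

lemma C1c_subset: "C1c a b \<gamma> g \<Longrightarrow> a \<le> c \<Longrightarrow> d \<le> b \<Longrightarrow> C1c c d \<gamma> g"
  unfolding C1c_def
  using has_field_derivative_subset[of \<gamma> _ _ "{a..b}" "{c..d}"] continuous_on_subset[of "{a..b}" g "{c..d}"]
  by auto

lemma C1c_continuous: "C1c a b \<gamma> g \<Longrightarrow> continuous_on {a..b} \<gamma>"
  unfolding C1c_def using DERIV_continuous_on by blast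

lemma C1c_bounded:
  assumes "C1c a b \<gamma> g" obtains M where "M > 0" "\<And>t. t \<in> {a..b} \<Longrightarrow> \<bar>g t\<bar> \<le> M"
proof -
  have "compact (g ` {a..b})" using assms compact_continuous_image unfolding C1c_def by blast
  then have "bounded (g ` {a..b})" by (rule compact_imp_bounded)
  then obtain M where "M > 0" "\<forall>x\<in>g ` {a..b}. norm x \<le> M" unfolding bounded_pos by blast
  then show ?thesis using that by auto
qed

lemma C1c_lip:
  assumes "C1c a b \<gamma> g" "\<And>t. t \<in> {a..b} \<Longrightarrow> \<bar>g t\<bar> \<le> M" "s \<in> {a..b}" "t \<in> {a..b}"
  shows "\<bar>\<gamma> t - \<gamma> s\<bar> \<le> M * \<bar>t - s\<bar>"
  using field_differentiable_bound[of "{a..b}" \<gamma> g M t s] assms unfolding C1c_def by auto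

lemma C1c_integral:
  assumes "C1c a b \<gamma> g" "a \<le> b"
  shows "(g has_integral \<gamma> b - \<gamma> a) {a..b}"
  using fundamental_theorem_of_calculus[OF assms(2), of \<gamma> g] assms(1)
  unfolding C1c_def has_real_derivative_iff_has_vector_derivative by blast

text \<open>Arzela-Ascoli needs functions on a fixed interval, so the grid data are extended with
  their Lipschitz constant. The conclusion samples the node just below s, within T/N of it, so that
  limits can be taken in the discrete relations themselves.\<close>

lemma grid_compactness:
  fixes z :: "nat \<Rightarrow> nat \<Rightarrow> real" and N :: "nat \<Rightarrow> nat"
  assumes T: "T > 0" and N: "\<And>n. N n > 0" "filterlim N at_top sequentially"
    and B: "\<And>n i. i \<le> N n \<Longrightarrow> \<bar>z n i\<bar> \<le> B"
    and D: "\<And>n i j. i \<le> N n \<Longrightarrow> j \<le> N n \<Longrightarrow> \<bar>z n i - z n j\<bar> \<le> D * \<bar>real i * (T / N n) - real j * (T / N n)\<bar>"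
    and D0: "D \<ge> 0"
  obtains r g where "strict_mono (r :: nat \<Rightarrow> nat)"
    "\<And>s::real. s \<in> {0..T} \<Longrightarrow> (\<lambda>n. z (r n) (nat \<lfloor>s * N (r n) / T\<rfloor>)) \<longlonglongrightarrow> g s"
proof -
  define t where "t n i = real i * (T / N n)" for n i
  \<comment> \<open>McShane extension of the grid values: it keeps the Lipschitz constant.\<close>
  define F where "F n s = Min ((\<lambda>i. z n i + D * \<bar>s - t n i\<bar>) ` {..N n})" for n s
  have F_le: "F n s \<le> z n i + D * \<bar>s - t n i\<bar>" if "i \<le> N n" for n s i
    unfolding F_def using that by (intro Min_le) auto
  have F_in: "\<exists>i\<le>N n. F n s = z n i + D * \<bar>s - t n i\<bar>" for n s
  proof -
    have "F n s \<in> (\<lambda>i. z n i + D * \<bar>s - t n i\<bar>) ` {..N n}" unfolding F_def by (rule Min_in) auto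
    then show ?thesis by auto
  qed
  have F_grid: "F n (t n i) = z n i" if "i \<le> N n" for n i
  proof (rule antisym)
    show "F n (t n i) \<le> z n i" using F_le[OF that, of "t n i"] by simp
    obtain j where j: "j \<le> N n" "F n (t n i) = z n j + D * \<bar>t n i - t n j\<bar>" using F_in by blast
    show "z n i \<le> F n (t n i)" using D[OF that j(1)] j(2) unfolding t_def by (simp add: abs_le_iff)
  qed
  have F1: "F n s \<le> F n s' + D * \<bar>s - s'\<bar>" for n s s'
  proof -
    obtain j where j: "j \<le> N n" "F n s' = z n j + D * \<bar>s' - t n j\<bar>" using F_in by blast
    have "F n s \<le> z n j + D * \<bar>s - t n j\<bar>" by (rule F_le[OF j(1)])
    also have "D * \<bar>s - t n j\<bar> \<le> D * (\<bar>s' - t n j\<bar> + \<bar>s - s'\<bar>)" using D0 by (intro mult_left_mono) auto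
    finally show ?thesis using j(2) by (simp add: algebra_simps)
  qed
  have F_lip: "\<bar>F n s - F n s'\<bar> \<le> D * \<bar>s - s'\<bar>" for n s s'
    using F1[of n s s'] F1[of n s' s] by (simp add: abs_le_iff abs_minus_commute)
  have F_bd: "norm (F n s) \<le> B + D * T" if "s \<in> {0..T}" for n s
  proof -
    have "F n 0 = z n 0" using F_grid[of 0 n] by (simp add: t_def)
    then have "\<bar>F n s\<bar> \<le> B + D * \<bar>s\<bar>" using F_lip[of n s 0] B[of 0 n] by simp
    moreover have "D * \<bar>s\<bar> \<le> D * T" using that D0 by (intro mult_left_mono) auto
    ultimately show ?thesis by simp
  qed
  obtain g k where gk: "continuous_on {0..T} g" "strict_mono (k :: nat \<Rightarrow> nat)"
      "\<And>e. 0 < e \<Longrightarrow> \<exists>M. \<forall>n x. n \<ge> M \<and> x \<in> {0..T} \<longrightarrow> norm (F (k n) x - g x) < e"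
  proof (rule Arzela_Ascoli[of "{0..T}" F "B + D * T"])
    show "\<exists>d>0. \<forall>n y. y \<in> {0..T} \<and> norm (x - y) < d \<longrightarrow> norm (F n x - F n y) < e" if "e > 0" for x e :: real
    proof (intro exI[of _ "e / (D + 1)"] conjI allI impI)
      show "e / (D + 1) > 0" using that D0 by simp
      fix n y assume a: "y \<in> {0..T} \<and> norm (x - y) < e / (D + 1)"
      have "D * \<bar>x - y\<bar> \<le> (D + 1) * \<bar>x - y\<bar>" by (intro mult_right_mono) auto
      also have "\<dots> < (D + 1) * (e / (D + 1))" using a D0 by (intro mult_strict_left_mono) auto
      finally show "norm (F n x - F n y) < e" using F_lip[of n x y] D0 by simp
    qed
  qed (use F_bd in auto)
  have "(\<lambda>n. z (k n) (nat \<lfloor>s * N (k n) / T\<rfloor>)) \<longlonglongrightarrow> g s" if s: "s \<in> {0..T}" for s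
  proof -
    define i where "i n = nat \<lfloor>s * N (k n) / T\<rfloor>" for n
    have iN: "i n \<le> N (k n)" for n
    proof -
      have "s * N (k n) / T \<le> N (k n)" using s T mult_right_mono[of s T "real (N (k n))"] by (simp add: field_simps)
      then have "\<lfloor>s * N (k n) / T\<rfloor> \<le> int (N (k n))" by (metis floor_mono floor_of_nat)
      then show ?thesis unfolding i_def by simp
    qed
    have ti: "\<bar>t (k n) (i n) - s\<bar> \<le> T / N (k n)" for n
    proof -
      have "s * N (k n) / T \<ge> 0" using s T by simp
      then have "\<bar>real (i n) - s * N (k n) / T\<bar> \<le> 1" unfolding i_def by linarith
      then have "\<bar>real (i n) - s * N (k n) / T\<bar> * (T / N (k n)) \<le> 1 * (T / N (k n))"
        using T by (intro mult_right_mono) auto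
      moreover have "\<bar>real (i n) - s * N (k n) / T\<bar> * (T / N (k n)) = \<bar>(real (i n) - s * N (k n) / T) * (T / N (k n))\<bar>"
        using T by (simp add: abs_mult)
      moreover have "(real (i n) - s * N (k n) / T) * (T / N (k n)) = t (k n) (i n) - s"
        using T N(1)[of "k n"] by (simp add: t_def field_simps)
      ultimately show ?thesis by (metis mult_1)
    qed
    have Nk: "(\<lambda>n. T / N (k n)) \<longlonglongrightarrow> 0"
    proof -
      have "filterlim (\<lambda>n. N (k n)) at_top sequentially"
        using N(2) filterlim_subseq[OF gk(2)] by (rule filterlim_compose)
      then have "filterlim (\<lambda>n. real (N (k n))) at_top sequentially"
        using filterlim_real_sequentially by (rule filterlim_compose[rotated])
      then show ?thesis by (intro tendsto_divide_0[OF tendsto_const] filterlim_at_top_imp_at_infinity)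
    qed
    have "(\<lambda>n. F (k n) s) \<longlonglongrightarrow> g s"
    proof (rule LIMSEQ_I)
      fix e :: real assume "e > 0"
      then show "\<exists>no. \<forall>n\<ge>no. norm (F (k n) s - g s) < e" using gk(3)[of e] s by blast
    qed
    moreover have "(\<lambda>n. F (k n) (t (k n) (i n)) - F (k n) s) \<longlonglongrightarrow> 0"
    proof (rule Lim_null_comparison)
      show "\<forall>\<^sub>F n in sequentially. norm (F (k n) (t (k n) (i n)) - F (k n) s) \<le> D * (T / N (k n))"
        using order_trans[OF F_lip mult_left_mono[OF ti D0]] by (intro always_eventually allI) simp
      show "(\<lambda>n. D * (T / N (k n))) \<longlonglongrightarrow> 0" using tendsto_mult_left[OF Nk, of D] by simp
    qed
    ultimately have "(\<lambda>n. (F (k n) (t (k n) (i n)) - F (k n) s) + F (k n) s) \<longlonglongrightarrow> 0 + g s"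
      by (intro tendsto_add)
    then show ?thesis using F_grid[OF iN] by (simp add: i_def)
  qed
  with gk(2) show ?thesis using that by blast
qed

text \<open>The estimate freezes the slope at the left point of the increment. For difference
  quotients to the left of s this is \<open>g y\<close> instead of \<open>g s\<close>, which is
  where continuity of g enters.\<close>

lemma derivative_of_increments:
  fixes f g :: "real \<Rightarrow> real"
  assumes inc: "\<And>s t. s \<in> {a..b} \<Longrightarrow> t \<in> {a..b} \<Longrightarrow> s \<le> t \<Longrightarrow> \<bar>f t - f s - (t - s) * g s\<bar> \<le> C * (t - s)\<^sup>2"
    and g: "continuous_on {a..b} g" and s: "s \<in> {a..b}"
  shows "(f has_real_derivative g s) (at s within {a..b})"
proof -
  have "((\<lambda>y. (f y - f s) / (y - s) - g s) \<longlongrightarrow> 0) (at s within {a..b})"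
  proof (rule Lim_null_comparison)
    show "\<forall>\<^sub>F y in at s within {a..b}. norm ((f y - f s) / (y - s) - g s) \<le> C * \<bar>y - s\<bar> + \<bar>g y - g s\<bar>"
      unfolding eventually_at
    proof (intro exI[of _ 1] conjI ballI impI)
      fix y assume y: "y \<in> {a..b}" "y \<noteq> s \<and> dist y s < 1"
      have e: "\<bar>(f y - f s) / (y - s) - c\<bar> = \<bar>f y - f s - (y - s) * c\<bar> / \<bar>y - s\<bar>" for c
        using y by (simp add: field_simps flip: abs_divide)
      show "norm ((f y - f s) / (y - s) - g s) \<le> C * \<bar>y - s\<bar> + \<bar>g y - g s\<bar>"
      proof (cases "s \<le> y")
        case True
        have "\<bar>f y - f s - (y - s) * g s\<bar> / \<bar>y - s\<bar> \<le> C * (y - s)\<^sup>2 / \<bar>y - s\<bar>"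
          by (rule divide_right_mono[OF inc[OF s y(1) True]]) simp
        also have "\<dots> = C * \<bar>y - s\<bar>" using y True by (simp add: power2_eq_square)
        finally show ?thesis unfolding real_norm_def e by simp
      next
        case False
        have "\<bar>f y - f s - (y - s) * g y\<bar> = \<bar>f s - f y - (s - y) * g y\<bar>" by (simp add: algebra_simps abs_minus_commute)
        also have "\<dots> \<le> C * (s - y)\<^sup>2" using inc[OF y(1) s] False by simp
        finally have "\<bar>f y - f s - (y - s) * g y\<bar> / \<bar>y - s\<bar> \<le> C * (s - y)\<^sup>2 / \<bar>y - s\<bar>"
          by (rule divide_right_mono) simp
        also have "\<dots> = C * \<bar>y - s\<bar>" using y False by (simp add: power2_eq_square)
        finally have "\<bar>(f y - f s) / (y - s) - g y\<bar> \<le> C * \<bar>y - s\<bar>" unfolding e .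
        then show ?thesis by simp
      qed
    qed simp
    have "((\<lambda>y. C * \<bar>y - s\<bar> + \<bar>g y - g s\<bar>) \<longlongrightarrow> C * \<bar>s - s\<bar> + \<bar>g s - g s\<bar>) (at s within {a..b})"
      by (intro tendsto_intros) (use g s continuous_on in blast)
    then show "((\<lambda>y. C * \<bar>y - s\<bar> + \<bar>g y - g s\<bar>) \<longlongrightarrow> 0) (at s within {a..b})" by simp
  qed
  then show ?thesis unfolding has_field_derivative_iff by (simp add: LIM_zero_iff)
qed

text \<open>Summation of one-step errors. With F = 0 it serves as a speed bound, otherwise as a
  comparison with the slope frozen at node i.\<close>

lemma euler_increment:
  fixes z f :: "nat \<Rightarrow> real"
  assumes "i \<le> j" "\<And>k. i \<le> k \<Longrightarrow> k < j \<Longrightarrow> z (Suc k) = z k + h * f k" "h \<ge> 0"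
    "\<And>k. i \<le> k \<Longrightarrow> k < j \<Longrightarrow> \<bar>f k - F\<bar> \<le> E"
  shows "\<bar>z j - z i - (real j - real i) * h * F\<bar> \<le> (real j - real i) * h * E"
  using assms
proof (induction j rule: dec_induct)
  case (step j)
  have "\<bar>z j - z i - (real j - real i) * h * F\<bar> \<le> (real j - real i) * h * E" using step by simp
  moreover have "z (Suc j) - z i - (real (Suc j) - real i) * h * F
      = (z j - z i - (real j - real i) * h * F) + h * (f j - F)" using step by (simp add: algebra_simps)
  moreover have "\<bar>h * (f j - F)\<bar> \<le> h * E" using step.prems(2) step.prems(3)[of j] step.hyps by (simp add: abs_mult mult_left_mono)
  ultimately show ?case by (simp add: algebra_simps)
qed simp

context ham begin

definition cost :: "real \<Rightarrow> real \<Rightarrow> (real \<Rightarrow> real) \<Rightarrow> (real \<Rightarrow> real) \<Rightarrow> real" where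
  "cost a b \<gamma> g = integral {a..b} (\<lambda>s. Lag H (\<gamma> s) (g s))"

lemma cost_integrable:
  assumes "C1c a b \<gamma> g" "a \<le> c" "d \<le> b"
  shows "(\<lambda>s. Lag H (\<gamma> s) (g s)) integrable_on {c..d}"
  by (intro integrable_continuous_real continuous_intros)
    (use C1c_subset[OF assms] C1c_continuous C1c_def in auto)

lemma cost_combine:
  assumes "C1c a b \<gamma> g" "a \<le> c" "c \<le> b"
  shows "cost a b \<gamma> g = cost a c \<gamma> g + cost c b \<gamma> g"
  unfolding cost_def using Henstock_Kurzweil_Integration.integral_combine[OF assms(2,3) cost_integrable[OF assms(1)]] by simp

text \<open>Bounding increments between arbitrary nodes by the slope at the earlier node plus a
  quadratic error is a form closed under pointwise limits. The third sequence follows the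
  accumulated cost, so no convergence of integrals has to be discussed. It serves both discrete
  minimizers and samples of genuine ones.\<close>

lemma limit_extremal:
  fixes x p c :: "nat \<Rightarrow> nat \<Rightarrow> real" and N :: "nat \<Rightarrow> nat"
  assumes T: "T > 0" and N: "\<And>n. N n > 0" "filterlim N at_top sequentially"
    and bx: "\<And>n i. i \<le> N n \<Longrightarrow> \<bar>x n i\<bar> \<le> B" and bp: "\<And>n i. i \<le> N n \<Longrightarrow> \<bar>p n i\<bar> \<le> B"
    and bc: "\<And>n i. i \<le> N n \<Longrightarrow> \<bar>c n i\<bar> \<le> B" and C: "C \<ge> 0"
    and ix: "\<And>n i j d. i \<le> j \<Longrightarrow> j \<le> N n \<Longrightarrow> d = (real j - real i) * (T / N n) \<Longrightarrow>
      \<bar>x n j - x n i - d * Hp (x n i) (p n i)\<bar> \<le> C * d\<^sup>2"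
    and ip: "\<And>n i j d. i \<le> j \<Longrightarrow> j \<le> N n \<Longrightarrow> d = (real j - real i) * (T / N n) \<Longrightarrow>
      \<bar>p n j - p n i - d * (- Hx (x n i) (p n i))\<bar> \<le> C * d\<^sup>2"
    and ic: "\<And>n i j d. i \<le> j \<Longrightarrow> j \<le> N n \<Longrightarrow> d = (real j - real i) * (T / N n) \<Longrightarrow>
      \<bar>c n j - c n i - d * ell (x n i) (p n i)\<bar> \<le> C * d\<^sup>2"
  obtains r q P w where "strict_mono (r :: nat \<Rightarrow> nat)" "HS_sol H T q P"
    "\<And>s. s \<in> {0..T} \<Longrightarrow> (w has_real_derivative ell (q s) (P s)) (at s within {0..T})"
    "\<And>s::real. s \<in> {0..T} \<Longrightarrow> (\<lambda>n. x (r n) (nat \<lfloor>s * N (r n) / T\<rfloor>)) \<longlonglongrightarrow> q s"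
    "\<And>s::real. s \<in> {0..T} \<Longrightarrow> (\<lambda>n. p (r n) (nat \<lfloor>s * N (r n) / T\<rfloor>)) \<longlonglongrightarrow> P s"
    "\<And>s::real. s \<in> {0..T} \<Longrightarrow> (\<lambda>n. c (r n) (nat \<lfloor>s * N (r n) / T\<rfloor>)) \<longlonglongrightarrow> w s"
proof -
  obtain D where D: "D > 0" "\<And>x p. \<bar>p\<bar> \<le> B \<Longrightarrow> \<bar>H x p\<bar> \<le> D" "\<And>x p. \<bar>p\<bar> \<le> B \<Longrightarrow> \<bar>Hx x p\<bar> \<le> D"
    "\<And>x p. \<bar>p\<bar> \<le> B \<Longrightarrow> \<bar>Hp x p\<bar> \<le> D" using bounds[of B] by metis
  have B0: "B \<ge> 0" using bx[of 0 0] by simp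
  \<comment> \<open>\<open>(B + 1) * D + D\<close> dominates the slopes \<open>Hp\<close>,
    \<open>Hx\<close> and \<open>ell\<close>; for increments \<open>d \<le> T\<close> the quadratic
    error adds at most \<open>C * T * d\<close>.\<close>
  define E where "E = (B + 1) * D + D + C * T"
  have E0: "E \<ge> 0" using B0 D(1) C T by (simp add: E_def)
  have lip: "\<bar>z n i - z n j\<bar> \<le> E * \<bar>real i * (T / N n) - real j * (T / N n)\<bar>"
    if z: "\<And>n i j d. i \<le> j \<Longrightarrow> j \<le> N n \<Longrightarrow> d = (real j - real i) * (T / N n) \<Longrightarrow> \<bar>z n j - z n i - d * F n i\<bar> \<le> C * d\<^sup>2"
      and F: "\<And>n i. i \<le> N n \<Longrightarrow> \<bar>F n i\<bar> \<le> (B + 1) * D + D" and ij: "i \<le> N n" "j \<le> N n"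
    for z F :: "nat \<Rightarrow> nat \<Rightarrow> real" and n i j
  proof -
    have *: "\<bar>z n j - z n i\<bar> \<le> E * \<bar>real j * (T / N n) - real i * (T / N n)\<bar>" if "i \<le> j" "j \<le> N n" for i j
    proof -
      define d where "d = (real j - real i) * (T / N n)"
      have d: "d \<ge> 0" "d \<le> T"
      proof -
        show "d \<ge> 0" using that T by (simp add: d_def)
        have "d \<le> real (N n) * (T / N n)" unfolding d_def using that T by (intro mult_right_mono) auto
        then show "d \<le> T" using N(1)[of n] by simp
      qed
      have "\<bar>z n j - z n i\<bar> \<le> \<bar>d * F n i\<bar> + C * d\<^sup>2" using z[OF that d_def] by linarith
      also have "\<dots> \<le> d * ((B + 1) * D + D) + d * (C * T)"
        using F[of i n] that d C by (auto simp: abs_mult power2_eq_square mult.left_commute[of C] intro!: add_mono mult_left_mono)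
      finally have "\<bar>z n j - z n i\<bar> \<le> E * d" by (simp add: E_def algebra_simps)
      moreover have "real j * (T / N n) - real i * (T / N n) = d" by (simp only: d_def left_diff_distrib)
      ultimately show ?thesis using d(1) by simp
    qed
    show ?thesis
      using *[of i j] *[of j i] ij by (cases "i \<le> j") (auto simp: abs_minus_commute)
  qed
  have bE: "\<bar>Hp (x n i) (p n i)\<bar> \<le> (B + 1) * D + D" "\<bar>- Hx (x n i) (p n i)\<bar> \<le> (B + 1) * D + D"
    "\<bar>ell (x n i) (p n i)\<bar> \<le> (B + 1) * D + D" if "i \<le> N n" for n i
  proof -
    have "\<bar>Hp (x n i) (p n i)\<bar> \<le> D" "\<bar>Hx (x n i) (p n i)\<bar> \<le> D" "\<bar>H (x n i) (p n i)\<bar> \<le> D"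
      using D bp[OF that] by auto
    moreover have "0 \<le> B * D" using B0 D(1) by simp
    moreover have "\<bar>p n i * Hp (x n i) (p n i)\<bar> \<le> B * D"
      unfolding abs_mult using bp[OF that] calculation(1) B0 by (intro mult_mono) auto
    ultimately show "\<bar>Hp (x n i) (p n i)\<bar> \<le> (B + 1) * D + D" "\<bar>- Hx (x n i) (p n i)\<bar> \<le> (B + 1) * D + D"
    "\<bar>ell (x n i) (p n i)\<bar> \<le> (B + 1) * D + D" using D(1) unfolding ell_def distrib_right by linarith+
  qed
  define fl where "fl n s = nat \<lfloor>s * N n / T\<rfloor>" for n and s :: real
  have fln: "nat \<lfloor>s * N n / T\<rfloor> = fl n s" for n and s :: real by (simp add: fl_def)
  obtain r1 q where r1: "strict_mono (r1 :: nat \<Rightarrow> nat)"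
    and q: "\<And>s. s \<in> {0..T} \<Longrightarrow> (\<lambda>n. x (r1 n) (fl (r1 n) s)) \<longlonglongrightarrow> q s"
    by (rule grid_compactness[OF T N bx lip[where z=x and F="\<lambda>n i. Hp (x n i) (p n i)", OF ix bE(1)] E0, unfolded fln]; (assumption | (rule that, assumption, assumption)))
  have lim_sub: "filterlim (\<lambda>n. N (r n)) at_top sequentially" if "strict_mono r" for r :: "nat \<Rightarrow> nat"
    using N(2) filterlim_subseq[OF that] by (rule filterlim_compose)
  obtain r2 P where r2: "strict_mono (r2 :: nat \<Rightarrow> nat)"
    and P: "\<And>s. s \<in> {0..T} \<Longrightarrow> (\<lambda>n. p (r1 (r2 n)) (fl (r1 (r2 n)) s)) \<longlonglongrightarrow> P s"
    by (rule grid_compactness[OF T N(1) lim_sub[OF r1] bp lip[where z=p and F="\<lambda>n i. - Hx (x n i) (p n i)", OF ip bE(2)] E0, unfolded fln]; (assumption | (rule that, assumption, assumption)))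
  have r12: "strict_mono (\<lambda>n. r1 (r2 n))" using r1 r2 by (simp add: strict_mono_def)
  obtain r3 w where r3: "strict_mono (r3 :: nat \<Rightarrow> nat)"
    and w: "\<And>s. s \<in> {0..T} \<Longrightarrow> (\<lambda>n. c (r1 (r2 (r3 n))) (fl (r1 (r2 (r3 n))) s)) \<longlonglongrightarrow> w s"
    by (rule grid_compactness[OF T N(1) lim_sub[OF r12] bc lip[where z=c and F="\<lambda>n i. ell (x n i) (p n i)", OF ic bE(3)] E0, unfolded fln]; (assumption | (rule that, assumption, assumption)))
  define r where "r n = r1 (r2 (r3 n))" for n
  have r: "strict_mono r" using r1 r2 r3 by (simp add: strict_mono_def r_def)
  have lx: "(\<lambda>n. x (r n) (fl (r n) s)) \<longlonglongrightarrow> q s" if "s \<in> {0..T}" for s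
    using LIMSEQ_subseq_LIMSEQ[OF q[OF that], of "\<lambda>n. r2 (r3 n)"] r2 r3 by (simp add: o_def r_def strict_mono_def)
  have lp: "(\<lambda>n. p (r n) (fl (r n) s)) \<longlonglongrightarrow> P s" if "s \<in> {0..T}" for s
    using LIMSEQ_subseq_LIMSEQ[OF P[OF that] r3] by (simp add: o_def r_def)
  have lc: "(\<lambda>n. c (r n) (fl (r n) s)) \<longlonglongrightarrow> w s" if "s \<in> {0..T}" for s
    using w[OF that] by (simp add: r_def)
  have Pb: "\<bar>P s\<bar> \<le> B" and flN: "fl n s \<le> N n" if s: "s \<in> {0..T}" for s n
  proof -
    show flN: "fl n s \<le> N n" for n
    proof -
      have "s * N n / T \<le> N n" using s T mult_right_mono[of s T "real (N n)"] by (simp add: field_simps)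
      then have "\<lfloor>s * N n / T\<rfloor> \<le> int (N n)" by (metis floor_mono floor_of_nat)
      then show ?thesis unfolding fl_def by simp
    qed
    show "\<bar>P s\<bar> \<le> B"
      using tendsto_rabs[OF lp[OF s]] by (rule LIMSEQ_le_const2) (use bp flN in blast)
  qed
  have flmono: "fl n s \<le> fl n t" if "s \<le> t" for n s t
    unfolding fl_def by (intro nat_mono floor_mono divide_right_mono mult_right_mono) (use that T in auto)
  have ld: "(\<lambda>n. (real (fl (r n) t) - real (fl (r n) s)) * (T / N (r n))) \<longlonglongrightarrow> t - s"
    if "s \<in> {0..T}" "t \<in> {0..T}" for s t
  proof -
    have Nk: "(\<lambda>n. T / N (r n)) \<longlonglongrightarrow> 0"
      using filterlim_compose[OF filterlim_real_sequentially lim_sub[OF r]]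
      by (intro tendsto_divide_0[OF tendsto_const] filterlim_at_top_imp_at_infinity)
    have *: "(\<lambda>n. real (fl (r n) s) * (T / N (r n)) - s) \<longlonglongrightarrow> 0" if s: "s \<in> {0..T}" for s
    proof (rule Lim_null_comparison[OF always_eventually Nk], rule allI)
      fix n
      have "s * N (r n) / T \<ge> 0" using s T by simp
      then have "\<bar>real (fl (r n) s) - s * N (r n) / T\<bar> \<le> 1" unfolding fl_def by linarith
      then have "\<bar>real (fl (r n) s) - s * N (r n) / T\<bar> * (T / N (r n)) \<le> 1 * (T / N (r n))"
        using T by (intro mult_right_mono) auto
      moreover have "\<bar>real (fl (r n) s) - s * N (r n) / T\<bar> * (T / N (r n)) = \<bar>(real (fl (r n) s) - s * N (r n) / T) * (T / N (r n))\<bar>"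
        using T by (simp add: abs_mult)
      moreover have "(real (fl (r n) s) - s * N (r n) / T) * (T / N (r n)) = real (fl (r n) s) * (T / N (r n)) - s"
        using T N(1)[of "r n"] by (simp add: field_simps)
      ultimately show "norm (real (fl (r n) s) * (T / N (r n)) - s) \<le> T / N (r n)"
        by (metis mult_1 real_norm_def)
    qed
    from tendsto_diff[OF *[OF that(2)] *[OF that(1)]]
    have "(\<lambda>n. (real (fl (r n) t) - real (fl (r n) s)) * (T / N (r n)) - (t - s)) \<longlonglongrightarrow> 0"
      by (simp add: algebra_simps)
    then show ?thesis by (rule LIM_zero_cancel)
  qed
  have lim_inc: "\<bar>q' t - q' s - (t - s) * G s\<bar> \<le> C * (t - s)\<^sup>2"
    if z: "\<And>n i j d. i \<le> j \<Longrightarrow> j \<le> N n \<Longrightarrow> d = (real j - real i) * (T / N n) \<Longrightarrow> \<bar>z n j - z n i - d * F n i\<bar> \<le> C * d\<^sup>2"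
      and zl: "\<And>s. s \<in> {0..T} \<Longrightarrow> (\<lambda>n. z (r n) (fl (r n) s)) \<longlonglongrightarrow> q' s"
      and Fl: "\<And>s. s \<in> {0..T} \<Longrightarrow> (\<lambda>n. F (r n) (fl (r n) s)) \<longlonglongrightarrow> G s"
      and st: "s \<in> {0..T}" "t \<in> {0..T}" "s \<le> t" for z F :: "nat \<Rightarrow> nat \<Rightarrow> real" and q' G s t
  proof (rule LIMSEQ_le)
    let ?d = "\<lambda>n. (real (fl (r n) t) - real (fl (r n) s)) * (T / N (r n))"
    show "(\<lambda>n. \<bar>z (r n) (fl (r n) t) - z (r n) (fl (r n) s) - ?d n * F (r n) (fl (r n) s)\<bar>)
        \<longlonglongrightarrow> \<bar>q' t - q' s - (t - s) * G s\<bar>"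
      by (intro tendsto_intros zl Fl ld st)
    show "(\<lambda>n. C * (?d n)\<^sup>2) \<longlonglongrightarrow> C * (t - s)\<^sup>2" by (intro tendsto_intros ld st)
    show "\<exists>M. \<forall>n\<ge>M. \<bar>z (r n) (fl (r n) t) - z (r n) (fl (r n) s) - ?d n * F (r n) (fl (r n) s)\<bar> \<le> C * (?d n)\<^sup>2"
      using z flmono flN st by blast
  qed
  \<comment> \<open>The increment estimates survive the limit with the same constant, and they
    contain the differential equations.\<close>
  have q_inc: "\<bar>q t - q s - (t - s) * Hp (q s) (P s)\<bar> \<le> C * (t - s)\<^sup>2"
    and p_inc: "\<bar>P t - P s - (t - s) * (- Hx (q s) (P s))\<bar> \<le> C * (t - s)\<^sup>2"
    and w_inc: "\<bar>w t - w s - (t - s) * ell (q s) (P s)\<bar> \<le> C * (t - s)\<^sup>2"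
    if st: "s \<in> {0..T}" "t \<in> {0..T}" "s \<le> t" for s t
  proof -
    show "\<bar>q t - q s - (t - s) * Hp (q s) (P s)\<bar> \<le> C * (t - s)\<^sup>2"
      using ix lx tendsto_ham(1)[OF lx lp] st by (rule lim_inc)
    show "\<bar>P t - P s - (t - s) * (- Hx (q s) (P s))\<bar> \<le> C * (t - s)\<^sup>2"
      using ip lp tendsto_minus[OF tendsto_ham(2)[OF lx lp]] st by (rule lim_inc)
    have "(\<lambda>n. ell (x (r n) (fl (r n) s)) (p (r n) (fl (r n) s))) \<longlonglongrightarrow> ell (q s) (P s)" if "s \<in> {0..T}" for s
      unfolding ell_def by (intro tendsto_intros lx lp that)
    with ic lc show "\<bar>w t - w s - (t - s) * ell (q s) (P s)\<bar> \<le> C * (t - s)\<^sup>2" using st by (rule lim_inc)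
  qed
  have cont: "continuous_on {0..T} f"
    if inc: "\<And>s t. s \<in> {0..T} \<Longrightarrow> t \<in> {0..T} \<Longrightarrow> s \<le> t \<Longrightarrow> \<bar>f t - f s - (t - s) * g s\<bar> \<le> C * (t - s)\<^sup>2"
      and g: "\<And>s. s \<in> {0..T} \<Longrightarrow> \<bar>g s\<bar> \<le> D" for f g :: "real \<Rightarrow> real"
  proof -
    have *: "\<bar>f t - f s\<bar> \<le> (D + C * T) * \<bar>t - s\<bar>" if st: "s \<in> {0..T}" "t \<in> {0..T}" "s \<le> t" for s t
    proof -
      have "\<bar>f t - f s\<bar> \<le> \<bar>(t - s) * g s\<bar> + C * (t - s)\<^sup>2" using inc[OF st] by linarith
      also have "\<dots> \<le> (t - s) * D + (t - s) * (C * T)"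
        using g[OF st(1)] st C by (auto simp: abs_mult power2_eq_square mult.left_commute[of C] intro!: add_mono mult_left_mono)
      finally show ?thesis using st(3) by (simp add: algebra_simps)
    qed
    have "(D + C * T)-lipschitz_on {0..T} f"
    proof (rule lipschitz_onI)
      show "dist (f s) (f t) \<le> (D + C * T) * dist s t" if "s \<in> {0..T}" "t \<in> {0..T}" for s t
        using *[of s t] *[of t s] that by (cases "s \<le> t") (auto simp: dist_real_def abs_minus_commute)
    qed (use D(1) C T in auto)
    then show ?thesis by (rule lipschitz_on_continuous_on)
  qed
  have cq: "continuous_on {0..T} q" using q_inc by (rule cont) (use D(4) Pb in auto)
  have cP: "continuous_on {0..T} P" using p_inc by (rule cont) (use D(3) Pb in auto)
  show ?thesis
  proof (rule that[OF r])
    show "HS_sol H T q P" unfolding HS_sol_def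
    proof (intro ballI conjI)
      fix s assume s: "s \<in> {0..T}"
      show "(q has_real_derivative Hp (q s) (P s)) (at s within {0..T})"
        by (rule derivative_of_increments[OF q_inc _ s]; (assumption | intro continuous_intros cq cP))
      show "(P has_real_derivative - Hx (q s) (P s)) (at s within {0..T})"
        by (rule derivative_of_increments[where g="\<lambda>s. - Hx (q s) (P s)", OF p_inc _ s]; (assumption | intro continuous_intros cq cP))
    qed
    show "(w has_real_derivative ell (q s) (P s)) (at s within {0..T})" if "s \<in> {0..T}" for s
      by (rule derivative_of_increments[OF w_inc _ that]; (assumption | intro continuous_intros cq cP))
  qed (use lx lp lc in \<open>auto simp: fl_def\<close>)
qed

end

section \<open>Comparison with continuous curves and Tonelli's theorem\<close>

context cauchy begin

lemma competitor_step:
  assumes h: "h > 0" and ab: "C1c a b \<gamma> g" and M: "\<And>t. t \<in> {a..b} \<Longrightarrow> \<bar>g t\<bar> \<le> M" "M \<ge> 0"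
    and st: "a \<le> s" "s \<le> t" "t \<le> b" "t - s \<le> h"
  shows "Vd h (Suc k) (\<gamma> t) \<le> Vd h k (\<gamma> s) + cost s t \<gamma> g + Bd * (h - (t - s)) + Lp * M * h * h"
proof -
  define v where "v = (\<gamma> t - \<gamma> s) / h"
  define \<rho> where "\<rho> = \<pi> (\<gamma> s) v"
  have \<rho>: "\<bar>\<rho>\<bar> \<le> Rad" unfolding \<rho>_def by (rule \<pi>_bound)
  have c: "C1c s t \<gamma> g" by (rule C1c_subset[OF ab st(1,3)])
  define E where "E = H (\<gamma> s) \<rho> + Lp * M * h"
  have "((\<lambda>r. \<rho> * g r - E) has_integral \<rho> * (\<gamma> t - \<gamma> s) - (t - s) * E) {s..t}"
    using has_integral_diff[OF has_integral_mult_right[OF C1c_integral[OF c st(2)], of \<rho>] has_integral_const_real[of E s t]] st(2)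
    by simp
  moreover have "((\<lambda>r. Lag H (\<gamma> r) (g r)) has_integral cost s t \<gamma> g) {s..t}"
    unfolding cost_def using cost_integrable[OF c] by blast
  ultimately have "\<rho> * (\<gamma> t - \<gamma> s) - (t - s) * E \<le> cost s t \<gamma> g"
  proof (rule has_integral_le)
    fix r assume r: "r \<in> {s..t}"
    have "\<bar>\<gamma> r - \<gamma> s\<bar> \<le> M * \<bar>r - s\<bar>" by (rule C1c_lip[OF ab M(1)]) (use r st in auto)
    also have "\<dots> \<le> M * h" using M(2) r st by (intro mult_left_mono) auto
    finally have "Lp * \<bar>\<gamma> r - \<gamma> s\<bar> \<le> Lp * (M * h)" using Lp(1) by (intro mult_left_mono) auto
    moreover have "\<bar>H (\<gamma> r) \<rho> - H (\<gamma> s) \<rho>\<bar> \<le> Lp * \<bar>\<gamma> r - \<gamma> s\<bar>" using Lp(4)[OF \<rho> \<rho>, of "\<gamma> r" "\<gamma> s"] by simp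
    ultimately have "H (\<gamma> r) \<rho> \<le> E" unfolding E_def by (simp add: abs_le_iff mult.assoc)
    then show "\<rho> * g r - E \<le> Lag H (\<gamma> r) (g r)" using Lag_ge[of \<rho> "g r" "\<gamma> r"] by simp
  qed
  moreover have "h * \<Lambda> (\<gamma> s) v = \<rho> * (\<gamma> t - \<gamma> s) - h * H (\<gamma> s) \<rho>"
  proof -
    have "h * v = \<gamma> t - \<gamma> s" using h by (simp add: v_def)
    then show ?thesis unfolding tLag_def \<rho>_def[symmetric] by (metis mult.left_commute right_diff_distrib')
  qed
  moreover have "Vd h (Suc k) (\<gamma> t) \<le> Vd h k (\<gamma> s) + h * \<Lambda> (\<gamma> s) v"
    unfolding v_def by (rule Vd_Suc(2)[OF h])
  moreover have "- (h - (t - s)) * H (\<gamma> s) \<rho> \<le> (h - (t - s)) * Bd"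
    using mult_left_mono[of "- H (\<gamma> s) \<rho>" Bd "h - (t - s)"] Bd(2)[OF \<rho>, of "\<gamma> s"] st(4)
    by (simp add: abs_le_iff del: minus_diff_eq)
  moreover have "(t - s) * (Lp * M * h) \<le> h * (Lp * M * h)"
    using st Lp(1) M(2) h by (intro mult_right_mono) auto
  ultimately show ?thesis unfolding E_def by (simp add: algebra_simps)
qed

text \<open>The clamp \<open>\<tau>\<close> lets the grid be unrelated to [a, b]: steps outside have
  length zero and only pay \<open>Bd\<close> per unit of time, and the one-step estimates
  telescope.\<close>

lemma competitor:
  assumes h: "h > 0" and ab: "C1c a b \<gamma> g" "a \<le> b" and M: "\<And>t. t \<in> {a..b} \<Longrightarrow> \<bar>g t\<bar> \<le> M" "M \<ge> 0"
    and i: "real i * h \<le> a" "i \<le> k"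
  defines "\<tau> \<equiv> \<lambda>k. max a (min b (real k * h))"
  shows "Vd h k (\<gamma> (\<tau> k)) \<le> Vd h i (\<gamma> a) + cost a (\<tau> k) \<gamma> g + Bd * (real (k - i) * h - (\<tau> k - a)) + Lp * M * h * (real (k - i) * h)"
  using i(2)
proof (induction k rule: dec_induct)
  case base
  have "\<tau> i = a" using i ab(2) by (simp add: \<tau>_def)
  then show ?case by (simp add: cost_def)
next
  case (step k)
  have \<tau>: "a \<le> \<tau> k" "\<tau> k \<le> \<tau> (Suc k)" "\<tau> (Suc k) \<le> b" "\<tau> (Suc k) - \<tau> k \<le> h"
    using ab(2) h unfolding \<tau>_def by (auto simp: algebra_simps max_def min_def)
  have "Vd h (Suc k) (\<gamma> (\<tau> (Suc k))) \<le> Vd h k (\<gamma> (\<tau> k)) + cost (\<tau> k) (\<tau> (Suc k)) \<gamma> g + Bd * (h - (\<tau> (Suc k) - \<tau> k)) + Lp * M * h * h"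
    by (rule competitor_step[OF h ab(1) M \<tau>])
  moreover have "cost a (\<tau> (Suc k)) \<gamma> g = cost a (\<tau> k) \<gamma> g + cost (\<tau> k) (\<tau> (Suc k)) \<gamma> g"
    by (rule cost_combine[OF C1c_subset[OF ab(1) order_refl \<tau>(3)] \<tau>(1,2)])
  moreover have "real (Suc k - i) = real (k - i) + 1" using step by simp
  ultimately show ?case using step.IH by (simp only:) (simp add: algebra_simps)
qed

lemma ell_lipschitz:
  assumes "\<bar>p\<bar> \<le> Rad" "\<bar>r\<bar> \<le> Rad"
  shows "\<bar>ell x p - ell y r\<bar> \<le> ((Rad + 1) * Lp + Bd) * (\<bar>x - y\<bar> + \<bar>p - r\<bar>)"
proof -
  define d where "d = \<bar>x - y\<bar> + \<bar>p - r\<bar>"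
  have "\<bar>p * (Hp x p - Hp y r)\<bar> \<le> Rad * (Lp * d)"
    unfolding abs_mult using assms Lp(3)[OF assms, of x y] Rad_nonneg by (intro mult_mono) (auto simp: d_def)
  moreover have "\<bar>(p - r) * Hp y r\<bar> \<le> d * Bd"
    unfolding abs_mult using assms Bd(4)[OF assms(2), of y] by (intro mult_mono) (auto simp: d_def)
  moreover have "\<bar>H x p - H y r\<bar> \<le> Lp * d" using Lp(4)[OF assms] by (simp add: d_def)
  moreover have "ell x p - ell y r = p * (Hp x p - Hp y r) + (p - r) * Hp y r - (H x p - H y r)"
    by (simp add: ell_def algebra_simps)
  ultimately have "\<bar>ell x p - ell y r\<bar> \<le> Rad * (Lp * d) + d * Bd + Lp * d" by linarith
  then show ?thesis unfolding d_def[symmetric] by (simp add: algebra_simps)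
qed

text \<open>Between nodes i and j position and momentum each move by at most \<open>Bd * d\<close>,
  so the slopes of the scheme differ from those frozen at node i by \<open>2 * Bd * d\<close> times
  a Lipschitz constant. One constant serves all three sequences.\<close>

lemma discrete_increments:
  assumes h: "h > 0"
    and b: "\<And>k. k \<le> N \<Longrightarrow> \<bar>p k\<bar> \<le> Rad"
    and x: "\<And>k. k < N \<Longrightarrow> x (Suc k) = x k + h * Hp (x k) (p (Suc k))"
    and p: "\<And>k. k < N \<Longrightarrow> p k = p (Suc k) + h * Hx (x k) (p (Suc k))"
    and c: "\<And>k. k < N \<Longrightarrow> c (Suc k) = c k + h * ell (x k) (p (Suc k))"
    and ij: "i \<le> j" "j \<le> N" and d: "d = (real j - real i) * h"
  shows "\<bar>x j - x i - d * Hp (x i) (p i)\<bar> \<le> 2 * Bd * ((Rad + 1) * Lp + Bd) * d\<^sup>2"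
    "\<bar>p j - p i - d * (- Hx (x i) (p i))\<bar> \<le> 2 * Bd * ((Rad + 1) * Lp + Bd) * d\<^sup>2"
    "\<bar>c j - c i - d * ell (x i) (p i)\<bar> \<le> 2 * Bd * ((Rad + 1) * Lp + Bd) * d\<^sup>2"
proof -
  define L where "L = (Rad + 1) * Lp + Bd"
  have L: "L \<ge> 0" "L \<ge> Lp" using Lp(1) Bd(1) Rad_nonneg by (auto simp: L_def algebra_simps)
  have pS: "p (Suc k) = p k + h * (- Hx (x k) (p (Suc k)))" if "k < N" for k using p[OF that] by simp
  have xk: "\<bar>x k - x i\<bar> \<le> (real k - real i) * h * Bd" "\<bar>p k - p i\<bar> \<le> (real k - real i) * h * Bd" if "i \<le> k" "k \<le> N" for k
    using euler_increment[OF that(1), of x h "\<lambda>k. Hp (x k) (p (Suc k))" 0 Bd]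
      euler_increment[OF that(1), of p h "\<lambda>k. - Hx (x k) (p (Suc k))" 0 Bd] h x pS b that Bd by auto
  have near: "\<bar>x k - x i\<bar> + \<bar>p (Suc k) - p i\<bar> \<le> 2 * Bd * d" if "i \<le> k" "k < j" for k
  proof -
    have "(real k - real i) * h * Bd \<le> d * Bd" "(real (Suc k) - real i) * h * Bd \<le> d * Bd"
      unfolding d using that ij h Bd(1) by (auto intro!: mult_right_mono)
    moreover have "\<bar>x k - x i\<bar> \<le> (real k - real i) * h * Bd" "\<bar>p (Suc k) - p i\<bar> \<le> (real (Suc k) - real i) * h * Bd"
      using xk(1)[of k] xk(2)[of "Suc k"] that ij by auto
    moreover have "2 * Bd * d = d * Bd + d * Bd" by simp
    ultimately show ?thesis by linarith
  qed
  have est: "\<bar>f k - F\<bar> \<le> L * (2 * Bd * d)" if "\<bar>f k - F\<bar> \<le> A * (\<bar>x k - x i\<bar> + \<bar>p (Suc k) - p i\<bar>)" "A \<le> L" "i \<le> k" "k < j" for f :: "nat \<Rightarrow> real" and F A k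
  proof -
    have "A * (\<bar>x k - x i\<bar> + \<bar>p (Suc k) - p i\<bar>) \<le> L * (2 * Bd * d)"
      using near[OF that(3,4)] that(2) L by (intro mult_mono) auto
    then show ?thesis using that(1) by simp
  qed
  have b': "\<bar>p (Suc k)\<bar> \<le> Rad" "\<bar>p i\<bar> \<le> Rad" if "k < j" for k using b ij that by auto
  have "\<bar>x j - x i - (real j - real i) * h * Hp (x i) (p i)\<bar> \<le> (real j - real i) * h * (L * (2 * Bd * d))"
  proof (rule euler_increment[where z=x and f="\<lambda>k. Hp (x k) (p (Suc k))", OF ij(1)])
    show "\<bar>Hp (x k) (p (Suc k)) - Hp (x i) (p i)\<bar> \<le> L * (2 * Bd * d)" if "i \<le> k" "k < j" for k
      by (rule est[of "\<lambda>k. Hp (x k) (p (Suc k))" _ _ Lp]) (use Lp(3)[OF b'[OF that(2)], of "x k" "x i"] L that in \<open>auto simp: abs_minus_commute L_def\<close>)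
  qed (use x h ij in auto)
  then show "\<bar>x j - x i - d * Hp (x i) (p i)\<bar> \<le> 2 * Bd * ((Rad + 1) * Lp + Bd) * d\<^sup>2"
    unfolding L_def[symmetric] d[symmetric] by (simp add: power2_eq_square algebra_simps)
  have "\<bar>p j - p i - (real j - real i) * h * (- Hx (x i) (p i))\<bar> \<le> (real j - real i) * h * (L * (2 * Bd * d))"
  proof (rule euler_increment[where z=p and f="\<lambda>k. - Hx (x k) (p (Suc k))", OF ij(1)])
    show "\<bar>- Hx (x k) (p (Suc k)) - (- Hx (x i) (p i))\<bar> \<le> L * (2 * Bd * d)" if "i \<le> k" "k < j" for k
      by (rule est[of "\<lambda>k. - Hx (x k) (p (Suc k))" _ _ Lp]) (use Lp(2)[OF b'[OF that(2)], of "x k" "x i"] L that in \<open>auto simp: abs_minus_commute L_def\<close>)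
  qed (use pS h ij in auto)
  then show "\<bar>p j - p i - d * (- Hx (x i) (p i))\<bar> \<le> 2 * Bd * ((Rad + 1) * Lp + Bd) * d\<^sup>2"
    unfolding L_def[symmetric] d[symmetric] by (simp add: power2_eq_square algebra_simps)
  have "\<bar>c j - c i - (real j - real i) * h * ell (x i) (p i)\<bar> \<le> (real j - real i) * h * (L * (2 * Bd * d))"
  proof (rule euler_increment[where z=c and f="\<lambda>k. ell (x k) (p (Suc k))", OF ij(1)])
    show "\<bar>ell (x k) (p (Suc k)) - ell (x i) (p i)\<bar> \<le> L * (2 * Bd * d)" if "i \<le> k" "k < j" for k
      by (rule est[of "\<lambda>k. ell (x k) (p (Suc k))" _ _ L]) (use ell_lipschitz[OF b'[OF that(2)], of "x k" "x i"] L that in \<open>auto simp: abs_minus_commute L_def\<close>)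
  qed (use c h ij in auto)
  then show "\<bar>c j - c i - d * ell (x i) (p i)\<bar> \<le> 2 * Bd * ((Rad + 1) * Lp + Bd) * d\<^sup>2"
    unfolding L_def[symmetric] d[symmetric] by (simp add: power2_eq_square algebra_simps)
qed

lemma Vd_dist_datum: "h > 0 \<Longrightarrow> \<bar>Vd h k y - Uo y\<bar> \<le> real k * (h * Bd)"
proof (induction k)
  case (Suc k)
  have "\<bar>Vd h (Suc k) y - Vd h k y\<bar> \<le> h * Bd" by (rule Vd_time[OF Suc.prems])
  with Suc show ?case by (simp add: algebra_simps abs_le_iff)
qed simp

lemma Uo_continuous: "continuous_on S Uo"
proof (rule continuous_on_subset[OF _ subset_UNIV])
  show "continuous_on UNIV Uo"
    by (rule lipschitz_on_continuous_on[of K]) (use Uo_lip K_nonneg in \<open>auto simp: lipschitz_on_def dist_real_def\<close>)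
qed

text \<open>Competitors may have a corner at s because dynamic programming concatenates C1 curves
  that do not join smoothly. \<open>Vd\<close> along the optimal discrete paths is the third
  sequence of \<open>limit_extremal\<close>, so its limit is both the cost of the extremal and the
  limit of the discrete values.\<close>

theorem tonelli:
  assumes T: "T > 0"
  obtains q p where "HS_sol H T q p" "q T = y"
    "\<And>s \<gamma>1 g1 \<gamma>2 g2. s \<in> {0..T} \<Longrightarrow> C1c 0 s \<gamma>1 g1 \<Longrightarrow> C1c s T \<gamma>2 g2 \<Longrightarrow> \<gamma>1 s = \<gamma>2 s \<Longrightarrow> \<gamma>2 T = y \<Longrightarrow>
       Uo (q 0) + integral {0..T} (\<lambda>t. ell (q t) (p t)) \<le> Uo (\<gamma>1 0) + cost 0 s \<gamma>1 g1 + cost s T \<gamma>2 g2"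
proof -
  \<comment> \<open>Large enough for the two smallness conditions of
    \<open>discrete_extremal\<close> to hold for every n.\<close>
  define n0 where "n0 = nat \<lceil>T * Bd + T * T * (2 * Lp * Bd\<^sup>2)\<rceil> + 1"
  define N where "N n = n + n0" for n
  define h where "h n = T / N n" for n
  have N: "N n > 0" "filterlim N at_top sequentially" for n
    unfolding N_def n0_def by (auto intro!: filterlim_at_top_mono[OF filterlim_ident])
  have hN: "real (N n) * h n = T" for n using N(1)[of n] by (simp add: h_def)
  have h: "h n > 0" for n using T N(1)[of n] by (simp add: h_def)
  have big: "T * Bd + T * T * (2 * Lp * Bd\<^sup>2) < N n" for n
    unfolding N_def n0_def by (simp, linarith)
  have nn: "T * Bd \<ge> 0" "T * T * (2 * Lp * Bd\<^sup>2) \<ge> 0" using T Bd(1) Lp(1) by auto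
  have h1: "h n * Bd < 1" for n using big[of n] nn N(1)[of n] by (simp add: h_def field_simps)
  have h2: "real (N n) * h n * h n * (2 * Lp * Bd\<^sup>2) \<le> 1" for n
    unfolding hN using big[of n] nn N(1)[of n] by (simp add: h_def field_simps)
  have ex: "\<exists>x p. x (N n) = y \<and> \<bar>p 0\<bar> \<le> K \<and> (\<forall>k\<le>N n. \<bar>p k\<bar> \<le> Rad - 1) \<and>
    (\<forall>k<N n. x (Suc k) = x k + h n * Hp (x k) (p (Suc k))) \<and>
    (\<forall>k<N n. p k = p (Suc k) + h n * Hx (x k) (p (Suc k))) \<and>
    (\<forall>k<N n. Vd (h n) (Suc k) (x (Suc k)) = Vd (h n) k (x k) + h n * ell (x k) (p (Suc k)))" for n
    by (rule discrete_extremal[OF h h1 h2 N(1), of n y]) blast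
  then obtain x p where xN: "\<And>n. x n (N n) = y" and pb: "\<And>n k. k \<le> N n \<Longrightarrow> \<bar>p n k\<bar> \<le> Rad - 1"
    and sx: "\<And>n k. k < N n \<Longrightarrow> x n (Suc k) = x n k + h n * Hp (x n k) (p n (Suc k))"
    and sp: "\<And>n k. k < N n \<Longrightarrow> p n k = p n (Suc k) + h n * Hx (x n k) (p n (Suc k))"
    and sc: "\<And>n k. k < N n \<Longrightarrow> Vd (h n) (Suc k) (x n (Suc k)) = Vd (h n) k (x n k) + h n * ell (x n k) (p n (Suc k))"
    by metis
  define c where "c n k = Vd (h n) k (x n k)" for n k
  have pR: "\<bar>p n k\<bar> \<le> Rad" if "k \<le> N n" for n k using pb[OF that] by simp
  have bx: "\<bar>x n k\<bar> \<le> \<bar>y\<bar> + T * Bd" if "k \<le> N n" for n k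
  proof -
    have "\<bar>x n (N n) - x n k - (real (N n) - real k) * h n * 0\<bar> \<le> (real (N n) - real k) * h n * Bd"
      by (rule euler_increment[where z="x n" and f="\<lambda>k. Hp (x n k) (p n (Suc k))", OF that])
        (use sx h[of n] pR Bd(4) in auto)
    moreover have "(real (N n) - real k) * h n * Bd \<le> real (N n) * h n * Bd"
      using h[of n] Bd(1) by (intro mult_right_mono) auto
    ultimately show ?thesis using xN[of n] hN[of n] by simp
  qed
  have bc: "\<bar>c n k\<bar> \<le> \<bar>Uo 0\<bar> + K * (\<bar>y\<bar> + T * Bd) + T * Bd" if "k \<le> N n" for n k
  proof -
    have "\<bar>Uo (x n k)\<bar> \<le> \<bar>Uo 0\<bar> + K * \<bar>x n k\<bar>" using Uo_lip[of "x n k" 0] by simp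
    moreover have "K * \<bar>x n k\<bar> \<le> K * (\<bar>y\<bar> + T * Bd)" using bx[OF that] K_nonneg by (intro mult_left_mono)
    moreover have "\<bar>c n k - Uo (x n k)\<bar> \<le> real k * (h n * Bd)" unfolding c_def by (rule Vd_dist_datum[OF h])
    moreover have "real k * (h n * Bd) \<le> real (N n) * (h n * Bd)" using that h[of n] Bd(1) by (intro mult_right_mono) auto
    moreover have "real (N n) * (h n * Bd) = T * Bd" using hN[of n] by (simp add: mult.assoc[symmetric])
    ultimately show ?thesis by linarith
  qed
  define B where "B = Rad + (\<bar>y\<bar> + T * Bd) + (\<bar>Uo 0\<bar> + K * (\<bar>y\<bar> + T * Bd) + T * Bd)"
  have nnB: "0 \<le> Rad" "0 \<le> \<bar>y\<bar> + T * Bd" "0 \<le> \<bar>Uo 0\<bar> + K * (\<bar>y\<bar> + T * Bd) + T * Bd"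
    using Rad_nonneg nn K_nonneg by auto
  have bB: "\<bar>x n k\<bar> \<le> B" "\<bar>p n k\<bar> \<le> B" "\<bar>c n k\<bar> \<le> B" if "k \<le> N n" for n k
    using bx[OF that] pR[OF that] bc[OF that] nnB unfolding B_def by linarith+
  define C where "C = 2 * Bd * ((Rad + 1) * Lp + Bd)"
  have C: "C \<ge> 0" using Bd(1) Lp(1) Rad_nonneg by (simp add: C_def)
  have inc: "\<bar>x n j - x n i - d * Hp (x n i) (p n i)\<bar> \<le> C * d\<^sup>2"
    "\<bar>p n j - p n i - d * (- Hx (x n i) (p n i))\<bar> \<le> C * d\<^sup>2"
    "\<bar>c n j - c n i - d * ell (x n i) (p n i)\<bar> \<le> C * d\<^sup>2"
    if "i \<le> j" "j \<le> N n" "d = (real j - real i) * (T / N n)" for n i j d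
    unfolding C_def using discrete_increments[where x="x n" and p="p n" and c="c n" and N="N n" and h="h n",
      OF h pR sx sp sc[folded c_def] that(1,2) that(3)[folded h_def]] by auto
  obtain r q P w where r: "strict_mono (r :: nat \<Rightarrow> nat)" and HS: "HS_sol H T q P"
    and dw: "\<And>s. s \<in> {0..T} \<Longrightarrow> (w has_real_derivative ell (q s) (P s)) (at s within {0..T})"
    and lx: "\<And>s::real. s \<in> {0..T} \<Longrightarrow> (\<lambda>n. x (r n) (nat \<lfloor>s * N (r n) / T\<rfloor>)) \<longlonglongrightarrow> q s"
    and lc: "\<And>s::real. s \<in> {0..T} \<Longrightarrow> (\<lambda>n. c (r n) (nat \<lfloor>s * N (r n) / T\<rfloor>)) \<longlonglongrightarrow> w s"
    by (rule limit_extremal[where x=x and p=p and c=c and N=N, OF T N bB C inc]; (assumption | (rule that; assumption)))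
  have flT: "nat \<lfloor>T * N n / T\<rfloor> = N n" "nat \<lfloor>0 * N n / T\<rfloor> = 0" for n using T by auto
  have "(\<lambda>n. y) \<longlonglongrightarrow> q T" using lx[of T] T by (simp add: flT xN)
  then have qT: "q T = y" using LIMSEQ_unique tendsto_const by blast
  have lc0: "(\<lambda>n. Uo (x (r n) 0)) \<longlonglongrightarrow> w 0" using lc[of 0] T by (simp add: flT c_def)
  have "(\<lambda>n. x (r n) 0) \<longlonglongrightarrow> q 0" using lx[of 0] T by (simp add: flT)
  then have "(\<lambda>n. Uo (x (r n) 0)) \<longlonglongrightarrow> Uo (q 0)"
    using isCont_tendsto_compose Uo_continuous[of UNIV] continuous_on_eq_continuous_at by blast
  then have w0: "w 0 = Uo (q 0)" using lc0 LIMSEQ_unique by blast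
  have lcT: "(\<lambda>n. Vd (h (r n)) (N (r n)) y) \<longlonglongrightarrow> w T" using lc[of T] T by (simp add: flT c_def xN)
  have "((\<lambda>t. ell (q t) (P t)) has_integral w T - w 0) {0..T}"
    by (rule fundamental_theorem_of_calculus) (use T dw in \<open>auto simp: has_real_derivative_iff_has_vector_derivative\<close>)
  from integral_unique[OF this] have wT: "Uo (q 0) + integral {0..T} (\<lambda>t. ell (q t) (P t)) = w T" using w0 by simp
  have h0: "(\<lambda>n. h (r n)) \<longlonglongrightarrow> 0"
  proof -
    have "filterlim (\<lambda>n. N (r n)) at_top sequentially"
      using N(2) filterlim_subseq[OF r] by (rule filterlim_compose)
    from filterlim_compose[OF filterlim_real_sequentially this] show ?thesis unfolding h_def
      by (intro tendsto_divide_0[OF tendsto_const] filterlim_at_top_imp_at_infinity)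
  qed
  show ?thesis
  proof (rule that[OF HS qT], unfold wT)
    fix s \<gamma>1 g1 \<gamma>2 g2
    assume s: "s \<in> {0..T}" and c1: "C1c 0 s \<gamma>1 g1" and c2: "C1c s T \<gamma>2 g2" and eq: "\<gamma>1 s = \<gamma>2 s" "\<gamma>2 T = y"
    obtain M1 where M1: "M1 > 0" "\<And>t. t \<in> {0..s} \<Longrightarrow> \<bar>g1 t\<bar> \<le> M1" using C1c_bounded[OF c1] by metis
    obtain M2 where M2: "M2 > 0" "\<And>t. t \<in> {s..T} \<Longrightarrow> \<bar>g2 t\<bar> \<le> M2" using C1c_bounded[OF c2] by metis
    define A where "A = Lp * M1 * (T + 1) + Lp * M2 * (T + 1) + 4 * Bd"
    \<comment> \<open>The corner s need not be a grid time. The first curve is used up to step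
      \<open>Suc i\<close> and the second from step \<open>i\<close>, with s between the two grid
      times; going back over the overlapping step costs \<open>h n * Bd\<close> by
      \<open>Vd_time\<close>.\<close>
    have bnd: "Vd (h n) (N n) y \<le> Uo (\<gamma>1 0) + cost 0 s \<gamma>1 g1 + cost s T \<gamma>2 g2 + h n * (Lp * M1 * (T + h n) + Lp * M2 * T + 3 * Bd)" for n
    proof -
      define i where "i = nat \<lfloor>s / h n\<rfloor>"
      have "s / h n \<ge> 0" using s h[of n] by simp
      then have "real i \<le> s / h n" "s / h n \<le> real i + 1" unfolding i_def by linarith+
      then have i: "real i * h n \<le> s" "s \<le> real (Suc i) * h n" using h[of n] by (simp_all add: field_simps)
      have iN: "i \<le> N n"
      proof -
        have "real i * h n \<le> real (N n) * h n" using i(1) s hN[of n] by simp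
        then show ?thesis using h[of n] by simp
      qed
      have e1: "max 0 (min s (real (Suc i) * h n)) = s" using i s by (auto simp: min_def max_def)
      have "Vd (h n) (Suc i) (\<gamma>1 s) \<le> Vd (h n) 0 (\<gamma>1 0) + cost 0 s \<gamma>1 g1
          + Bd * (real (Suc i - 0) * h n - (s - 0)) + Lp * M1 * h n * (real (Suc i - 0) * h n)"
        using competitor[OF h c1 _ M1(2), of 0 n "Suc i", unfolded e1] s M1(1) by simp
      moreover have "Bd * (real (Suc i - 0) * h n - (s - 0)) \<le> Bd * h n"
        using Bd(1) i by (intro mult_left_mono) (auto simp: algebra_simps)
      moreover have "Lp * M1 * h n * (real (Suc i - 0) * h n) \<le> Lp * M1 * h n * (T + h n)"
        using Lp(1) M1(1) h[of n] i s by (intro mult_left_mono) (auto simp: algebra_simps)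
      moreover have e2: "max s (min T (real (N n) * h n)) = T" using hN[of n] s by simp
      have e3: "real (N n - i) * h n = T - real i * h n" using iN hN[of n] by (simp add: of_nat_diff algebra_simps)
      have "Vd (h n) (N n) (\<gamma>2 T) \<le> Vd (h n) i (\<gamma>2 s) + cost s T \<gamma>2 g2
          + Bd * ((T - real i * h n) - (T - s)) + Lp * M2 * h n * (T - real i * h n)"
        using competitor[OF h c2 _ M2(2), of i n "N n", unfolded e2 e3] s M2(1) i iN by simp
      moreover have "Bd * ((T - real i * h n) - (T - s)) \<le> Bd * h n"
        using Bd(1) i by (intro mult_left_mono) (auto simp: algebra_simps)
      moreover have "Lp * M2 * h n * (T - real i * h n) \<le> Lp * M2 * h n * T"
        using Lp(1) M2(1) h[of n] by (intro mult_left_mono) auto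
      moreover have "Vd (h n) i (\<gamma>1 s) \<le> Vd (h n) (Suc i) (\<gamma>1 s) + h n * Bd"
        using Vd_time[OF h, of n i "\<gamma>1 s"] by (simp add: abs_le_iff)
      moreover have "h n * (Lp * M1 * (T + h n) + Lp * M2 * T + 3 * Bd)
          = Lp * M1 * h n * (T + h n) + Lp * M2 * h n * T + (Bd * h n + Bd * h n + h n * Bd)"
        by (simp add: algebra_simps)
      ultimately show ?thesis using eq mult.commute[of Bd "h n"] by simp
    qed
    have "(\<lambda>n. Uo (\<gamma>1 0) + cost 0 s \<gamma>1 g1 + cost s T \<gamma>2 g2 + h (r n) * (Lp * M1 * (T + h (r n)) + Lp * M2 * T + 3 * Bd))
      \<longlonglongrightarrow> Uo (\<gamma>1 0) + cost 0 s \<gamma>1 g1 + cost s T \<gamma>2 g2 + 0 * (Lp * M1 * (T + 0) + Lp * M2 * T + 3 * Bd)"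
      by (intro tendsto_intros h0)
    from LIMSEQ_le[OF lcT this] bnd
    show "w T \<le> Uo (\<gamma>1 0) + cost 0 s \<gamma>1 g1 + cost s T \<gamma>2 g2" by auto
  qed
qed

end

section \<open>The value function\<close>

lemma lipschitz_of_local:
  fixes f :: "real \<Rightarrow> real"
  assumes loc: "\<And>x y. \<bar>x - y\<bar> \<le> 1 \<Longrightarrow> \<bar>f x - f y\<bar> \<le> L * \<bar>x - y\<bar>"
  shows "\<bar>f x - f y\<bar> \<le> L * \<bar>x - y\<bar>"
proof -
  have "\<bar>x - y\<bar> \<le> real n \<Longrightarrow> \<bar>f x - f y\<bar> \<le> L * \<bar>x - y\<bar>" for n x y
  proof (induction n arbitrary: x y)
    case (Suc n)
    define z where "z = x + (y - x) * (real n / (real n + 1))"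
    have 1: "x - z = (x - y) * (real n / (real n + 1))" "z - y = (x - y) * (1 / (real n + 1))"
      by (simp_all add: z_def field_simps)
    have a: "\<bar>x - z\<bar> = \<bar>x - y\<bar> * (real n / (real n + 1))" "\<bar>z - y\<bar> = \<bar>x - y\<bar> * (1 / (real n + 1))"
      unfolding 1 abs_mult by simp_all
    have "\<bar>x - z\<bar> \<le> (real n + 1) * (real n / (real n + 1))" "\<bar>z - y\<bar> \<le> (real n + 1) * (1 / (real n + 1))"
      unfolding a using Suc.prems by (intro mult_right_mono; simp)+
    then have "\<bar>x - z\<bar> \<le> real n" "\<bar>z - y\<bar> \<le> 1" by simp_all
    then have "\<bar>f x - f z\<bar> \<le> L * \<bar>x - z\<bar>" "\<bar>f z - f y\<bar> \<le> L * \<bar>z - y\<bar>" using Suc.IH loc by blast+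
    moreover have "\<bar>x - z\<bar> + \<bar>z - y\<bar> = \<bar>x - y\<bar>"
      unfolding a distrib_left[symmetric] add_divide_distrib[symmetric] by simp
    moreover have "\<bar>f x - f y\<bar> \<le> L * \<bar>x - z\<bar> + L * \<bar>z - y\<bar>" using calculation by linarith
    ultimately show ?case by (metis distrib_left)
  qed simp
  moreover obtain n where "\<bar>x - y\<bar> \<le> real n" using real_arch_simple by blast
  ultimately show ?thesis by blast
qed

section \<open>Extremals and their first variation\<close>

context ham begin

definition HSab :: "real \<Rightarrow> real \<Rightarrow> (real \<Rightarrow> real) \<Rightarrow> (real \<Rightarrow> real) \<Rightarrow> bool" where
  "HSab a b q p \<longleftrightarrow> (\<forall>t\<in>{a..b}. (q has_real_derivative Hp (q t) (p t)) (at t within {a..b}) \<and>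
      (p has_real_derivative - Hx (q t) (p t)) (at t within {a..b}))"

lemma HS_sol_iff: "HS_sol H T q p \<longleftrightarrow> HSab 0 T q p"
  unfolding HS_sol_def HSab_def ..

lemma HSab_subset:
  assumes "HSab a b q p" "a \<le> c" "d \<le> b" shows "HSab c d q p"
proof -
  have sub: "{c..d} \<subseteq> {a..b}" using assms(2,3) by auto
  show ?thesis unfolding HSab_def
  proof (intro ballI conjI)
    fix t assume "t \<in> {c..d}"
    then have "t \<in> {a..b}" using sub by (rule rev_subsetD)
    then have *: "(q has_real_derivative Hp (q t) (p t)) (at t within {a..b})"
      "(p has_real_derivative - Hx (q t) (p t)) (at t within {a..b})"
      using assms(1) unfolding HSab_def by blast+
    show "(q has_real_derivative Hp (q t) (p t)) (at t within {c..d})"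
      "(p has_real_derivative - Hx (q t) (p t)) (at t within {c..d})"
      by (rule has_field_derivative_subset[OF *(1) sub], rule has_field_derivative_subset[OF *(2) sub])
  qed
qed

lemma HSab_continuous:
  assumes "HSab a b q p" shows "continuous_on {a..b} q" "continuous_on {a..b} p"
proof -
  show "continuous_on {a..b} q" by (rule DERIV_continuous_on) (use assms in \<open>auto simp: HSab_def\<close>)
  show "continuous_on {a..b} p" by (rule DERIV_continuous_on) (use assms in \<open>auto simp: HSab_def\<close>)
qed

lemma HSab_C1c: "HSab a b q p \<Longrightarrow> C1c a b q (\<lambda>s. Hp (q s) (p s))"
  unfolding C1c_def
  by (intro conjI continuous_intros HSab_continuous) (auto simp: HSab_def)

lemma HSab_cost: "cost a b q (\<lambda>s. Hp (q s) (p s)) = integral {a..b} (\<lambda>s. ell (q s) (p s))"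
  unfolding cost_def Lag_Hp ..

lemma HSab_ell_integrable: "HSab a b q p \<Longrightarrow> (\<lambda>s. ell (q s) (p s)) integrable_on {a..b}"
  by (intro integrable_continuous_real continuous_intros HSab_continuous)

lemma HSab_ell_combine:
  assumes "HSab a b q p" "a \<le> c" "c \<le> b"
  shows "integral {a..b} (\<lambda>s. ell (q s) (p s)) = integral {a..c} (\<lambda>s. ell (q s) (p s)) + integral {c..b} (\<lambda>s. ell (q s) (p s))"
  using cost_combine[OF HSab_C1c[OF assms(1)] assms(2,3)] unfolding HSab_cost .

lemma HSab_energy:
  assumes "HSab a b q p" "s \<in> {a..b}" "t \<in> {a..b}"
  shows "H (q s) (p s) = H (q t) (p t)"
proof -
  have "\<exists>c. \<forall>t\<in>{a..b}. H (q t) (p t) = c"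
  proof (rule has_field_derivative_zero_constant)
    fix t assume t: "t \<in> {a..b}"
    have d: "(q has_derivative (\<lambda>h. Hp (q t) (p t) * h)) (at t within {a..b})"
      "(p has_derivative (\<lambda>h. - Hx (q t) (p t) * h)) (at t within {a..b})"
      using assms(1) t unfolding HSab_def has_field_derivative_def by blast+
    have "((\<lambda>s. H (fst (q s, p s)) (snd (q s, p s))) has_derivative
        (\<lambda>h. Hx (q t) (p t) * fst (Hp (q t) (p t) * h, - Hx (q t) (p t) * h) +
             Hp (q t) (p t) * snd (Hp (q t) (p t) * h, - Hx (q t) (p t) * h))) (at t within {a..b})"
      by (rule has_derivative_compose[OF has_derivative_Pair[OF d] joint[of "q t" "p t"]])
    then show "((\<lambda>s. H (q s) (p s)) has_real_derivative 0) (at t within {a..b})"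
      unfolding has_field_derivative_def lambda_zero[symmetric] by (simp add: algebra_simps)
  qed simp
  then show ?thesis using assms by metis
qed

text \<open>Moving the extremal by \<open>\<delta>\<close> times an affine function changes the action, to first order, by the
  boundary terms only; the quadratic error is uniform over extremals with bounded momentum.\<close>

definition variation_const :: "real \<Rightarrow> real \<Rightarrow> real \<Rightarrow> bool" where
  "variation_const R k0 C \<longleftrightarrow> C > 0 \<and> (\<forall>a b q p m k \<delta>. a \<le> b \<longrightarrow> HSab a b q p \<longrightarrow> (\<forall>s\<in>{a..b}. \<bar>p s\<bar> \<le> R) \<longrightarrow>
    (\<forall>s\<in>{a..b}. \<bar>m + k * s\<bar> \<le> 1) \<longrightarrow> \<bar>k\<bar> \<le> k0 \<longrightarrow> \<bar>\<delta>\<bar> \<le> 1 \<longrightarrow>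
    C1c a b (\<lambda>s. q s + \<delta> * (m + k * s)) (\<lambda>s. Hp (q s) (p s) + \<delta> * k) \<and>
    cost a b (\<lambda>s. q s + \<delta> * (m + k * s)) (\<lambda>s. Hp (q s) (p s) + \<delta> * k)
      \<le> integral {a..b} (\<lambda>s. ell (q s) (p s)) + \<delta> * (p b * (m + k * b) - p a * (m + k * a)) + C * (b - a) * \<delta>\<^sup>2)"

lemma first_variation:
  assumes "variation_const R k0 C" "a \<le> b" "HSab a b q p" "\<And>s. s \<in> {a..b} \<Longrightarrow> \<bar>p s\<bar> \<le> R"
    "\<And>s. s \<in> {a..b} \<Longrightarrow> \<bar>m + k * s\<bar> \<le> 1" "\<bar>k\<bar> \<le> k0" "\<bar>\<delta>\<bar> \<le> 1"
  shows "C1c a b (\<lambda>s. q s + \<delta> * (m + k * s)) (\<lambda>s. Hp (q s) (p s) + \<delta> * k)"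
    "cost a b (\<lambda>s. q s + \<delta> * (m + k * s)) (\<lambda>s. Hp (q s) (p s) + \<delta> * k)
      \<le> integral {a..b} (\<lambda>s. ell (q s) (p s)) + \<delta> * (p b * (m + k * b) - p a * (m + k * a)) + C * (b - a) * \<delta>\<^sup>2"
proof -
  have "C1c a b (\<lambda>s. q s + \<delta> * (m + k * s)) (\<lambda>s. Hp (q s) (p s) + \<delta> * k) \<and>
    cost a b (\<lambda>s. q s + \<delta> * (m + k * s)) (\<lambda>s. Hp (q s) (p s) + \<delta> * k)
      \<le> integral {a..b} (\<lambda>s. ell (q s) (p s)) + \<delta> * (p b * (m + k * b) - p a * (m + k * a)) + C * (b - a) * \<delta>\<^sup>2"
    using assms(1)[unfolded variation_const_def, THEN conjunct2, rule_format, OF assms(2-3) _ _ assms(6-7), of m] assms(4,5)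
    by blast
  then show "C1c a b (\<lambda>s. q s + \<delta> * (m + k * s)) (\<lambda>s. Hp (q s) (p s) + \<delta> * k)"
    "cost a b (\<lambda>s. q s + \<delta> * (m + k * s)) (\<lambda>s. Hp (q s) (p s) + \<delta> * k)
      \<le> integral {a..b} (\<lambda>s. ell (q s) (p s)) + \<delta> * (p b * (m + k * b) - p a * (m + k * a)) + C * (b - a) * \<delta>\<^sup>2"
    by (rule conjunct1, rule conjunct2)
qed

lemma variation_const_pos: "variation_const R k0 C \<Longrightarrow> C > 0"
  unfolding variation_const_def by (rule conjunct1)

text \<open>\<open>Lag_upper\<close> is applied pointwise along the extremal. Its linear part
  integrates exactly, since by (HS) \<open>p * k - Hx * (m + k * s)\<close> is the derivative of
  \<open>p * (m + k * s)\<close>.\<close>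

lemma variation_const_exists:
  assumes "k0 \<ge> 0"
  shows "\<exists>C. variation_const R k0 C"
proof -
  obtain D where D: "D > 0" "\<And>x p. \<bar>p\<bar> \<le> R \<Longrightarrow> \<bar>Hp x p\<bar> \<le> D" using bounds[of R] by metis
  obtain C where C: "C > 0" "\<And>x y v w. \<bar>v\<bar> \<le> D + k0 \<Longrightarrow> \<bar>w\<bar> \<le> D + k0 \<Longrightarrow>
    Lag H y w \<le> Lag H x v + mom x v * (w - v) - Hx x (mom x v) * (y - x) + C * (\<bar>y - x\<bar> + \<bar>w - v\<bar>)\<^sup>2"
    using Lag_upper[of "D + k0"] by metis
  show ?thesis
    unfolding variation_const_def
  proof (intro exI[of _ "C * (1 + k0)\<^sup>2"] conjI[of "0 < _"] allI impI)
    show "C * (1 + k0)\<^sup>2 > 0" using C(1) assms by simp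
    fix a b q p m k \<delta>
    assume ab: "a \<le> b" and HS: "HSab a b q p" and "\<forall>s\<in>{a..b}. \<bar>p s\<bar> \<le> R"
      and "\<forall>s\<in>{a..b}. \<bar>m + k * s\<bar> \<le> 1" and k: "\<bar>k\<bar> \<le> k0" and \<delta>: "\<bar>\<delta>\<bar> \<le> (1::real)"
    then have pR: "\<And>s. s \<in> {a..b} \<Longrightarrow> \<bar>p s\<bar> \<le> R" and \<phi>: "\<And>s. s \<in> {a..b} \<Longrightarrow> \<bar>m + k * s\<bar> \<le> 1" by blast+
    let ?g = "\<lambda>s. q s + \<delta> * (m + k * s)" and ?g' = "\<lambda>s. Hp (q s) (p s) + \<delta> * k"
    have c1: "C1c a b ?g ?g'"
      unfolding C1c_def
    proof (intro conjI ballI)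
      fix t assume "t \<in> {a..b}"
      then have "(q has_real_derivative Hp (q t) (p t)) (at t within {a..b})" using HS by (simp add: HSab_def)
      then show "(?g has_real_derivative ?g' t) (at t within {a..b})" by (auto intro!: derivative_eq_intros)
    qed (intro continuous_intros HSab_continuous[OF HS])
    define F where "F s = ell (q s) (p s) + \<delta> * (p s * k - Hx (q s) (p s) * (m + k * s)) + C * (1 + k0)\<^sup>2 * \<delta>\<^sup>2" for s
    have "((\<lambda>s. p s * k - Hx (q s) (p s) * (m + k * s)) has_integral p b * (m + k * b) - p a * (m + k * a)) {a..b}"
    proof (rule fundamental_theorem_of_calculus[OF ab])
      fix s assume "s \<in> {a..b}"
      then have "(p has_real_derivative - Hx (q s) (p s)) (at s within {a..b})" using HS by (simp add: HSab_def)
      then show "((\<lambda>s. p s * (m + k * s)) has_vector_derivative p s * k - Hx (q s) (p s) * (m + k * s)) (at s within {a..b})"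
        unfolding has_real_derivative_iff_has_vector_derivative[symmetric]
        by (auto intro!: derivative_eq_intros)
    qed
    from has_integral_add[OF has_integral_add[OF integrable_integral[OF HSab_ell_integrable[OF HS]] has_integral_mult_right[OF this, of \<delta>]]
        has_integral_const_real[of "C * (1 + k0)\<^sup>2 * \<delta>\<^sup>2" a b]]
    have I: "(F has_integral integral {a..b} (\<lambda>s. ell (q s) (p s)) + \<delta> * (p b * (m + k * b) - p a * (m + k * a))
        + C * (1 + k0)\<^sup>2 * (b - a) * \<delta>\<^sup>2) {a..b}"
      using ab unfolding F_def by (simp add: mult_ac)
    have J: "((\<lambda>s. Lag H (?g s) (?g' s)) has_integral cost a b ?g ?g') {a..b}"
      unfolding cost_def using cost_integrable[OF c1] by blast
    have "cost a b ?g ?g' \<le> integral {a..b} (\<lambda>s. ell (q s) (p s)) + \<delta> * (p b * (m + k * b) - p a * (m + k * a))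
        + C * (1 + k0)\<^sup>2 * (b - a) * \<delta>\<^sup>2"
    proof (rule has_integral_le[OF J I])
      fix s assume s: "s \<in> {a..b}"
      have dk: "\<bar>\<delta> * k\<bar> \<le> \<bar>\<delta>\<bar> * k0" "\<bar>\<delta> * (m + k * s)\<bar> \<le> \<bar>\<delta>\<bar> * 1"
        unfolding abs_mult by (rule mult_left_mono[OF k], simp, rule mult_left_mono[OF \<phi>[OF s]], simp)
      have "\<bar>\<delta>\<bar> * k0 \<le> k0" using \<delta> assms by (simp add: mult_left_le_one_le)
      then have "\<bar>?g' s\<bar> \<le> D + k0" "\<bar>Hp (q s) (p s)\<bar> \<le> D + k0"
        using D(2)[OF pR[OF s], of "q s"] dk(1) assms by linarith+
      from C(2)[OF this(2,1), of "?g s" "q s"]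
      have "Lag H (?g s) (?g' s) \<le> ell (q s) (p s) + p s * (\<delta> * k) - Hx (q s) (p s) * (\<delta> * (m + k * s)) + C * (\<bar>\<delta> * (m + k * s)\<bar> + \<bar>\<delta> * k\<bar>)\<^sup>2"
        by (simp add: Lag_Hp)
      also have "C * (\<bar>\<delta> * (m + k * s)\<bar> + \<bar>\<delta> * k\<bar>)\<^sup>2 \<le> C * (\<bar>\<delta>\<bar> * (1 + k0))\<^sup>2"
        using C(1) dk by (intro mult_left_mono power_mono) (auto simp: algebra_simps)
      finally show "Lag H (?g s) (?g' s) \<le> F s" unfolding F_def power_mult_distrib by (simp add: algebra_simps)
    qed
    with c1 show "C1c a b ?g ?g' \<and> cost a b ?g ?g' \<le> integral {a..b} (\<lambda>s. ell (q s) (p s))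
        + \<delta> * (p b * (m + k * b) - p a * (m + k * a)) + C * (1 + k0)\<^sup>2 * (b - a) * \<delta>\<^sup>2" by blast
  qed
qed

lemma C1c_singleton: "C1c a a \<gamma> g"
proof -
  have "at a within {a} = bot" by (simp add: at_within_eq_bot_iff)
  then show ?thesis unfolding C1c_def by (simp add: has_field_derivative_iff)
qed

lemma cost_singleton [simp]: "cost a a \<gamma> g = 0"
  by (simp add: cost_def)

end

section \<open>The value function: dynamic programming and Lipschitz bounds\<close>

context cauchy begin

definition u :: "real \<Rightarrow> real \<Rightarrow> real" where
  "u t y = Inf {Uo (\<gamma> 0) + cost 0 t \<gamma> g | \<gamma> g. C1c 0 t \<gamma> g \<and> \<gamma> t = y}"

text \<open>A minimizer must solve (HS) and carries its momentum, although \<open>u\<close> is an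
  infimum over all C1 curves; that this class contains one is the content of
  \<open>tonelli\<close>.\<close>

definition Mini :: "real \<Rightarrow> real \<Rightarrow> (real \<Rightarrow> real) \<Rightarrow> (real \<Rightarrow> real) \<Rightarrow> bool" where
  "Mini t y q p \<longleftrightarrow> HSab 0 t q p \<and> q t = y \<and> u t y = Uo (q 0) + integral {0..t} (\<lambda>s. ell (q s) (p s))"

lemma u_0: "u 0 y = Uo y"
proof -
  have "{Uo (\<gamma> 0) + cost 0 0 \<gamma> g | \<gamma> g. C1c 0 0 \<gamma> g \<and> \<gamma> 0 = y} = {Uo y}"
  proof (intro equalityI subsetI)
    fix z assume "z \<in> {Uo y}"
    then show "z \<in> {Uo (\<gamma> 0) + cost 0 0 \<gamma> g | \<gamma> g. C1c 0 0 \<gamma> g \<and> \<gamma> 0 = y}"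
      by (intro CollectI exI[of _ "\<lambda>_. y"] exI[of _ "\<lambda>_. 0"]) (simp add: C1c_singleton)
  next
    fix z assume "z \<in> {Uo (\<gamma> 0) + cost 0 0 \<gamma> g | \<gamma> g. C1c 0 0 \<gamma> g \<and> \<gamma> 0 = y}"
    then obtain \<gamma> g where "z = Uo (\<gamma> 0) + cost 0 0 \<gamma> g" "\<gamma> 0 = y" by blast
    then show "z \<in> {Uo y}" by simp
  qed
  then show ?thesis unfolding u_def by simp
qed

lemma u_tonelli:
  assumes T: "T > 0"
  obtains q p where "Mini T y q p"
    "\<And>s \<gamma>1 g1 \<gamma>2 g2. s \<in> {0..T} \<Longrightarrow> C1c 0 s \<gamma>1 g1 \<Longrightarrow> C1c s T \<gamma>2 g2 \<Longrightarrow> \<gamma>1 s = \<gamma>2 s \<Longrightarrow> \<gamma>2 T = y \<Longrightarrow>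
       u T y \<le> Uo (\<gamma>1 0) + cost 0 s \<gamma>1 g1 + cost s T \<gamma>2 g2"
proof (rule tonelli[OF T, of y])
  fix q p assume q: "HS_sol H T q p" "q T = y"
    and m: "\<And>s \<gamma>1 g1 \<gamma>2 g2. s \<in> {0..T} \<Longrightarrow> C1c 0 s \<gamma>1 g1 \<Longrightarrow> C1c s T \<gamma>2 g2 \<Longrightarrow> \<gamma>1 s = \<gamma>2 s \<Longrightarrow> \<gamma>2 T = y \<Longrightarrow>
       Uo (q 0) + integral {0..T} (\<lambda>t. ell (q t) (p t)) \<le> Uo (\<gamma>1 0) + cost 0 s \<gamma>1 g1 + cost s T \<gamma>2 g2"
  have HS: "HSab 0 T q p" using q by (simp only: HS_sol_iff)
  have uT: "u T y = Uo (q 0) + integral {0..T} (\<lambda>t. ell (q t) (p t))" unfolding u_def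
  proof (rule cInf_eq_minimum)
    show "Uo (q 0) + integral {0..T} (\<lambda>t. ell (q t) (p t)) \<in> {Uo (\<gamma> 0) + cost 0 T \<gamma> g | \<gamma> g. C1c 0 T \<gamma> g \<and> \<gamma> T = y}"
      by (intro CollectI exI[of _ q] exI[of _ "\<lambda>s. Hp (q s) (p s)"]) (simp only: HSab_C1c[OF HS] HSab_cost q(2) simp_thms)
    fix z assume "z \<in> {Uo (\<gamma> 0) + cost 0 T \<gamma> g | \<gamma> g. C1c 0 T \<gamma> g \<and> \<gamma> T = y}"
    then obtain \<gamma> g where z: "z = Uo (\<gamma> 0) + cost 0 T \<gamma> g" "C1c 0 T \<gamma> g" "\<gamma> T = y" by blast
    have "T \<in> {0..T}" using T by simp
    from m[OF this z(2) C1c_singleton[of T \<gamma> g] refl z(3)]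
    show "Uo (q 0) + integral {0..T} (\<lambda>t. ell (q t) (p t)) \<le> z" unfolding z(1) cost_singleton by linarith
  qed
  have "Mini T y q p" using HS q(2) uT unfolding Mini_def by blast
  then show thesis using m unfolding uT[symmetric] by (rule that)
qed

lemma Mini_exists:
  assumes "T > 0" shows "\<exists>q p. Mini T y q p"
  by (rule u_tonelli[OF assms, of y]) (intro exI)

lemma u_broken:
  assumes "T > 0" "s \<in> {0..T}" "C1c 0 s \<gamma>1 g1" "C1c s T \<gamma>2 g2" "\<gamma>1 s = \<gamma>2 s"
  shows "u T (\<gamma>2 T) \<le> Uo (\<gamma>1 0) + cost 0 s \<gamma>1 g1 + cost s T \<gamma>2 g2"
proof (rule u_tonelli[OF assms(1), of "\<gamma>2 T"])
  fix q p assume "\<And>s \<gamma>1 g1 \<gamma>2' g2. s \<in> {0..T} \<Longrightarrow> C1c 0 s \<gamma>1 g1 \<Longrightarrow> C1c s T \<gamma>2' g2 \<Longrightarrow> \<gamma>1 s = \<gamma>2' s \<Longrightarrow> \<gamma>2' T = \<gamma>2 T \<Longrightarrow>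
       u T (\<gamma>2 T) \<le> Uo (\<gamma>1 0) + cost 0 s \<gamma>1 g1 + cost s T \<gamma>2' g2"
  from this[OF assms(2-5) refl] show ?thesis .
qed

lemma u_le:
  assumes "T \<ge> 0" "C1c 0 T \<gamma> g"
  shows "u T (\<gamma> T) \<le> Uo (\<gamma> 0) + cost 0 T \<gamma> g"
proof (cases "T = 0")
  case False
  then have "T > 0" using assms by simp
  then show ?thesis using u_broken[of T T \<gamma> g \<gamma> g] assms C1c_singleton[of T \<gamma> g] by simp
qed (simp add: u_0)

text \<open>A minimizer up to time s followed by \<open>\<gamma>\<close> is a curve with a corner,
  which \<open>u_broken\<close> admits as competitor.\<close>

lemma u_dpp:
  assumes "0 \<le> s" "s \<le> t" "C1c s t \<gamma> g"
  shows "u t (\<gamma> t) \<le> u s (\<gamma> s) + cost s t \<gamma> g"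
proof -
  consider "s = 0" | "s > 0" using assms by linarith
  then show ?thesis
  proof cases
    case 1 then show ?thesis using u_le[of t \<gamma> g] assms by (simp add: u_0)
  next
    case 2
    obtain q p where m: "Mini s (\<gamma> s) q p" using Mini_exists[OF 2] by blast
    have "t > 0" using 2 assms by simp
    then have "u t (\<gamma> t) \<le> Uo (q 0) + cost 0 s q (\<lambda>s. Hp (q s) (p s)) + cost s t \<gamma> g"
      using assms m by (intro u_broken HSab_C1c) (auto simp: Mini_def)
    then show ?thesis using m unfolding Mini_def HSab_cost by simp
  qed
qed

text \<open>The restrictions to [0, s] and [s, t] give two upper bounds whose sum is attained, so
  both are equalities.\<close>

lemma Mini_calibrated:
  assumes m: "Mini t y q p" and s: "0 \<le> s" "s \<le> t"
  shows "u t y = u s (q s) + integral {s..t} (\<lambda>s. ell (q s) (p s))" "Mini s (q s) q p"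
proof -
  have HS: "HSab 0 t q p" and y: "q t = y" and ut: "u t y = Uo (q 0) + integral {0..t} (\<lambda>s. ell (q s) (p s))"
    using m by (auto simp: Mini_def)
  have "u t (q t) \<le> u s (q s) + cost s t q (\<lambda>s. Hp (q s) (p s))"
    by (rule u_dpp[OF s HSab_C1c[OF HSab_subset[OF HS]]]) (use s in auto)
  moreover have "u s (q s) \<le> Uo (q 0) + cost 0 s q (\<lambda>s. Hp (q s) (p s))"
    by (rule u_le[OF s(1) HSab_C1c[OF HSab_subset[OF HS]]]) (use s in auto)
  moreover have "integral {0..t} (\<lambda>s. ell (q s) (p s)) = integral {0..s} (\<lambda>s. ell (q s) (p s)) + integral {s..t} (\<lambda>s. ell (q s) (p s))"
    by (rule HSab_ell_combine[OF HS s])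
  ultimately have "u t y = u s (q s) + integral {s..t} (\<lambda>s. ell (q s) (p s))"
    "u s (q s) = Uo (q 0) + integral {0..s} (\<lambda>s. ell (q s) (p s))"
    using ut unfolding HSab_cost y by linarith+
  then show "u t y = u s (q s) + integral {s..t} (\<lambda>s. ell (q s) (p s))" "Mini s (q s) q p"
    using HSab_subset[OF HS order_refl s(2)] by (auto simp: Mini_def)
qed

text \<open>The perturbation \<open>\<delta> * (1 - s / t)\<close> moves the starting point and
  keeps the end point: the action changes by \<open>- \<delta> * p 0\<close> to first order, the
  datum by at most \<open>K * \<bar>\<delta>\<bar>\<close>.\<close>

lemma Mini_initial_momentum:
  assumes m: "Mini t y q p" and t: "t > 0"
  shows "\<bar>p 0\<bar> \<le> K"
proof -
  have HS: "HSab 0 t q p" and y: "q t = y" and ut: "u t y = Uo (q 0) + integral {0..t} (\<lambda>s. ell (q s) (p s))"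
    using m by (auto simp: Mini_def)
  have "compact (p ` {0..t})" by (intro compact_continuous_image HSab_continuous[OF HS]) auto
  then have "bounded (p ` {0..t})" by (rule compact_imp_bounded)
  then obtain R where "\<forall>x\<in>p ` {0..t}. norm x \<le> R" unfolding bounded_iff by blast
  then have R: "\<bar>p s\<bar> \<le> R" if "s \<in> {0..t}" for s using that by auto
  obtain C where C: "variation_const R (1 / t) C" using variation_const_exists t by (metis less_imp_le zero_le_divide_1_iff)
  note C0 = variation_const_pos[OF C]
  have "\<bar>- p 0\<bar> \<le> K"
  proof (rule linear_coeff_bound[of 1 _ _ "C * t"])
    fix \<delta> :: real assume \<delta>: "\<bar>\<delta>\<bar> \<le> 1"
    note * = first_variation[OF C _ HS R, of 1 "- 1 / t" \<delta>]
    have pre: "0 \<le> t" "\<And>s. s \<in> {0..t} \<Longrightarrow> \<bar>1 + (- 1 / t) * s\<bar> \<le> 1" "\<bar>- 1 / t\<bar> \<le> 1 / t"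
      using t by (auto simp: field_simps abs_le_iff)
    have "u t (q t + \<delta> * (1 + (- 1 / t) * t)) \<le> Uo (q 0 + \<delta> * (1 + (- 1 / t) * 0)) +
      cost 0 t (\<lambda>s. q s + \<delta> * (1 + (- 1 / t) * s)) (\<lambda>s. Hp (q s) (p s) + \<delta> * (- 1 / t))"
      by (rule u_le[of t "\<lambda>s. q s + \<delta> * (1 + (- 1 / t) * s)"]) (use t *(1)[OF pre(1) _ pre(2,3) \<delta>] in auto)
    then have "u t y \<le> Uo (q 0 + \<delta>) + (integral {0..t} (\<lambda>s. ell (q s) (p s)) - \<delta> * p 0 + C * t * \<delta>\<^sup>2)"
      using *(2)[OF pre(1) _ pre(2,3) \<delta>] t y by simp
    then show "0 \<le> K * \<bar>\<delta>\<bar> + (- p 0) * \<delta> + C * t * \<delta>\<^sup>2"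
      using ut Uo_lip[of "q 0 + \<delta>" "q 0"] by (simp add: abs_le_iff algebra_simps)
  qed (use C0 t in auto)
  then show ?thesis by simp
qed

text \<open>Conservation of energy carries the bound on \<open>p 0\<close> to all times, so
  \<open>Bd\<close> and \<open>Lp\<close> are valid along every minimizer.\<close>

lemma Mini_momentum:
  assumes m: "Mini t y q p" and t: "t > 0" "s \<in> {0..t}"
  shows "\<bar>p s\<bar> \<le> Rad"
proof -
  have HS: "HSab 0 t q p" using m by (simp add: Mini_def)
  have "H (q s) (p s) = H (q 0) (p 0)" by (rule HSab_energy[OF HS t(2)]) (use t in auto)
  also have "\<dots> \<le> E0" by (rule E0[OF Mini_initial_momentum[OF m t(1)]])
  finally show ?thesis using Rad(3)[of "q s" "p s"] by simp
qed

lemma Mini_speed: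
  assumes m: "Mini t y q p" and t: "t > 0" "r \<in> {0..t}" "s \<in> {0..t}"
  shows "\<bar>q s - q r\<bar> \<le> Bd * \<bar>s - r\<bar>" "\<bar>p s - p r\<bar> \<le> Bd * \<bar>s - r\<bar>"
proof -
  have HS: "HSab 0 t q p" using m by (simp add: Mini_def)
  have "norm (q s - q r) \<le> Bd * norm (s - r)" "norm (p s - p r) \<le> Bd * norm (s - r)"
    by (rule field_differentiable_bound[of "{0..t}" q "\<lambda>s. Hp (q s) (p s)"] field_differentiable_bound[of "{0..t}" p "\<lambda>s. - Hx (q s) (p s)"];
      use HS Mini_momentum[OF m t(1)] Bd t in \<open>auto simp: HSab_def\<close>)+
  then show "\<bar>q s - q r\<bar> \<le> Bd * \<bar>s - r\<bar>" "\<bar>p s - p r\<bar> \<le> Bd * \<bar>s - r\<bar>" by simp_all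
qed

text \<open>The minimizer is translated rigidly: a perturbation fixing the starting point would have
  slope 1/t, whereas this constant stays bounded near t = 0. It collects K from the datum,
  \<open>2 * Rad\<close> from the boundary momenta and \<open>C * t\<close> from the quadratic
  error. Shifts have size at most 1, hence \<open>lipschitz_of_local\<close>.\<close>

lemma u_lipschitz_x:
  obtains C where "C > 0" "\<And>t x y. t \<ge> 0 \<Longrightarrow> \<bar>u t x - u t y\<bar> \<le> (K + 2 * Rad + C * t) * \<bar>x - y\<bar>"
proof -
  obtain C where C: "variation_const Rad 0 C" using variation_const_exists by blast
  note C0 = variation_const_pos[OF C]
  have "\<bar>u t x - u t y\<bar> \<le> (K + 2 * Rad + C * t) * \<bar>x - y\<bar>" if t: "t > 0" for t x y
  proof (rule lipschitz_of_local)
    have *: "u t (y + \<delta>) - u t y \<le> (K + 2 * Rad + C * t) * \<bar>\<delta>\<bar>" if \<delta>: "\<bar>\<delta>\<bar> \<le> 1" for y \<delta>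
    proof -
      obtain q p where m: "Mini t y q p" using Mini_exists[OF t] by blast
      have HS: "HSab 0 t q p" and y: "q t = y" and ut: "u t y = Uo (q 0) + integral {0..t} (\<lambda>s. ell (q s) (p s))"
        using m by (auto simp: Mini_def)
      note * = first_variation[OF C _ HS Mini_momentum[OF m t], of 1 0 \<delta>]
      have "u t (q t + \<delta> * (1 + 0 * t)) \<le> Uo (q 0 + \<delta> * (1 + 0 * 0)) +
        cost 0 t (\<lambda>s. q s + \<delta> * (1 + 0 * s)) (\<lambda>s. Hp (q s) (p s) + \<delta> * 0)"
        by (rule u_le[of t "\<lambda>s. q s + \<delta> * (1 + 0 * s)"]) (use t *(1) \<delta> in auto)
      then have "u t (y + \<delta>) \<le> Uo (q 0 + \<delta>) + (integral {0..t} (\<lambda>s. ell (q s) (p s)) + \<delta> * (p t - p 0) + C * t * \<delta>\<^sup>2)"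
        using *(2) t \<delta> y by simp
      moreover have "Uo (q 0 + \<delta>) - Uo (q 0) \<le> K * \<bar>\<delta>\<bar>" using Uo_lip[of "q 0 + \<delta>" "q 0"] by simp
      moreover have "\<delta> * (p t - p 0) \<le> \<bar>\<delta>\<bar> * (2 * Rad)"
      proof -
        have "\<bar>p t - p 0\<bar> \<le> 2 * Rad" using Mini_momentum[OF m t, of t] Mini_momentum[OF m t, of 0] t by auto
        then have "\<bar>\<delta>\<bar> * \<bar>p t - p 0\<bar> \<le> \<bar>\<delta>\<bar> * (2 * Rad)" by (intro mult_left_mono) auto
        then show ?thesis by (metis abs_ge_self abs_mult order_trans)
      qed
      moreover have "C * t * \<delta>\<^sup>2 \<le> C * t * \<bar>\<delta>\<bar>"
      proof (rule mult_left_mono)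
        have "\<bar>\<delta>\<bar> * \<bar>\<delta>\<bar> \<le> \<bar>\<delta>\<bar> * 1" using \<delta> by (intro mult_left_mono) auto
        then show "\<delta>\<^sup>2 \<le> \<bar>\<delta>\<bar>" by (simp add: power2_eq_square)
      qed (use C0 t in simp)
      ultimately show ?thesis using ut by (simp add: algebra_simps)
    qed
    fix x y :: real assume "\<bar>x - y\<bar> \<le> 1"
    then show "\<bar>u t x - u t y\<bar> \<le> (K + 2 * Rad + C * t) * \<bar>x - y\<bar>"
      using *[of "x - y" y] *[of "y - x" x] by (simp add: abs_le_iff abs_minus_commute)
  qed
  moreover have "\<bar>u 0 x - u 0 y\<bar> \<le> (K + 2 * Rad + C * 0) * \<bar>x - y\<bar>" for x y
  proof -
    have "K * \<bar>x - y\<bar> \<le> (K + 2 * Rad) * \<bar>x - y\<bar>" using Rad_nonneg by (intro mult_right_mono) auto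
    then show ?thesis using Uo_lip[of x y] by (simp add: u_0)
  qed
  ultimately show ?thesis using that[OF C0] by (metis less_eq_real_def)
qed

lemma u_lipschitz:
  obtains C where "C \<ge> 0" "\<And>s t x y. s \<in> {0..\<tau>} \<Longrightarrow> t \<in> {0..\<tau>} \<Longrightarrow> \<bar>u s x - u t y\<bar> \<le> C * (\<bar>s - t\<bar> + \<bar>x - y\<bar>)"
proof -
  obtain C where C: "C > 0" "\<And>t x y. t \<ge> 0 \<Longrightarrow> \<bar>u t x - u t y\<bar> \<le> (K + 2 * Rad + C * t) * \<bar>x - y\<bar>"
    by (rule u_lipschitz_x) (rule that; assumption)
  define L where "L = K + 2 * Rad + C * \<bar>\<tau>\<bar>"
  have L0: "L \<ge> 0" using K_nonneg Rad_nonneg C(1) by (simp add: L_def)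
  have L: "\<bar>u t x - u t y\<bar> \<le> L * \<bar>x - y\<bar>" if "t \<in> {0..\<tau>}" for t x y
  proof -
    have "(K + 2 * Rad + C * t) * \<bar>x - y\<bar> \<le> L * \<bar>x - y\<bar>"
      unfolding L_def using that C(1) by (intro mult_right_mono add_left_mono mult_left_mono) auto
    then show ?thesis using C(2)[of t x y] that by simp
  qed
  obtain r where r: "\<And>x v. \<bar>v\<bar> \<le> 0 \<Longrightarrow> \<bar>mom x v\<bar> \<le> r" using mom_bound[of 0] by metis
  obtain D where D: "D > 0" "\<And>x p. \<bar>p\<bar> \<le> r \<Longrightarrow> \<bar>H x p\<bar> \<le> D" using bounds[of r] by metis
  \<comment> \<open>Rate of change in time: resting at x gives the upper bound with rate
    \<open>D\<close>; the lower one follows a minimizer back to time s, at speed at most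
    \<open>Bd\<close> and with running cost at most \<open>Rad * Bd + Bd\<close> in modulus.\<close>
  define E where "E = L * Bd + (Rad * Bd + Bd) + D"
  have nn: "0 \<le> L * Bd" "0 \<le> Rad * Bd" using L0 Bd(1) Rad_nonneg by auto
  have time: "\<bar>u t x - u s x\<bar> \<le> E * (t - s)" if st: "0 \<le> s" "s < t" "t \<le> \<tau>" for s t x
  proof -
    have c: "C1c s t (\<lambda>_. x) (\<lambda>_. 0)" by (auto simp: C1c_def intro!: derivative_eq_intros)
    have "u t x \<le> u s x + cost s t (\<lambda>_. x) (\<lambda>_. 0)" by (rule u_dpp[OF _ _ c]) (use st in auto)
    moreover have "cost s t (\<lambda>_. x) (\<lambda>_. 0) = (t - s) * Lag H x 0" using st by (simp add: cost_def)
    moreover have "(t - s) * Lag H x 0 \<le> (t - s) * D"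
      using st D(2)[OF r[of 0 x], of x] by (intro mult_left_mono) (auto simp: Lag_mom abs_le_iff)
    moreover have "(t - s) * D \<le> (t - s) * E" unfolding E_def using nn Bd(1) st by (intro mult_left_mono) auto
    ultimately have 1: "u t x \<le> u s x + E * (t - s)" by (simp add: algebra_simps)
    have t0: "t > 0" using st by simp
    obtain q p where m: "Mini t x q p" using Mini_exists[OF t0] by blast
    have HS: "HSab s t q p" by (rule HSab_subset[of 0 t]) (use m st in \<open>auto simp: Mini_def\<close>)
    have e: "\<bar>ell (q r) (p r)\<bar> \<le> Rad * Bd + Bd" if "r \<in> {s..t}" for r
    proof -
      have p: "\<bar>p r\<bar> \<le> Rad" by (rule Mini_momentum[OF m t0]) (use that st in auto)
      have "\<bar>p r * Hp (q r) (p r)\<bar> \<le> Rad * Bd"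
        unfolding abs_mult using p Bd(4)[OF p] Rad_nonneg by (intro mult_mono) auto
      then show ?thesis using Bd(2)[OF p, of "q r"] unfolding ell_def by linarith
    qed
    have "\<bar>integral {s..t} (\<lambda>s. ell (q s) (p s))\<bar> \<le> (Rad * Bd + Bd) * (t - s)"
      using integral_bound[of s t "\<lambda>s. ell (q s) (p s)" "Rad * Bd + Bd"] st e
        continuous_on_Lag(3)[OF HSab_continuous[OF HS]] by auto
    moreover have "u t x = u s (q s) + integral {s..t} (\<lambda>s. ell (q s) (p s))"
      by (rule Mini_calibrated(1)[OF m]) (use st in auto)
    moreover have "\<bar>u s (q s) - u s x\<bar> \<le> L * \<bar>q s - x\<bar>" by (rule L) (use st in auto)
    moreover have "L * \<bar>q s - x\<bar> \<le> L * (Bd * (t - s))"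
      using Mini_speed(1)[OF m t0, of t s] m st L0 unfolding Mini_def by (intro mult_left_mono) auto
    moreover have "L * (Bd * (t - s)) + (Rad * Bd + Bd) * (t - s) \<le> E * (t - s)"
      unfolding E_def using D(1) st by (simp add: algebra_simps)
    ultimately show ?thesis using 1 by (simp add: abs_le_iff)
  qed
  have time': "\<bar>u s x - u t x\<bar> \<le> E * \<bar>s - t\<bar>" if "s \<in> {0..\<tau>}" "t \<in> {0..\<tau>}" for s t x
    using time[of s t x] time[of t s x] that by (cases s t rule: linorder_cases) (auto simp: abs_minus_commute)
  show ?thesis
  proof (rule that[of "L + E"])
    show "L + E \<ge> 0" using L0 nn Bd(1) D(1) by (simp add: E_def)
    fix s t x y assume st: "s \<in> {0..\<tau>}" "t \<in> {0..\<tau>}"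
    have E0: "E \<ge> 0" using nn Bd(1) D(1) by (simp add: E_def)
    have "0 \<le> L * \<bar>s - t\<bar>" "0 \<le> E * \<bar>x - y\<bar>" using L0 E0 by auto
    moreover have "\<bar>u s x - u t y\<bar> \<le> E * \<bar>s - t\<bar> + L * \<bar>x - y\<bar>"
      using time'[OF st, of x] L[OF st(2), of x y] by linarith
    ultimately show "\<bar>u s x - u t y\<bar> \<le> (L + E) * (\<bar>s - t\<bar> + \<bar>x - y\<bar>)" by (simp add: algebra_simps)
  qed
qed

end

section \<open>Minimizers do not cross\<close>

lemma derivative_of_quadratic_bound:
  fixes f :: "real \<Rightarrow> real"
  assumes "e > 0" "\<And>\<delta>. \<bar>\<delta>\<bar> \<le> e \<Longrightarrow> \<bar>f (x + \<delta>) - f x - \<delta> * c\<bar> \<le> C * \<delta>\<^sup>2"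
  shows "(f has_real_derivative c) (at x)"
proof -
  have "((\<lambda>h. (f (x + h) - f x) / h - c) \<longlongrightarrow> 0) (at 0)"
  proof (rule Lim_null_comparison)
    show "\<forall>\<^sub>F h in at 0. norm ((f (x + h) - f x) / h - c) \<le> C * \<bar>h\<bar>"
      unfolding eventually_at
    proof (intro exI[of _ e] conjI ballI impI assms(1))
      fix h :: real assume h: "h \<noteq> 0 \<and> dist h 0 < e"
      then have "\<bar>f (x + h) - f x - h * c\<bar> / \<bar>h\<bar> \<le> C * h\<^sup>2 / \<bar>h\<bar>"
        by (intro divide_right_mono assms(2)) auto
      moreover have "\<bar>f (x + h) - f x - h * c\<bar> / \<bar>h\<bar> = \<bar>(f (x + h) - f x) / h - c\<bar>"
        using h by (simp add: field_simps flip: abs_divide)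
      moreover have "C * h\<^sup>2 / \<bar>h\<bar> = C * \<bar>h\<bar>"
        using h by (cases "h > 0") (auto simp: power2_eq_square)
      ultimately show "norm ((f (x + h) - f x) / h - c) \<le> C * \<bar>h\<bar>" by simp
    qed
    have "((\<lambda>h. C * \<bar>h\<bar>) \<longlongrightarrow> C * \<bar>0\<bar>) (at 0)" by (intro tendsto_intros)
    then show "((\<lambda>h. C * \<bar>h\<bar>) \<longlongrightarrow> 0) (at 0)" by simp
  qed
  then show ?thesis unfolding DERIV_def by (simp add: LIM_zero_iff)
qed

context ham begin

text \<open>Gronwall for the squared phase space distance:
  \<open>\<bar>E'\<bar> \<le> 4 * L * E\<close>, so \<open>E\<close> weighted with
  \<open>exp (- 4 * L * s)\<close> decreases and with \<open>exp (4 * L * s)\<close> increases,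
  which settles the times after and before c.\<close>

lemma HSab_unique:
  assumes h1: "HSab a b q1 p1" and h2: "HSab a b q2 p2" and c: "c \<in> {a..b}"
    and eq: "q1 c = q2 c" "p1 c = p2 c" and t: "t \<in> {a..b}"
  shows "q1 t = q2 t" "p1 t = p2 t"
proof -
  note cont = HSab_continuous[OF h1] HSab_continuous[OF h2]
  have "compact (p1 ` {a..b} \<union> p2 ` {a..b})" by (intro compact_Un compact_continuous_image cont) auto
  then have "bounded (p1 ` {a..b} \<union> p2 ` {a..b})" by (rule compact_imp_bounded)
  then obtain B where "\<forall>x\<in>p1 ` {a..b} \<union> p2 ` {a..b}. norm x \<le> B" unfolding bounded_iff by blast
  then have B: "\<bar>p1 s\<bar> \<le> B" "\<bar>p2 s\<bar> \<le> B" if "s \<in> {a..b}" for s using that by auto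
  obtain L where L: "L > 0"
    "\<And>x p y r. \<bar>p\<bar> \<le> B \<Longrightarrow> \<bar>r\<bar> \<le> B \<Longrightarrow> \<bar>Hx x p - Hx y r\<bar> \<le> L * (\<bar>x - y\<bar> + \<bar>p - r\<bar>)"
    "\<And>x p y r. \<bar>p\<bar> \<le> B \<Longrightarrow> \<bar>r\<bar> \<le> B \<Longrightarrow> \<bar>Hp x p - Hp y r\<bar> \<le> L * (\<bar>x - y\<bar> + \<bar>p - r\<bar>)"
    using lipschitz[of B] by metis
  define E where "E s = (q1 s - q2 s)\<^sup>2 + (p1 s - p2 s)\<^sup>2" for s
  define E' where "E' s = 2 * (q1 s - q2 s) * (Hp (q1 s) (p1 s) - Hp (q2 s) (p2 s))
      - 2 * (p1 s - p2 s) * (Hx (q1 s) (p1 s) - Hx (q2 s) (p2 s))" for s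
  have dE: "(E has_real_derivative E' s) (at s)" if "a < s" "s < b" for s
  proof -
    have at: "at s within {a..b} = at s" by (rule at_within_interior) (use that in auto)
    have "(q1 has_real_derivative Hp (q1 s) (p1 s)) (at s)" "(p1 has_real_derivative - Hx (q1 s) (p1 s)) (at s)"
      "(q2 has_real_derivative Hp (q2 s) (p2 s)) (at s)" "(p2 has_real_derivative - Hx (q2 s) (p2 s)) (at s)"
      using h1 h2 that unfolding HSab_def at[symmetric] by auto
    then show ?thesis unfolding E_def[abs_def] E'_def
      by (auto intro!: derivative_eq_intros simp: algebra_simps)
  qed
  have bE: "\<bar>E' s\<bar> \<le> 4 * L * E s" if s: "s \<in> {a..b}" for s
  proof -
    define d where "d = \<bar>q1 s - q2 s\<bar> + \<bar>p1 s - p2 s\<bar>"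
    have "\<bar>(q1 s - q2 s) * (Hp (q1 s) (p1 s) - Hp (q2 s) (p2 s))\<bar> \<le> \<bar>q1 s - q2 s\<bar> * (L * d)"
      unfolding abs_mult d_def using B[OF s] by (intro mult_left_mono L) auto
    moreover have "\<bar>(p1 s - p2 s) * (Hx (q1 s) (p1 s) - Hx (q2 s) (p2 s))\<bar> \<le> \<bar>p1 s - p2 s\<bar> * (L * d)"
      unfolding abs_mult d_def using B[OF s] by (intro mult_left_mono L) auto
    moreover have "\<bar>q1 s - q2 s\<bar> * (L * d) + \<bar>p1 s - p2 s\<bar> * (L * d) = L * d\<^sup>2"
      by (simp add: d_def power2_eq_square algebra_simps)
    moreover have "L * d\<^sup>2 \<le> L * (2 * E s)"
    proof (rule mult_left_mono)
      have "(\<bar>q1 s - q2 s\<bar> - \<bar>p1 s - p2 s\<bar>)\<^sup>2 \<ge> 0" by simp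
      then show "d\<^sup>2 \<le> 2 * E s" unfolding d_def E_def by (simp add: power2_sum power2_diff)
    qed (use L(1) in simp)
    moreover have "L * (2 * E s) = 2 * (L * E s)" by simp
    ultimately show ?thesis unfolding E'_def mult.assoc by linarith
  qed
  have cE: "continuous_on {a..b} E" unfolding E_def by (intro continuous_intros cont)
  have Ec: "E c = 0" using eq by (simp add: E_def)
  have E0: "E s \<ge> 0" for s unfolding E_def by simp
  have "E t = 0"
  proof (cases "c \<le> t")
    case True
    have "E c * exp (- (4 * L) * c) \<ge> E t * exp (- (4 * L) * t)"
    proof (rule DERIV_nonpos_imp_decreasing_open[OF True])
      fix s assume s: "c < s" "s < t"
      have "((\<lambda>s. E s * exp (- (4 * L) * s)) has_real_derivative (E' s - 4 * L * E s) * exp (- (4 * L) * s)) (at s)"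
        using c t s by (auto intro!: derivative_eq_intros dE simp: algebra_simps)
      moreover have "(E' s - 4 * L * E s) * exp (- (4 * L) * s) \<le> 0"
        using bE[of s] c t s by (intro mult_nonpos_nonneg) (auto simp: abs_le_iff)
      ultimately show "\<exists>y. ((\<lambda>s. E s * exp (- (4 * L) * s)) has_real_derivative y) (at s) \<and> y \<le> 0" by blast
    qed (intro continuous_intros continuous_on_subset[OF cE], use c t in auto)
    then have "E t * exp (- (4 * L) * t) \<le> 0" using Ec by simp
    then show ?thesis using E0[of t] by (simp add: mult_le_0_iff)
  next
    case False
    then have "t \<le> c" by simp
    then have "E t * exp (4 * L * t) \<le> E c * exp (4 * L * c)"
    proof (rule DERIV_nonneg_imp_increasing_open)
      fix s assume s: "t < s" "s < c"
      have "((\<lambda>s. E s * exp (4 * L * s)) has_real_derivative (E' s + 4 * L * E s) * exp (4 * L * s)) (at s)"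
        using c t s by (auto intro!: derivative_eq_intros dE simp: algebra_simps)
      moreover have "(E' s + 4 * L * E s) * exp (4 * L * s) \<ge> 0"
        using bE[of s] c t s by (intro mult_nonneg_nonneg) (auto simp: abs_le_iff)
      ultimately show "\<exists>y. ((\<lambda>s. E s * exp (4 * L * s)) has_real_derivative y) (at s) \<and> y \<ge> 0" by blast
    qed (intro continuous_intros continuous_on_subset[OF cE], use c t in auto)
    then have "E t * exp (4 * L * t) \<le> 0" using Ec by simp
    then show ?thesis using E0[of t] by (simp add: mult_le_0_iff)
  qed
  then show "q1 t = q2 t" "p1 t = p2 t" unfolding E_def by (simp_all add: sum_power2_eq_zero_iff)
qed

end

section \<open>Differentiability along minimizers, ordering and compactness\<close>

context cauchy begin

text \<open>Perturbing by \<open>\<delta> * s / t\<close> moves only the end point. The constant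
  depends on t but not on the minimizer, as is needed when end points vary.\<close>

lemma u_superdifferentiable:
  assumes t: "t > 0"
  obtains C where "C > 0" "\<And>y q p \<delta>. Mini t y q p \<Longrightarrow> \<bar>\<delta>\<bar> \<le> 1 \<Longrightarrow> u t (y + \<delta>) \<le> u t y + \<delta> * p t + C * \<delta>\<^sup>2"
proof -
  obtain C where C: "variation_const Rad (1 / t) C" using variation_const_exists t by (metis less_imp_le zero_le_divide_1_iff)
  show ?thesis
  proof (rule that[of "C * t"])
    show "C * t > 0" using variation_const_pos[OF C] t by simp
    fix y q p and \<delta> :: real assume m: "Mini t y q p" and \<delta>: "\<bar>\<delta>\<bar> \<le> 1"
    have HS: "HSab 0 t q p" and y: "q t = y" and ut: "u t y = Uo (q 0) + integral {0..t} (\<lambda>s. ell (q s) (p s))"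
      using m by (auto simp: Mini_def)
    have pre: "0 \<le> t" "\<And>s. s \<in> {0..t} \<Longrightarrow> \<bar>0 + (1 / t) * s\<bar> \<le> 1" "\<bar>1 / t\<bar> \<le> 1 / t"
      using t by (auto simp: field_simps abs_le_iff)
    note * = first_variation[OF C pre(1) HS Mini_momentum[OF m t] pre(2,3) \<delta>]
    have "u t (q t + \<delta> * (0 + (1 / t) * t)) \<le> Uo (q 0 + \<delta> * (0 + (1 / t) * 0)) +
      cost 0 t (\<lambda>s. q s + \<delta> * (0 + (1 / t) * s)) (\<lambda>s. Hp (q s) (p s) + \<delta> * (1 / t))"
      by (rule u_le[of t "\<lambda>s. q s + \<delta> * (0 + (1 / t) * s)"]) (use t *(1) in auto)
    then show "u t (y + \<delta>) \<le> u t y + \<delta> * p t + C * t * \<delta>\<^sup>2"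
      using *(2) t y ut by simp
  qed
qed

text \<open>Touching from both sides. The upper bound perturbs the part before s; the lower one
  perturbs the part after s by \<open>\<delta> * (t - r) / (t - s)\<close>, which starts at
  \<open>q s + \<delta>\<close> and still ends at y. The latter requires s < t.\<close>

lemma u_differentiable:
  assumes m: "Mini t y q p" and s: "0 < s" "s < t"
  shows "(u s has_real_derivative p s) (at (q s))"
proof -
  obtain C1 where C1: "C1 > 0" "\<And>y q p \<delta>. Mini s y q p \<Longrightarrow> \<bar>\<delta>\<bar> \<le> 1 \<Longrightarrow> u s (y + \<delta>) \<le> u s y + \<delta> * p s + C1 * \<delta>\<^sup>2"
    using u_superdifferentiable[OF s(1)] by metis
  define k where "k = 1 / (t - s)"
  have k: "k > 0" using s by (simp add: k_def)
  obtain C2 where C2: "variation_const Rad k C2" using variation_const_exists k by (metis less_imp_le)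
  have HS: "HSab s t q p" and y: "q t = y" using m s HSab_subset[of 0 t q p s t] by (auto simp: Mini_def)
  show ?thesis
  proof (rule derivative_of_quadratic_bound[of 1])
    fix \<delta> :: real assume \<delta>: "\<bar>\<delta>\<bar> \<le> 1"
    have ks: "k * t - k * s = 1" unfolding right_diff_distrib[symmetric] k_def using s by simp
    have up: "u s (q s + \<delta>) \<le> u s (q s) + \<delta> * p s + C1 * \<delta>\<^sup>2"
      by (rule C1(2)[OF Mini_calibrated(2)[OF m] \<delta>]) (use s in auto)
    have b: "\<bar>k * t + (- k) * r\<bar> \<le> 1" if r: "r \<in> {s..t}" for r
    proof -
      have "k * r \<le> k * t" "k * s \<le> k * r" using r k by auto
      then show ?thesis using ks by (simp add: abs_le_iff)
    qed
    have st: "s \<le> t" and kk: "\<bar>- k\<bar> \<le> k" using s k by auto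
    have pR: "\<bar>p r\<bar> \<le> Rad" if "r \<in> {s..t}" for r by (rule Mini_momentum[OF m]) (use s that in auto)
    note * = first_variation[OF C2 st HS pR b kk \<delta>]
    have "u t (q t + \<delta> * (k * t + (- k) * t)) \<le> u s (q s + \<delta> * (k * t + (- k) * s)) +
      cost s t (\<lambda>r. q r + \<delta> * (k * t + (- k) * r)) (\<lambda>r. Hp (q r) (p r) + \<delta> * (- k))"
      by (rule u_dpp[of s t "\<lambda>r. q r + \<delta> * (k * t + (- k) * r)"]) (use s *(1) in auto)
    then have "u t y \<le> u s (q s + \<delta>) + integral {s..t} (\<lambda>s. ell (q s) (p s)) - \<delta> * p s + C2 * (t - s) * \<delta>\<^sup>2"
      using *(2) y ks by simp
    moreover have "u t y = u s (q s) + integral {s..t} (\<lambda>s. ell (q s) (p s))"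
      by (rule Mini_calibrated(1)[OF m]) (use s in auto)
    ultimately have lo: "u s (q s + \<delta>) \<ge> u s (q s) + \<delta> * p s - C2 * (t - s) * \<delta>\<^sup>2" by linarith
    have "0 \<le> C2 * (t - s) * \<delta>\<^sup>2" "0 \<le> C1 * \<delta>\<^sup>2" using C1(1) variation_const_pos[OF C2] s by auto
    with up lo show "\<bar>u s (q s + \<delta>) - u s (q s) - \<delta> * p s\<bar> \<le> (C1 + C2 * (t - s)) * \<delta>\<^sup>2"
      unfolding distrib_right by linarith
  qed simp
qed

lemma Mini_crossing:
  assumes m: "Mini t y1 q1 p1" "Mini t y2 q2 p2" and s: "0 < s" "s < t" "q1 s = q2 s" and r: "r \<in> {0..t}"
  shows "q1 r = q2 r" "p1 r = p2 r"
proof -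
  have p: "p1 s = p2 s"
    using u_differentiable[OF m(1) s(1,2)] u_differentiable[OF m(2) s(1,2)] s(3) DERIV_unique by metis
  have h: "HSab 0 t q1 p1" "HSab 0 t q2 p2" using m by (auto simp: Mini_def)
  have "s \<in> {0..t}" using s by simp
  from HSab_unique[OF h this s(3) p r] show "q1 r = q2 r" "p1 r = p2 r" .
qed

text \<open>If the order failed, the intermediate value theorem would give a meeting time before t,
  and the two curves would then have the same end point. Meeting at time 0 is not excluded by
  \<open>Mini_crossing\<close>, hence the weak inequality there.\<close>

lemma Mini_ordered:
  assumes m: "Mini t y1 q1 p1" "Mini t y2 q2 p2" and y: "y1 < y2" and t: "t > 0" and s: "s \<in> {0..t}"
  shows "0 < s \<Longrightarrow> q1 s < q2 s" "q1 s \<le> q2 s"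
proof -
  have c: "continuous_on {0..t} (\<lambda>r. q2 r - q1 r)"
    using HSab_continuous m unfolding Mini_def by (intro continuous_intros) blast+
  have T: "q2 t - q1 t > 0" using m y by (simp add: Mini_def)
  have False if a: "q2 a - q1 a \<le> 0" "a \<in> {0..t}" "a > 0 \<or> q2 a - q1 a < 0" for a
  proof -
    have "\<exists>r. a \<le> r \<and> r \<le> t \<and> q2 r - q1 r = 0"
      by (rule IVT') (use a T continuous_on_subset[OF c] in auto)
    then obtain r where r: "a \<le> r" "r \<le> t" "q2 r - q1 r = 0" by blast
    have "r \<noteq> t" using r T by auto
    moreover have "r > 0" using r a by (cases "a = r") auto
    ultimately have "q1 t = q2 t" using Mini_crossing(1)[OF m, of r t] r t by auto
    then show False using T by simp
  qed
  note F = this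
  show "q1 s < q2 s" if "0 < s" using F[of s] s that by force
  show "q1 s \<le> q2 s" using F[of s] s by force
qed

lemma u_continuous: "t \<ge> 0 \<Longrightarrow> isCont (u t) x"
proof -
  assume t: "t \<ge> 0"
  obtain C where C: "C \<ge> 0" "\<And>s r x y. s \<in> {0..t} \<Longrightarrow> r \<in> {0..t} \<Longrightarrow> \<bar>u s x - u r y\<bar> \<le> C * (\<bar>s - r\<bar> + \<bar>x - y\<bar>)"
    by (rule u_lipschitz[of t]) (rule that; assumption)
  have "\<bar>u t x - u t y\<bar> \<le> C * \<bar>x - y\<bar>" for x y using C(2)[of t t x y] t by simp
  then have "C-lipschitz_on UNIV (u t)" using C(1) by (simp add: lipschitz_on_def dist_real_def)
  then show ?thesis using lipschitz_on_continuous_on continuous_on_eq_continuous_at by blast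
qed

text \<open>Genuine minimizers are sampled on finer and finer grids so that
  \<open>limit_extremal\<close> applies again; the bounds along minimizers are uniform in n.\<close>

lemma Mini_compact:
  assumes t: "t > 0" and y: "Y \<longlonglongrightarrow> y" and m: "\<And>n. Mini t (Y n) (q n) (p n)"
  obtains r qq pp where "strict_mono (r :: nat \<Rightarrow> nat)" "Mini t y qq pp"
    "\<And>s. s \<in> {0..t} \<Longrightarrow> (\<lambda>n. q (r n) s) \<longlonglongrightarrow> qq s" "\<And>s. s \<in> {0..t} \<Longrightarrow> (\<lambda>n. p (r n) s) \<longlonglongrightarrow> pp s"
proof -
  define N where "N n = Suc n" for n :: nat
  have N: "N n > 0" "filterlim N at_top sequentially" for n
    unfolding N_def by (simp, rule filterlim_Suc)
  define \<tau> where "\<tau> n i = real i * (t / N n)" for n i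
  have \<tau>: "\<tau> n i \<in> {0..t}" if "i \<le> N n" for n i
  proof -
    have "real i * (t / N n) \<le> real (N n) * (t / N n)" using that t by (intro mult_right_mono) auto
    then show ?thesis using N(1)[of n] t by (simp add: \<tau>_def)
  qed
  \<comment> \<open>Accumulated cost: from \<open>Uo (q n 0)\<close> at time 0 to
    \<open>u t (Y n)\<close> at time t. Its limit together with continuity of \<open>u t\<close>
    shows that the limiting extremal is minimizing.\<close>
  define c where "c n s = Uo (q n 0) + integral {0..s} (\<lambda>s. ell (q n s) (p n s))" for n s
  have HS: "HSab 0 t (q n) (p n)" for n using m by (simp add: Mini_def)
  have pR: "\<bar>p n s\<bar> \<le> Rad" if "s \<in> {0..t}" for n s by (rule Mini_momentum[OF m t that])
  note sp = Mini_speed[OF m t]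
  have dc: "(c n has_real_derivative ell (q n s) (p n s)) (at s within {0..t})" if "s \<in> {0..t}" for n s
    unfolding c_def
    by (rule derivative_eq_intros refl integral_has_real_derivative[OF continuous_on_Lag(3)[OF HSab_continuous[OF HS]] that])+ simp
  have eb: "\<bar>ell (q n s) (p n s)\<bar> \<le> Rad * Bd + Bd" if s: "s \<in> {0..t}" for n s
  proof -
    have "\<bar>p n s * Hp (q n s) (p n s)\<bar> \<le> Rad * Bd"
      unfolding abs_mult using pR[OF s, of n] Bd(4)[OF pR[OF s]] Rad_nonneg by (intro mult_mono) auto
    then show ?thesis using Bd(2)[OF pR[OF s, of n], of "q n s"] unfolding ell_def by linarith
  qed
  obtain B0 where B0: "\<And>n. \<bar>Y n\<bar> \<le> B0" using y convergent_imp_Bseq[of Y] unfolding convergent_def Bseq_def by auto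
  have qb: "\<bar>q n s\<bar> \<le> B0 + Bd * t" if s: "s \<in> {0..t}" for n s
  proof -
    have "\<bar>q n s - Y n\<bar> \<le> Bd * \<bar>s - t\<bar>" using sp(1)[where r=t and s=s] m s t by (auto simp: Mini_def)
    moreover have "Bd * \<bar>s - t\<bar> \<le> Bd * t" using Bd(1) s by (intro mult_left_mono) auto
    ultimately show ?thesis using B0[of n] by linarith
  qed
  have cb: "\<bar>c n s\<bar> \<le> \<bar>Uo 0\<bar> + K * (B0 + Bd * t) + (Rad * Bd + Bd) * t" if s: "s \<in> {0..t}" for n s
  proof -
    have "\<bar>Uo (q n 0) - Uo 0\<bar> \<le> K * \<bar>q n 0 - 0\<bar>" by (rule Uo_lip)
    moreover have "K * \<bar>q n 0 - 0\<bar> \<le> K * (B0 + Bd * t)" using qb[of 0 n] t K_nonneg by (intro mult_left_mono) auto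
    moreover have "norm (c n s - c n 0) \<le> (Rad * Bd + Bd) * norm (s - 0)"
      by (rule field_differentiable_bound[of "{0..t}" "c n" "\<lambda>s. ell (q n s) (p n s)"]) (use dc eb s t in auto)
    moreover have "(Rad * Bd + Bd) * norm (s - 0) \<le> (Rad * Bd + Bd) * t" using s Rad_nonneg Bd(1) by (intro mult_left_mono) auto
    moreover have "c n 0 = Uo (q n 0)" by (simp add: c_def)
    ultimately show ?thesis unfolding real_norm_def by linarith
  qed
  define B where "B = Rad + (B0 + Bd * t) + (\<bar>Uo 0\<bar> + K * (B0 + Bd * t) + (Rad * Bd + Bd) * t)"
  have nnB: "0 \<le> Rad" "0 \<le> B0 + Bd * t" "0 \<le> \<bar>Uo 0\<bar> + K * (B0 + Bd * t) + (Rad * Bd + Bd) * t"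
    using Rad_nonneg order_trans[OF abs_ge_zero qb[of t 0]] order_trans[OF abs_ge_zero cb[of t 0]] t by auto
  have bB: "\<bar>q n (\<tau> n i)\<bar> \<le> B" "\<bar>p n (\<tau> n i)\<bar> \<le> B" "\<bar>c n (\<tau> n i)\<bar> \<le> B" if "i \<le> N n" for n i
    using qb[OF \<tau>[OF that], of n] pR[OF \<tau>[OF that], of n] cb[OF \<tau>[OF that], of n] nnB unfolding B_def by linarith+
  define C where "C = ((Rad + 1) * Lp + Bd) * (2 * Bd)"
  have C: "C \<ge> 0" using Rad_nonneg Lp(1) Bd(1) by (simp add: C_def)
  have LL: "Lp * x \<le> ((Rad + 1) * Lp + Bd) * x" if "x \<ge> 0" for x
    using that Rad_nonneg Lp(1) Bd(1) by (intro mult_right_mono) (auto simp: algebra_simps)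
  have incr: "\<bar>f s' - f s - (s' - s) * f' s\<bar> \<le> C * (s' - s)\<^sup>2"
    if f: "\<And>s. s \<in> {0..t} \<Longrightarrow> (f has_real_derivative f' s) (at s within {0..t})"
      and L: "\<And>r s. r \<in> {0..t} \<Longrightarrow> s \<in> {0..t} \<Longrightarrow> \<bar>f' r - f' s\<bar> \<le> ((Rad + 1) * Lp + Bd) * (\<bar>q n r - q n s\<bar> + \<bar>p n r - p n s\<bar>)"
      and ss: "s \<in> {0..t}" "s' \<in> {0..t}" "s \<le> s'" for f f' n s s'
  proof -
    have "norm ((f s' - f' s * s') - (f s - f' s * s)) \<le> (C * (s' - s)) * norm (s' - s)"
    proof (rule field_differentiable_bound[of "{s..s'}" "\<lambda>r. f r - f' s * r" "\<lambda>r. f' r - f' s"])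
      fix r assume r: "r \<in> {s..s'}"
      have rt: "r \<in> {0..t}" using r ss by auto
      have "(f has_real_derivative f' r) (at r within {s..s'})"
        by (rule has_field_derivative_subset[OF f[OF rt]]) (use ss in auto)
      then show "((\<lambda>r. f r - f' s * r) has_field_derivative f' r - f' s) (at r within {s..s'})"
        by (auto intro!: derivative_eq_intros)
      have "\<bar>q n r - q n s\<bar> + \<bar>p n r - p n s\<bar> \<le> 2 * Bd * (r - s)"
        using sp(1)[where r=s and s=r and n1=n] sp(2)[where r=s and s=r and n1=n] rt ss r by auto
      also have "\<dots> \<le> 2 * Bd * (s' - s)" using r Bd(1) by (intro mult_left_mono) auto
      finally have "((Rad + 1) * Lp + Bd) * (\<bar>q n r - q n s\<bar> + \<bar>p n r - p n s\<bar>) \<le> ((Rad + 1) * Lp + Bd) * (2 * Bd * (s' - s))"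
        using Rad_nonneg Lp(1) Bd(1) by (intro mult_left_mono) auto
      then show "norm (f' r - f' s) \<le> C * (s' - s)" using L[OF rt ss(1)] unfolding C_def by (simp add: mult.assoc)
    qed (use ss in auto)
    then show ?thesis using ss(3) by (simp add: algebra_simps power2_eq_square)
  qed
  have di: "\<tau> n j - \<tau> n i = d" "\<tau> n i \<le> \<tau> n j" "\<tau> n i \<in> {0..t}" "\<tau> n j \<in> {0..t}"
    if "i \<le> j" "j \<le> N n" "d = (real j - real i) * (t / N n)" for n i j d
  proof -
    show "\<tau> n i \<in> {0..t}" "\<tau> n j \<in> {0..t}" using that \<tau> by auto
    show "\<tau> n j - \<tau> n i = d" unfolding that(3) \<tau>_def left_diff_distrib ..
    have "real i * (t / N n) \<le> real j * (t / N n)" using that(1) t by (intro mult_right_mono) auto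
    then show "\<tau> n i \<le> \<tau> n j" unfolding \<tau>_def .
  qed
  have ix: "\<bar>q n (\<tau> n j) - q n (\<tau> n i) - d * Hp (q n (\<tau> n i)) (p n (\<tau> n i))\<bar> \<le> C * d\<^sup>2"
    and ip: "\<bar>p n (\<tau> n j) - p n (\<tau> n i) - d * (- Hx (q n (\<tau> n i)) (p n (\<tau> n i)))\<bar> \<le> C * d\<^sup>2"
    and ic: "\<bar>c n (\<tau> n j) - c n (\<tau> n i) - d * ell (q n (\<tau> n i)) (p n (\<tau> n i))\<bar> \<le> C * d\<^sup>2"
    if ij: "i \<le> j" "j \<le> N n" "d = (real j - real i) * (t / N n)" for n i j d
  proof -
    note D = di[OF ij]
    show "\<bar>q n (\<tau> n j) - q n (\<tau> n i) - d * Hp (q n (\<tau> n i)) (p n (\<tau> n i))\<bar> \<le> C * d\<^sup>2"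
      unfolding D(1)[symmetric]
    proof (rule incr[where f'="\<lambda>s. Hp (q n s) (p n s)", OF _ _ D(3,4,2)])
      fix r s assume "r \<in> {0..t}" "s \<in> {0..t}"
      from Lp(3)[OF pR[OF this(1), of n] pR[OF this(2), of n], of "q n r" "q n s"] LL
      show "\<bar>Hp (q n r) (p n r) - Hp (q n s) (p n s)\<bar> \<le> ((Rad + 1) * Lp + Bd) * (\<bar>q n r - q n s\<bar> + \<bar>p n r - p n s\<bar>)"
        by (rule order_trans) simp
    qed (use HS in \<open>simp add: HSab_def\<close>)
    show "\<bar>p n (\<tau> n j) - p n (\<tau> n i) - d * (- Hx (q n (\<tau> n i)) (p n (\<tau> n i)))\<bar> \<le> C * d\<^sup>2"
      unfolding D(1)[symmetric]
    proof (rule incr[where f'="\<lambda>s. - Hx (q n s) (p n s)", OF _ _ D(3,4,2)])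
      fix r s assume "r \<in> {0..t}" "s \<in> {0..t}"
      from order_trans[OF Lp(2)[OF pR[OF this(1), of n] pR[OF this(2), of n], of "q n r" "q n s"] LL]
      show "\<bar>- Hx (q n r) (p n r) - - Hx (q n s) (p n s)\<bar> \<le> ((Rad + 1) * Lp + Bd) * (\<bar>q n r - q n s\<bar> + \<bar>p n r - p n s\<bar>)"
        by (simp add: abs_minus_commute)
    qed (use HS in \<open>simp add: HSab_def\<close>)
    show "\<bar>c n (\<tau> n j) - c n (\<tau> n i) - d * ell (q n (\<tau> n i)) (p n (\<tau> n i))\<bar> \<le> C * d\<^sup>2"
      unfolding D(1)[symmetric]
      by (rule incr[where f'="\<lambda>s. ell (q n s) (p n s)", OF dc ell_lipschitz[OF pR pR] D(3,4,2)])
  qed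
  obtain r qq pp w where r: "strict_mono (r :: nat \<Rightarrow> nat)" and HSq: "HS_sol H t qq pp"
    and dw: "\<And>s. s \<in> {0..t} \<Longrightarrow> (w has_real_derivative ell (qq s) (pp s)) (at s within {0..t})"
    and lx: "\<And>s::real. s \<in> {0..t} \<Longrightarrow> (\<lambda>n. q (r n) (\<tau> (r n) (nat \<lfloor>s * N (r n) / t\<rfloor>))) \<longlonglongrightarrow> qq s"
    and lp: "\<And>s::real. s \<in> {0..t} \<Longrightarrow> (\<lambda>n. p (r n) (\<tau> (r n) (nat \<lfloor>s * N (r n) / t\<rfloor>))) \<longlonglongrightarrow> pp s"
    and lc: "\<And>s::real. s \<in> {0..t} \<Longrightarrow> (\<lambda>n. c (r n) (\<tau> (r n) (nat \<lfloor>s * N (r n) / t\<rfloor>))) \<longlonglongrightarrow> w s"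
    by (rule limit_extremal[where x="\<lambda>n i. q n (\<tau> n i)" and p="\<lambda>n i. p n (\<tau> n i)" and c="\<lambda>n i. c n (\<tau> n i)" and N=N,
          OF t N bB C ix ip ic]; (assumption | (rule that; assumption)))
  have Nr: "(\<lambda>n. t / N (r n)) \<longlonglongrightarrow> 0"
  proof -
    have "filterlim (\<lambda>n. N (r n)) at_top sequentially"
      using N(2) filterlim_subseq[OF r] by (rule filterlim_compose)
    from filterlim_compose[OF filterlim_real_sequentially this] show ?thesis
      by (intro tendsto_divide_0[OF tendsto_const] filterlim_at_top_imp_at_infinity)
  qed
  have near: "\<tau> n (nat \<lfloor>s * N n / t\<rfloor>) \<in> {0..t}" "\<bar>\<tau> n (nat \<lfloor>s * N n / t\<rfloor>) - s\<bar> \<le> t / N n" if s: "s \<in> {0..t}" for s n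
  proof -
    have z: "0 \<le> s * N n / t" "s * N n / t \<le> N n" using s t mult_right_mono[of s t "real (N n)"] by (auto simp: field_simps)
    have i: "real (nat \<lfloor>s * N n / t\<rfloor>) \<le> s * N n / t" "s * N n / t \<le> real (nat \<lfloor>s * N n / t\<rfloor>) + 1"
      using z by linarith+
    then have "nat \<lfloor>s * N n / t\<rfloor> \<le> N n" using z by linarith
    then show "\<tau> n (nat \<lfloor>s * N n / t\<rfloor>) \<in> {0..t}" by (rule \<tau>)
    have tN: "t / N n > 0" using t N(1)[of n] by simp
    have e: "s * N n / t * (t / N n) = s" using t N(1)[of n] by simp
    have "real (nat \<lfloor>s * N n / t\<rfloor>) * (t / N n) \<le> s" "s \<le> (real (nat \<lfloor>s * N n / t\<rfloor>) + 1) * (t / N n)"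
      using mult_right_mono[OF i(1) less_imp_le[OF tN]] mult_right_mono[OF i(2) less_imp_le[OF tN]] unfolding e .
    then have "\<tau> n (nat \<lfloor>s * N n / t\<rfloor>) \<le> s" "s \<le> \<tau> n (nat \<lfloor>s * N n / t\<rfloor>) + t / N n"
      unfolding \<tau>_def distrib_right mult_1 .
    then show "\<bar>\<tau> n (nat \<lfloor>s * N n / t\<rfloor>) - s\<bar> \<le> t / N n" by linarith
  qed
  \<comment> \<open>The limit was taken at the nodes just below s; the common speed bound
    \<open>Bd\<close> transfers it to s itself.\<close>
  have pointwise: "(\<lambda>n. f (r n) s) \<longlonglongrightarrow> l"
    if f: "\<And>n a b. a \<in> {0..t} \<Longrightarrow> b \<in> {0..t} \<Longrightarrow> \<bar>f n b - f n a\<bar> \<le> Bd * \<bar>b - a\<bar>" and s: "s \<in> {0..t}"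
      and l: "(\<lambda>n. f (r n) (\<tau> (r n) (nat \<lfloor>s * N (r n) / t\<rfloor>))) \<longlonglongrightarrow> l" for f :: "nat \<Rightarrow> real \<Rightarrow> real" and s l
  proof -
    have "(\<lambda>n. f (r n) s - f (r n) (\<tau> (r n) (nat \<lfloor>s * N (r n) / t\<rfloor>))) \<longlonglongrightarrow> 0"
    proof (rule Lim_null_comparison[OF always_eventually])
      show "\<forall>n. norm (f (r n) s - f (r n) (\<tau> (r n) (nat \<lfloor>s * N (r n) / t\<rfloor>))) \<le> Bd * (t / N (r n))"
      proof
        fix n
        have "\<bar>f (r n) s - f (r n) (\<tau> (r n) (nat \<lfloor>s * N (r n) / t\<rfloor>))\<bar> \<le> Bd * \<bar>s - \<tau> (r n) (nat \<lfloor>s * N (r n) / t\<rfloor>)\<bar>"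
          by (rule f[OF near(1)[OF s] s])
        also have "\<dots> \<le> Bd * (t / N (r n))" using near(2)[OF s, of "r n"] Bd(1)
          by (intro mult_left_mono) (auto simp: abs_minus_commute)
        finally show "norm (f (r n) s - f (r n) (\<tau> (r n) (nat \<lfloor>s * N (r n) / t\<rfloor>))) \<le> Bd * (t / N (r n))" by simp
      qed
      show "(\<lambda>n. Bd * (t / N (r n))) \<longlonglongrightarrow> 0" using tendsto_mult_left[OF Nr, of Bd] by simp
    qed
    from tendsto_add[OF this l] show ?thesis by simp
  qed
  have lq: "(\<lambda>n. q (r n) s) \<longlonglongrightarrow> qq s" and lpp: "(\<lambda>n. p (r n) s) \<longlonglongrightarrow> pp s" if "s \<in> {0..t}" for s
    using pointwise[of q s, OF sp(1) that lx[OF that]] pointwise[of p s, OF sp(2) that lp[OF that]] by blast+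
  have e0: "\<tau> n (nat \<lfloor>(0::real) * N n / t\<rfloor>) = 0" "\<tau> n (nat \<lfloor>t * N n / t\<rfloor>) = t" for n
    using t N(1)[of n] by (simp_all add: \<tau>_def)
  have in0: "0 \<in> {0..t}" "t \<in> {0..t}" using t by auto
  have cc: "c n 0 = Uo (q n 0)" "c n t = u t (Y n)" for n using m[of n] by (auto simp: c_def Mini_def)
  have "(\<lambda>n. Uo (q (r n) 0)) \<longlonglongrightarrow> w 0" using lc[OF in0(1)] unfolding e0 cc .
  moreover have "(\<lambda>n. Uo (q (r n) 0)) \<longlonglongrightarrow> Uo (qq 0)"
    using isCont_tendsto_compose[OF _ lq[OF in0(1)]] Uo_continuous[of UNIV] continuous_on_eq_continuous_at by blast
  ultimately have w0: "w 0 = Uo (qq 0)" using LIMSEQ_unique by blast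
  have lY: "(\<lambda>n. Y (r n)) \<longlonglongrightarrow> y" using LIMSEQ_subseq_LIMSEQ[OF y r] by (simp add: o_def)
  have "(\<lambda>n. u t (Y (r n))) \<longlonglongrightarrow> w t" using lc[OF in0(2)] unfolding e0 cc .
  moreover have "(\<lambda>n. u t (Y (r n))) \<longlonglongrightarrow> u t y"
    by (rule isCont_tendsto_compose[OF u_continuous lY]) (use t in simp)
  ultimately have wt: "w t = u t y" using LIMSEQ_unique by blast
  have "q (r n) t = Y (r n)" for n using m[of "r n"] by (simp add: Mini_def)
  then have qt: "qq t = y" using lq[OF in0(2)] lY LIMSEQ_unique by auto
  have "((\<lambda>t. ell (qq t) (pp t)) has_integral w t - w 0) {0..t}"
    by (rule fundamental_theorem_of_calculus) (use t dw in \<open>auto simp: has_real_derivative_iff_has_vector_derivative\<close>)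
  from integral_unique[OF this] have "Mini t y qq pp"
    using HSq qt w0 wt unfolding Mini_def HS_sol_iff by simp
  with r show ?thesis using lq lpp by (rule that)
qed

end

section \<open>Left traces of the space derivative\<close>

text \<open>Two values would both be approximated almost everywhere on a common interval, which has
  positive measure. This gives the inner \<open>THE\<close> of \<open>pi_map\<close> its
  meaning.\<close>

lemma left_trace_unique:
  assumes "left_trace w x l" "left_trace w x l'"
  shows "l = l'"
proof (rule ccontr)
  assume ne: "l \<noteq> l'"
  define e where "e = \<bar>l - l'\<bar> / 2"
  have e: "e > 0" using ne by (simp add: e_def)
  obtain d1 where d1: "d1 > 0" "AE y in lborel. x - d1 < y \<and> y < x \<longrightarrow> \<bar>w y - l\<bar> < e"
    using assms(1) e unfolding left_trace_def by blast
  obtain d2 where d2: "d2 > 0" "AE y in lborel. x - d2 < y \<and> y < x \<longrightarrow> \<bar>w y - l'\<bar> < e"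
    using assms(2) e unfolding left_trace_def by blast
  define d where "d = min d1 d2"
  have d: "d > 0" using d1 d2 by (simp add: d_def)
  have "AE y in lborel. y \<notin> {x - d<..<x}"
    using d1(2) d2(2)
  proof eventually_elim
    case (elim y)
    show ?case
    proof
      assume "y \<in> {x - d<..<x}"
      then have "\<bar>w y - l\<bar> < e" "\<bar>w y - l'\<bar> < e" using elim by (auto simp: d_def)
      then show False unfolding e_def by (auto simp: abs_if split: if_splits)
    qed
  qed
  then have "{x - d<..<x} \<in> null_sets lborel" using AE_iff_null_sets[of "{x - d<..<x}" lborel] by simp
  then have "emeasure lborel {x - d<..<x} = 0" by (rule null_setsD1)
  then show False using d by simp
qed

context cauchy begin

definition sel :: "real \<Rightarrow> real \<Rightarrow> (real \<Rightarrow> real) \<times> (real \<Rightarrow> real)" where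
  "sel T y = (SOME qp. Mini T y (fst qp) (snd qp))"

abbreviation "Qs T y \<equiv> fst (sel T y)"
abbreviation "Ps T y \<equiv> snd (sel T y)"
abbreviation "mid T y \<equiv> Qs T y (T / 2)"

lemma sel: assumes "T > 0" shows "Mini T y (Qs T y) (Ps T y)"
proof -
  obtain q p where "Mini T y q p" using Mini_exists[OF assms] by blast
  then have "\<exists>qp. Mini T y (fst qp) (snd qp)" by (intro exI[of _ "(q, p)"]) simp
  then show ?thesis unfolding sel_def by (rule someI_ex)
qed

lemma mid_less: "T > 0 \<Longrightarrow> y < y' \<Longrightarrow> mid T y < mid T y'"
  using Mini_ordered(1)[OF sel sel, of T y y' "T / 2"] by simp

text \<open>A minimizer is determined by its end point and its position at time \<open>T / 2\<close>, because minimizers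
  meeting strictly before time \<open>T\<close> coincide.\<close>

lemma terminal_momentum_limit:
  assumes T: "T > 0" and m: "Mini T x q p"
    and uniq: "\<And>Y \<mu>. (\<And>n::nat. Y n \<in> S) \<Longrightarrow> Y \<longlonglongrightarrow> x \<Longrightarrow> (\<lambda>n. mid T (Y n)) \<longlonglongrightarrow> \<mu> \<Longrightarrow> \<mu> = q (T / 2)"
    and e: "e > 0"
  shows "\<exists>d>0. \<forall>y\<in>S. \<bar>y - x\<bar> < d \<longrightarrow> \<bar>Ps T y T - p T\<bar> < e"
proof (rule ccontr)
  assume "\<not> ?thesis"
  then have "\<exists>y\<in>S. \<bar>y - x\<bar> < 1 / real (Suc n) \<and> \<bar>Ps T y T - p T\<bar> \<ge> e" for n
    by (metis linorder_not_less of_nat_0_less_iff zero_less_Suc zero_less_divide_1_iff)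
  then obtain Y where Y: "\<And>n. Y n \<in> S" "\<And>n. \<bar>Y n - x\<bar> < 1 / real (Suc n)" "\<And>n. \<bar>Ps T (Y n) T - p T\<bar> \<ge> e" by metis
  have Yx: "Y \<longlonglongrightarrow> x"
    by (rule LIM_zero_cancel, rule Lim_null_comparison[OF always_eventually LIMSEQ_inverse_real_of_nat])
      (use Y(2) in \<open>auto simp: inverse_eq_divide intro: less_imp_le\<close>)
  obtain r qq pp where r: "strict_mono (r :: nat \<Rightarrow> nat)" and mm: "Mini T x qq pp"
    and lq: "\<And>s. s \<in> {0..T} \<Longrightarrow> (\<lambda>n. Qs T (Y (r n)) s) \<longlonglongrightarrow> qq s"
    and lp: "\<And>s. s \<in> {0..T} \<Longrightarrow> (\<lambda>n. Ps T (Y (r n)) s) \<longlonglongrightarrow> pp s"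
    by (rule Mini_compact[where q="\<lambda>n. Qs T (Y n)" and p="\<lambda>n. Ps T (Y n)", OF T Yx sel[OF T]]) (rule that; assumption)
  have "(\<lambda>n. Y (r n)) \<longlonglongrightarrow> x" using LIMSEQ_subseq_LIMSEQ[OF Yx r] by (simp add: o_def)
  moreover have "(\<lambda>n. mid T (Y (r n))) \<longlonglongrightarrow> qq (T / 2)" by (rule lq) (use T in simp)
  ultimately have "qq (T / 2) = q (T / 2)" using uniq[of "\<lambda>n. Y (r n)"] Y(1) by blast
  then have "pp T = p T" using Mini_crossing(2)[OF mm m, of "T / 2" T] T by simp
  then have "(\<lambda>n. \<bar>Ps T (Y (r n)) T - p T\<bar>) \<longlonglongrightarrow> \<bar>p T - p T\<bar>"
    using lp[of T] T by (intro tendsto_intros) auto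
  then have "e \<le> \<bar>p T - p T\<bar>" by (rule LIMSEQ_le_const) (use Y(3) in blast)
  then show False using e by simp
qed

text \<open>For fixed n the point \<open>A n\<close> eventually lies to the left of
  \<open>B k\<close>, and \<open>mid T\<close> is increasing. Used in both directions it shows that
  all left limits of \<open>mid T\<close> at x agree.\<close>

lemma mid_left_limits:
  assumes T: "T > 0" and A: "\<And>n. A n < x" "A \<longlonglongrightarrow> x" "(\<lambda>n. mid T (A n)) \<longlonglongrightarrow> \<alpha>"
    and B: "\<And>n. B n < x" "B \<longlonglongrightarrow> x" "(\<lambda>n. mid T (B n)) \<longlonglongrightarrow> \<beta>"
  shows "\<alpha> \<le> \<beta>"
proof (rule LIMSEQ_le_const2[OF A(3)], intro exI allI impI)
  fix n
  have "eventually (\<lambda>k. A n < B k) sequentially" by (rule order_tendstoD(1)[OF B(2) A(1)])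
  then obtain M where "\<And>k. k \<ge> M \<Longrightarrow> A n < B k" unfolding eventually_sequentially by blast
  then show "mid T (A n) \<le> \<beta>" using mid_less[OF T]
    by (intro LIMSEQ_le_const[OF B(3)] exI[of _ M]) (auto intro: less_imp_le)
qed

text \<open>One sequence from the left produces a limiting minimizer. Every other such sequence has
  the same limiting midpoint, so its terminal momenta tend to the same value.\<close>

lemma left_limit_minimizer:
  assumes T: "T > 0"
  shows "\<exists>q p. Mini T x q p \<and> (\<forall>e>0. \<exists>d>0. \<forall>y. x - d < y \<and> y < x \<longrightarrow> \<bar>Ps T y T - p T\<bar> < e)"
proof -
  define Y where "Y n = x - inverse (real (Suc n))" for n
  have Yx: "Y \<longlonglongrightarrow> x" unfolding Y_def using tendsto_diff[OF tendsto_const LIMSEQ_inverse_real_of_nat, of x] by simp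
  have Yl: "Y n < x" for n unfolding Y_def by simp
  obtain r q p where r: "strict_mono (r :: nat \<Rightarrow> nat)" and m: "Mini T x q p"
    and lq: "\<And>s. s \<in> {0..T} \<Longrightarrow> (\<lambda>n. Qs T (Y (r n)) s) \<longlonglongrightarrow> q s"
    by (rule Mini_compact[where q="\<lambda>n. Qs T (Y n)" and p="\<lambda>n. Ps T (Y n)", OF T Yx sel[OF T]]) (rule that; assumption)
  have 1: "(\<lambda>n. Y (r n)) \<longlonglongrightarrow> x" using LIMSEQ_subseq_LIMSEQ[OF Yx r] by (simp add: o_def)
  have 2: "(\<lambda>n. mid T (Y (r n))) \<longlonglongrightarrow> q (T / 2)" by (rule lq) (use T in simp)
  have ex: "\<exists>d>0. \<forall>y\<in>{..<x}. \<bar>y - x\<bar> < d \<longrightarrow> \<bar>Ps T y T - p T\<bar> < e" if "e > 0" for e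
  proof (rule terminal_momentum_limit[OF T m _ that])
    fix Z \<mu> assume Z: "\<And>n::nat. Z n \<in> {..<x}" "Z \<longlonglongrightarrow> x" "(\<lambda>n. mid T (Z n)) \<longlonglongrightarrow> \<mu>"
    have Zl: "Z n < x" for n using Z(1) by simp
    show "\<mu> = q (T / 2)"
      using mid_left_limits[OF T Zl Z(2,3) Yl 1 2] mid_left_limits[OF T Yl 1 2 Zl Z(2,3)] by (rule antisym)
  qed
  have "\<exists>d>0. \<forall>y. x - d < y \<and> y < x \<longrightarrow> \<bar>Ps T y T - p T\<bar> < e" if e: "e > 0" for e
  proof -
    obtain d where d: "d > 0" "\<forall>y\<in>{..<x}. \<bar>y - x\<bar> < d \<longrightarrow> \<bar>Ps T y T - p T\<bar> < e"
      using ex[OF e] by blast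
    then show ?thesis by (intro exI[of _ d]) auto
  qed
  then show ?thesis using m by blast
qed

text \<open>Superdifferentiability at y bounds the increment above with slope
  \<open>Ps T y T\<close>; at y + h, with increment -h, it bounds it below with slope
  \<open>Ps T (y + h) T\<close>. Continuity of the midpoint makes the slopes agree in the
  limit.\<close>

lemma u_derivative:
  assumes T: "T > 0" and c: "isCont (mid T) y"
  shows "(u T has_real_derivative Ps T y T) (at y)"
proof -
  obtain C where C: "C > 0" "\<And>y q p \<delta>. Mini T y q p \<Longrightarrow> \<bar>\<delta>\<bar> \<le> 1 \<Longrightarrow> u T (y + \<delta>) \<le> u T y + \<delta> * p T + C * \<delta>\<^sup>2"
    by (rule u_superdifferentiable[OF T]) (rule that; assumption)
  have lim: "\<exists>d>0. \<forall>z\<in>UNIV. \<bar>z - y\<bar> < d \<longrightarrow> \<bar>Ps T z T - Ps T y T\<bar> < e" if "e > 0" for e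
    by (rule terminal_momentum_limit[OF T sel[OF T] _ that]) (use isCont_tendsto_compose[OF c] LIMSEQ_unique in blast)
  have "((\<lambda>h. (u T (y + h) - u T y) / h - Ps T y T) \<longlongrightarrow> 0) (at 0)"
  proof (rule tendstoI)
    fix e :: real assume e: "e > 0"
    obtain d where d: "d > 0" "\<And>z. \<bar>z - y\<bar> < d \<Longrightarrow> \<bar>Ps T z T - Ps T y T\<bar> < e / 2" using lim[of "e / 2"] e by auto
    show "\<forall>\<^sub>F h in at 0. dist ((u T (y + h) - u T y) / h - Ps T y T) 0 < e"
      unfolding eventually_at
    proof (intro exI[of _ "min (min d 1) (e / (2 * C))"] conjI ballI impI)
      show "min (min d 1) (e / (2 * C)) > 0" using d(1) e C(1) by simp
      fix h :: real assume h: "h \<noteq> 0 \<and> dist h 0 < min (min d 1) (e / (2 * C))"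
      then have h1: "\<bar>h\<bar> \<le> 1" "\<bar>h\<bar> < d" "C * \<bar>h\<bar> < e / 2" "\<bar>h\<bar> > 0" using C(1) by (auto simp: field_simps)
      have up: "u T (y + h) \<le> u T y + h * Ps T y T + C * h\<^sup>2" by (rule C(2)[OF sel[OF T] h1(1)])
      have "u T (y + h + - h) \<le> u T (y + h) + (- h) * Ps T (y + h) T + C * (- h)\<^sup>2"
        by (rule C(2)[OF sel[OF T]]) (use h1 in simp)
      then have lo: "u T y \<le> u T (y + h) - h * Ps T (y + h) T + C * h\<^sup>2" by simp
      have "\<bar>h * (Ps T (y + h) T - Ps T y T)\<bar> \<le> \<bar>h\<bar> * (e / 2)"
        unfolding abs_mult using d(2)[of "y + h"] h1(2) by (intro mult_left_mono) auto
      then have "\<bar>u T (y + h) - u T y - h * Ps T y T\<bar> \<le> \<bar>h\<bar> * (e / 2) + C * h\<^sup>2"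
        using up lo C(1) unfolding right_diff_distrib by (smt (verit) mult_nonneg_nonneg zero_le_power2 abs_ge_zero)
      also have "C * h\<^sup>2 = \<bar>h\<bar> * (C * \<bar>h\<bar>)" by (simp add: power2_eq_square)
      also have "\<bar>h\<bar> * (e / 2) + \<bar>h\<bar> * (C * \<bar>h\<bar>) < \<bar>h\<bar> * (e / 2) + \<bar>h\<bar> * (e / 2)"
        using h1 by (intro add_strict_left_mono mult_strict_left_mono) auto
      finally have "\<bar>u T (y + h) - u T y - h * Ps T y T\<bar> < \<bar>h\<bar> * e" by (simp add: mult.commute)
      moreover have "(u T (y + h) - u T y) / h - Ps T y T = (u T (y + h) - u T y - h * Ps T y T) / h"
        using h by (simp add: field_simps)
      ultimately show "dist ((u T (y + h) - u T y) / h - Ps T y T) 0 < e"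
        using h1(4) by (simp add: dist_real_def field_simps)
    qed
  qed
  then show ?thesis unfolding DERIV_def by (simp add: LIM_zero_iff)
qed

text \<open>Almost every y is a continuity point of the increasing function \<open>mid T\<close>;
  there the derivative is a terminal momentum, whose left limit is known.\<close>

lemma left_trace_u:
  assumes T: "T > 0"
  shows "\<exists>q p. Mini T x q p \<and> left_trace (deriv (u T)) x (p T)"
proof -
  obtain q p where m: "Mini T x q p"
    and l: "\<And>e. e > 0 \<Longrightarrow> \<exists>d>0. \<forall>y. x - d < y \<and> y < x \<longrightarrow> \<bar>Ps T y T - p T\<bar> < e"
    using left_limit_minimizer[OF T] by blast
  have "mono (mid T)" by (rule monoI) (metis mid_less[OF T] less_le_not_le order_le_less)
  then have "countable {y. \<not> isCont (mid T) y}" by (rule mono_ctble_discont)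
  then have "{y. \<not> isCont (mid T) y} \<in> null_sets lborel" by (rule countable_imp_null_set_lborel)
  then have ae: "AE y in lborel. y \<notin> {y. \<not> isCont (mid T) y}" by (rule AE_not_in)
  have "left_trace (deriv (u T)) x (p T)" unfolding left_trace_def
  proof (intro allI impI)
    fix e :: real assume "e > 0"
    then obtain d where d: "d > 0" "\<forall>y. x - d < y \<and> y < x \<longrightarrow> \<bar>Ps T y T - p T\<bar> < e" using l by blast
    have "AE y in lborel. x - d < y \<and> y < x \<longrightarrow> \<bar>deriv (u T) y - p T\<bar> < e"
      using ae
    proof eventually_elim
      case (elim y)
      then have "deriv (u T) y = Ps T y T" using u_derivative[OF T] DERIV_imp_deriv by blast
      then show ?case using d(2) by simp
    qed
    with d(1) show "\<exists>d>0. AE y in lborel. x - d < y \<and> y < x \<longrightarrow> \<bar>deriv (u T) y - p T\<bar> < e" by blast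
  qed
  with m show ?thesis by blast
qed

text \<open>The backward solution of (HS) from x and the left trace is unique, hence it is a
  minimizer, and initial points of minimizers are ordered.\<close>

lemma mono_pi_map:
  assumes T: "T > 0"
  shows "mono (pi_map H T (deriv (u T)))"
proof -
  have pi: "\<exists>q p. Mini T x q p \<and> pi_map H T (deriv (u T)) x = q 0" for x
  proof -
    obtain q p where m: "Mini T x q p" and l: "left_trace (deriv (u T)) x (p T)" using left_trace_u[OF T] by blast
    have the: "(THE l. left_trace (deriv (u T)) x l) = p T"
      using l left_trace_unique by blast
    have "pi_map H T (deriv (u T)) x = q 0" unfolding pi_map_def the
    proof (rule the_equality)
      show "\<exists>q' p'. HS_sol H T q' p' \<and> q' T = x \<and> p' T = p T \<and> q' 0 = q 0"
        using m unfolding Mini_def HS_sol_iff by blast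
      fix y assume "\<exists>q' p'. HS_sol H T q' p' \<and> q' T = x \<and> p' T = p T \<and> q' 0 = y"
      then obtain q' p' where "HSab 0 T q' p'" "q' T = x" "p' T = p T" "q' 0 = y" unfolding HS_sol_iff by blast
      then show "y = q 0" using HSab_unique(1)[of 0 T q' p' q p T 0] m T by (simp add: Mini_def)
    qed
    then show ?thesis using m by blast
  qed
  show ?thesis
  proof (rule monoI)
    fix x y :: real assume xy: "x \<le> y"
    show "pi_map H T (deriv (u T)) x \<le> pi_map H T (deriv (u T)) y"
    proof (cases "x = y")
      case False
      obtain q1 p1 where 1: "Mini T x q1 p1" "pi_map H T (deriv (u T)) x = q1 0" using pi by blast
      obtain q2 p2 where 2: "Mini T y q2 p2" "pi_map H T (deriv (u T)) y = q2 0" using pi by blast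
      show ?thesis using Mini_ordered(2)[OF 1(1) 2(1) _ T, of 0] 1 2 False xy T by simp
    qed simp
  qed
qed

end

section \<open>Viscosity solutions\<close>

lemma pdt_pdx:
  assumes "(\<phi> has_derivative (\<lambda>h. a * fst h + b * snd h)) (at z)"
  shows "pdt \<phi> z = a" "pdx \<phi> z = b"
  unfolding pdt_def pdx_def
  using partial_derivs[of \<phi> a b "fst z" "snd z"] assms by (auto intro: DERIV_imp_deriv)

lemma test_C1_partials:
  assumes "test_C1 \<phi>"
  shows "(\<phi> has_derivative (\<lambda>h. pdt \<phi> z * fst h + pdx \<phi> z * snd h)) (at z)"
proof -
  obtain a b where d: "(\<phi> has_derivative (\<lambda>h. a * fst h + b * snd h)) (at z)"
    using assms unfolding test_C1_def by blast
  from pdt_pdx[OF d] d show ?thesis by simp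
qed

lemma test_C1_along_curve:
  assumes "test_C1 \<phi>" "(\<gamma> has_real_derivative v) (at t within S)"
  shows "((\<lambda>s. \<phi> (s, \<gamma> s)) has_real_derivative pdt \<phi> (t, \<gamma> t) + v * pdx \<phi> (t, \<gamma> t)) (at t within S)"
proof -
  have "((\<lambda>s. (s, \<gamma> s)) has_derivative (\<lambda>h. (h, v * h))) (at t within S)"
    using assms(2) by (intro has_derivative_Pair has_derivative_ident) (simp add: has_field_derivative_def)
  from has_derivative_compose[OF this test_C1_partials[OF assms(1)]]
  show ?thesis unfolding has_field_derivative_def
    by (rule has_derivative_eq_rhs) (auto simp: fun_eq_iff algebra_simps)
qed

section \<open>The value function is a viscosity solution\<close>

context cauchy begin

text \<open>The test curve is the line backwards from (t, x) with velocity \<open>Hp x P\<close>,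
  for which Fenchel's inequality at \<open>P\<close> is an equality. If the equation failed by
  \<open>\<epsilon>\<close>, \<open>\<phi>\<close> would grow along it faster than the running cost,
  against \<open>u_dpp\<close> and the maximum.\<close>

lemma u_subsolution:
  assumes t: "t > 0" and \<phi>: "test_C1 \<phi>"
    and max: "e > 0" "\<And>z. z \<in> ball (t, x) e \<Longrightarrow> u (fst z) (snd z) - \<phi> z \<le> u t x - \<phi> (t, x)"
  shows "pdt \<phi> (t, x) + H x (pdx \<phi> (t, x)) \<le> 0"
proof (rule ccontr)
  assume "\<not> ?thesis"
  define P where "P = pdx \<phi> (t, x)"
  define v where "v = Hp x P"
  define \<epsilon> where "\<epsilon> = pdt \<phi> (t, x) + H x P"
  have \<epsilon>: "\<epsilon> > 0" using \<open>\<not> _\<close> by (simp add: \<epsilon>_def P_def)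
  have ellv: "Lag H x v = v * P - H x P" unfolding v_def Lag_Hp ell_def by simp
  define \<gamma> where "\<gamma> s = x + (s - t) * v" for s
  have d\<gamma>: "(\<gamma> has_real_derivative v) (at s within S)" for s S
    unfolding \<gamma>_def by (auto intro!: derivative_eq_intros)
  have \<gamma>t: "\<gamma> t = x" by (simp add: \<gamma>_def)
  define F where "F s = \<phi> (s, \<gamma> s) - s * (Lag H x v + \<epsilon> / 2)" for s
  have "(F has_real_derivative (pdt \<phi> (t, \<gamma> t) + v * pdx \<phi> (t, \<gamma> t)) - (Lag H x v + \<epsilon> / 2)) (at t)"
    unfolding F_def by (auto intro!: derivative_eq_intros test_C1_along_curve[OF \<phi> d\<gamma>])
  moreover have "(pdt \<phi> (t, \<gamma> t) + v * pdx \<phi> (t, \<gamma> t)) - (Lag H x v + \<epsilon> / 2) = \<epsilon> / 2"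
    unfolding \<gamma>t ellv by (simp add: \<epsilon>_def P_def field_simps)
  ultimately have "(F has_real_derivative \<epsilon> / 2) (at t)" by simp
  from DERIV_pos_inc_left[OF this] \<epsilon> obtain d1 where d1: "d1 > 0" "\<And>h. 0 < h \<Longrightarrow> h < d1 \<Longrightarrow> F (t - h) < F t" by auto
  have "isCont (\<lambda>s. Lag H (\<gamma> s) v) t"
  proof -
    have "continuous_on UNIV (\<lambda>s. Lag H (\<gamma> s) v)"
      unfolding \<gamma>_def by (intro continuous_intros)
    then show ?thesis by (simp add: continuous_on_eq_continuous_at)
  qed
  then have "eventually (\<lambda>s. Lag H (\<gamma> s) v < Lag H x v + \<epsilon> / 2) (at t)"
    unfolding isCont_def \<gamma>t using \<epsilon> by (intro order_tendstoD(2)) auto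
  then obtain d2 where d2: "d2 > 0" "\<And>s. s \<noteq> t \<Longrightarrow> \<bar>s - t\<bar> < d2 \<Longrightarrow> Lag H (\<gamma> s) v < Lag H x v + \<epsilon> / 2"
    unfolding eventually_at dist_real_def by auto
  \<comment> \<open>Small enough for the two local estimates, for a positive time, and for the point
    at time t - h to lie in the ball.\<close>
  define h where "h = min (min (d1 / 2) (d2 / 2)) (min (t / 2) (e / (2 * (1 + \<bar>v\<bar>))))"
  have h: "h > 0" "h < d1" "h < d2" "h < t" "h * (1 + \<bar>v\<bar>) < e"
  proof -
    show "h > 0" unfolding h_def using d1(1) d2(1) t max(1) by simp
    have "h \<le> d1 / 2" "h \<le> d2 / 2" "h \<le> t / 2" unfolding h_def by linarith+
    then show "h < d1" "h < d2" "h < t" using d1(1) d2(1) t by linarith+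
    have "h * (1 + \<bar>v\<bar>) \<le> e / (2 * (1 + \<bar>v\<bar>)) * (1 + \<bar>v\<bar>)" by (intro mult_right_mono) (auto simp: h_def)
    also have "\<dots> = e / 2" by (simp add: field_simps)
    finally show "h * (1 + \<bar>v\<bar>) < e" using max(1) by simp
  qed
  have "dist (t, x) (t - h, \<gamma> (t - h)) \<le> \<bar>h\<bar> + \<bar>h * v\<bar>"
    using norm_Pair_le[of h "h * v"] by (simp add: dist_norm \<gamma>_def)
  also have "\<dots> < e" using h by (simp add: abs_mult algebra_simps)
  finally have "u (t - h) (\<gamma> (t - h)) - \<phi> (t - h, \<gamma> (t - h)) \<le> u t x - \<phi> (t, x)"
    using max(2)[of "(t - h, \<gamma> (t - h))"] by simp
  moreover have c: "C1c (t - h) t \<gamma> (\<lambda>_. v)" unfolding C1c_def using d\<gamma> by simp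
  have "u t (\<gamma> t) \<le> u (t - h) (\<gamma> (t - h)) + cost (t - h) t \<gamma> (\<lambda>_. v)"
    by (rule u_dpp[OF _ _ c]) (use h in auto)
  moreover have "cost (t - h) t \<gamma> (\<lambda>_. v) \<le> integral {t - h..t} (\<lambda>_. Lag H x v + \<epsilon> / 2)"
    unfolding cost_def
  proof (rule integral_le[OF cost_integrable[OF c order_refl order_refl]])
    fix s assume s: "s \<in> {t - h..t}"
    show "Lag H (\<gamma> s) v \<le> Lag H x v + \<epsilon> / 2"
      using d2(2)[of s] s h \<epsilon> by (cases "s = t") (auto simp: \<gamma>t intro: less_imp_le)
  qed (rule integrable_const_ivl)
  moreover have "integral {t - h..t} (\<lambda>_. Lag H x v + \<epsilon> / 2) = h * (Lag H x v + \<epsilon> / 2)" using h by simp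
  moreover have "F (t - h) < F t" by (rule d1(2)[OF h(1,2)])
  ultimately show False unfolding F_def \<gamma>t left_diff_distrib by linarith
qed

text \<open>The test curve is a minimizer ending at (t, x): along it dynamic programming is an
  equality, and Fenchel's inequality for its terminal velocity and \<open>P\<close> has the required
  direction. Derivatives at t are from the left.\<close>

lemma u_supersolution:
  assumes t: "t > 0" and \<phi>: "test_C1 \<phi>"
    and min: "e > 0" "\<And>z. z \<in> ball (t, x) e \<Longrightarrow> u (fst z) (snd z) - \<phi> z \<ge> u t x - \<phi> (t, x)"
  shows "pdt \<phi> (t, x) + H x (pdx \<phi> (t, x)) \<ge> 0"
proof (rule ccontr)
  assume "\<not> ?thesis"
  define P where "P = pdx \<phi> (t, x)"
  define \<epsilon> where "\<epsilon> = - (pdt \<phi> (t, x) + H x P)"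
  have \<epsilon>: "\<epsilon> > 0" using \<open>\<not> _\<close> by (simp add: \<epsilon>_def P_def)
  obtain q p where m: "Mini t x q p" using Mini_exists[OF t] by blast
  have HS: "HSab 0 t q p" and qt: "q t = x" using m by (auto simp: Mini_def)
  define v where "v = Hp (q t) (p t)"
  have Lv: "ell (q t) (p t) = Lag H x v" unfolding v_def Lag_Hp[symmetric] qt ..
  define F where "F s = \<phi> (s, q s) - s * (Lag H x v - \<epsilon> / 2)" for s
  have dq: "(q has_real_derivative v) (at t within {0..t})" using HS t by (simp add: HSab_def v_def)
  have dF: "(F has_real_derivative (pdt \<phi> (t, q t) + v * pdx \<phi> (t, q t)) - (Lag H x v - \<epsilon> / 2)) (at t within {0..t})"
    unfolding F_def by (auto intro!: derivative_eq_intros test_C1_along_curve[OF \<phi> dq])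
  have "pdt \<phi> (t, q t) + v * pdx \<phi> (t, q t) - (Lag H x v - \<epsilon> / 2) \<le> - \<epsilon> / 2"
    using Lag_ge[of P v x] unfolding qt \<epsilon>_def P_def by (simp add: field_simps)
  then have neg: "pdt \<phi> (t, q t) + v * pdx \<phi> (t, q t) - (Lag H x v - \<epsilon> / 2) < 0" using \<epsilon> by linarith
  obtain d1 where d1: "d1 > 0" "\<And>h. 0 < h \<Longrightarrow> t - h \<in> {0..t} \<Longrightarrow> h < d1 \<Longrightarrow> F t < F (t - h)"
    using has_real_derivative_neg_dec_left[OF dF neg] by auto
  have ct: "continuous_on {0..t} (\<lambda>s. ell (q s) (p s))" by (intro continuous_intros HSab_continuous[OF HS])
  have "((\<lambda>s. ell (q s) (p s)) \<longlongrightarrow> ell (q t) (p t)) (at t within {0..t})"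
    using ct t unfolding continuous_on by simp
  then have "eventually (\<lambda>s. ell (q s) (p s) > Lag H x v - \<epsilon> / 2) (at t within {0..t})"
    using \<epsilon> Lv by (intro order_tendstoD(1)) auto
  then obtain d2 where d2: "d2 > 0" "\<And>s. s \<in> {0..t} \<Longrightarrow> s \<noteq> t \<Longrightarrow> \<bar>s - t\<bar> < d2 \<Longrightarrow> ell (q s) (p s) > Lag H x v - \<epsilon> / 2"
    unfolding eventually_at dist_real_def by auto
  define h where "h = min (min (d1 / 2) (d2 / 2)) (min (t / 2) (e / (2 * (1 + Bd))))"
  have h: "h > 0" "h < d1" "h < d2" "h < t" "h * (1 + Bd) < e"
  proof -
    show "h > 0" unfolding h_def using d1(1) d2(1) t min(1) Bd(1) by simp
    have "h \<le> d1 / 2" "h \<le> d2 / 2" "h \<le> t / 2" unfolding h_def by linarith+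
    then show "h < d1" "h < d2" "h < t" using d1(1) d2(1) t by linarith+
    have "h * (1 + Bd) \<le> e / (2 * (1 + Bd)) * (1 + Bd)" using Bd(1) by (intro mult_right_mono) (auto simp: h_def)
    also have "\<dots> = e / 2" using Bd(1) by (simp add: field_simps)
    finally show "h * (1 + Bd) < e" using min(1) by simp
  qed
  have "dist (t, x) (t - h, q (t - h)) \<le> \<bar>h\<bar> + \<bar>x - q (t - h)\<bar>"
    using norm_Pair_le[of h "x - q (t - h)"] by (simp add: dist_norm)
  also have "\<bar>x - q (t - h)\<bar> \<le> Bd * h"
    using Mini_speed(1)[OF m t, of "t - h" t] h qt by auto
  also have "\<bar>h\<bar> + Bd * h < e" using h by (simp add: algebra_simps)
  finally have "u (t - h) (q (t - h)) - \<phi> (t - h, q (t - h)) \<ge> u t x - \<phi> (t, x)"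
    using min(2)[of "(t - h, q (t - h))"] by simp
  moreover have "u t x = u (t - h) (q (t - h)) + integral {t - h..t} (\<lambda>s. ell (q s) (p s))"
    by (rule Mini_calibrated(1)[OF m]) (use h in auto)
  moreover have "integral {t - h..t} (\<lambda>s. ell (q s) (p s)) \<ge> integral {t - h..t} (\<lambda>_. Lag H x v - \<epsilon> / 2)"
  proof (rule integral_le)
    show "(\<lambda>s. ell (q s) (p s)) integrable_on {t - h..t}"
      by (rule HSab_ell_integrable[OF HSab_subset[OF HS]]) (use h in auto)
    fix s assume s: "s \<in> {t - h..t}"
    show "Lag H x v - \<epsilon> / 2 \<le> ell (q s) (p s)"
      using d2(2)[of s] s h \<epsilon> Lv by (cases "s = t") (auto intro: less_imp_le)
  qed (rule integrable_const_ivl)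
  moreover have "integral {t - h..t} (\<lambda>_. Lag H x v - \<epsilon> / 2) = h * (Lag H x v - \<epsilon> / 2)" using h by simp
  moreover have "F t < F (t - h)" by (rule d1(2)) (use h in auto)
  ultimately show False unfolding F_def qt left_diff_distrib by linarith
qed

lemma u_visc_sol: "HJ_visc_sol H Uo u"
  unfolding HJ_visc_sol_def
proof (intro conjI allI impI)
  show "u 0 x = Uo x" for x by (rule u_0)
  show "\<exists>C. C-lipschitz_on ({0..\<tau>} \<times> UNIV) (\<lambda>(t, x). u t x)" for \<tau>
  proof -
    obtain C where C: "C \<ge> 0" "\<And>s t x y. s \<in> {0..\<tau>} \<Longrightarrow> t \<in> {0..\<tau>} \<Longrightarrow> \<bar>u s x - u t y\<bar> \<le> C * (\<bar>s - t\<bar> + \<bar>x - y\<bar>)"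
      by (rule u_lipschitz[of \<tau>]) (rule that; assumption)
    \<comment> \<open>The factor 2 passes from the sum of coordinate distances to the product
      metric.\<close>
    have "(2 * C)-lipschitz_on ({0..\<tau>} \<times> UNIV) (\<lambda>(t, x). u t x)"
    proof (rule lipschitz_onI)
      fix z w :: "real \<times> real" assume zw: "z \<in> {0..\<tau>} \<times> UNIV" "w \<in> {0..\<tau>} \<times> UNIV"
      have "\<bar>fst z - fst w\<bar> \<le> dist z w" "\<bar>snd z - snd w\<bar> \<le> dist z w"
        using dist_fst_le[of z w] dist_snd_le[of z w] by (simp_all add: dist_real_def)
      then have "C * (\<bar>fst z - fst w\<bar> + \<bar>snd z - snd w\<bar>) \<le> C * (2 * dist z w)" using C(1) by (intro mult_left_mono) auto
      moreover have "\<bar>u (fst z) (snd z) - u (fst w) (snd w)\<bar> \<le> C * (\<bar>fst z - fst w\<bar> + \<bar>snd z - snd w\<bar>)"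
        by (rule C(2)) (use zw in auto)
      ultimately show "dist (case z of (t, x) \<Rightarrow> u t x) (case w of (t, x) \<Rightarrow> u t x) \<le> 2 * C * dist z w"
        by (simp add: dist_real_def case_prod_unfold)
    qed (use C(1) in simp)
    then show ?thesis by blast
  qed
  show "pdt \<phi> (t, x) + H x (pdx \<phi> (t, x)) \<le> 0"
    if "t > 0" "test_C1 \<phi>" "\<exists>e>0. \<forall>z\<in>ball (t, x) e. u (fst z) (snd z) - \<phi> z \<le> u t x - \<phi> (t, x)" for t x \<phi>
    using u_subsolution[OF that(1,2)] that(3) by blast
  show "0 \<le> pdt \<phi> (t, x) + H x (pdx \<phi> (t, x))"
    if "t > 0" "test_C1 \<phi>" "\<exists>e>0. \<forall>z\<in>ball (t, x) e. u t x - \<phi> (t, x) \<le> u (fst z) (snd z) - \<phi> z" for t x \<phi>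
    using u_supersolution[OF that(1,2)] that(3) by blast
qed

end

section \<open>Comparison principle and uniqueness\<close>

lemma exists_max_of_compact:
  fixes f :: "'a::topological_space \<Rightarrow> real"
  assumes "compact K" "K \<subseteq> S" "continuous_on S f" "z0 \<in> S" "\<And>z. z \<in> S - K \<Longrightarrow> f z < f z0"
  shows "\<exists>z\<in>S. \<forall>w\<in>S. f w \<le> f z"
proof -
  have z0: "z0 \<in> K" using assms(4,5) by blast
  have "\<exists>z\<in>K. \<forall>w\<in>K. f w \<le> f z"
    by (rule continuous_attains_sup) (use assms(1,2) z0 continuous_on_subset[OF assms(3)] in auto)
  then obtain z where z: "z \<in> K" "\<And>w. w \<in> K \<Longrightarrow> f w \<le> f z" by blast
  have "f w \<le> f z" if "w \<in> S" for w
    using z(2)[of w] z(2)[OF z0] assms(5)[of w] that by (cases "w \<in> K") auto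
  then show ?thesis using z(1) assms(2) by blast
qed

lemma separated_test_C1:
  fixes f g f' g' :: "real \<Rightarrow> real"
  assumes f: "\<And>t. (f has_real_derivative f' t) (at t)" and g: "\<And>x. (g has_real_derivative g' x) (at x)"
    and c: "continuous_on UNIV f'" "continuous_on UNIV g'"
  shows "test_C1 (\<lambda>z. f (fst z) + g (snd z))"
    and "pdt (\<lambda>z. f (fst z) + g (snd z)) (t, x) = f' t"
    and "pdx (\<lambda>z. f (fst z) + g (snd z)) (t, x) = g' x"
proof -
  have d: "((\<lambda>z. f (fst z) + g (snd z)) has_derivative (\<lambda>h. f' (fst z) * fst h + g' (snd z) * snd h)) (at z)"
    for z :: "real \<times> real"
    using f[of "fst z"] g[of "snd z"] unfolding has_field_derivative_def
    by (intro has_derivative_add)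
      (rule has_derivative_compose[OF has_derivative_fst[OF has_derivative_ident]],
       (rule has_derivative_compose[OF has_derivative_snd[OF has_derivative_ident]] | assumption)+)
  have "continuous_on UNIV (\<lambda>z::real \<times> real. f' (fst z))" "continuous_on UNIV (\<lambda>z::real \<times> real. g' (snd z))"
    by (rule continuous_on_compose2[OF c(1) continuous_on_fst[OF continuous_on_id]], simp)
      (rule continuous_on_compose2[OF c(2) continuous_on_snd[OF continuous_on_id]], simp)
  with d show "test_C1 (\<lambda>z. f (fst z) + g (snd z))" unfolding test_C1_def by blast
  show "pdt (\<lambda>z. f (fst z) + g (snd z)) (t, x) = f' t" "pdx (\<lambda>z. f (fst z) + g (snd z)) (t, x) = g' x"
    using pdt_pdx[OF d[of "(t, x)"]] by simp_all
qed

context ham begin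

text \<open>Doubling of variables. The exponential penalty keeps the maximum away from the end of the
  time interval, and its derivative supplies the strict inequality.\<close>

lemma visc_comparison:
  assumes U: "HJ_visc_sol H Uo U" and V: "HJ_visc_sol H Uo V" and t0: "t0 > 0"
  shows "U t0 x0 \<le> V t0 x0"
proof (rule ccontr)
  assume "\<not> ?thesis"
  define \<sigma> where "\<sigma> = U t0 x0 - V t0 x0"
  have \<sigma>: "\<sigma> > 0" using \<open>\<not> _\<close> by (simp add: \<sigma>_def)
  \<comment> \<open>The extra unit of time is room for the penalty to push the maximum away from the
    upper end.\<close>
  define \<tau> where "\<tau> = t0 + 1"
  have \<tau>: "\<tau> > 0" using t0 by (simp add: \<tau>_def)
  have lip: "\<exists>C>0. \<forall>t\<in>{0..\<tau>}. \<forall>s\<in>{0..\<tau>}. \<forall>x y. \<bar>F t x - F s y\<bar> \<le> C * (\<bar>t - s\<bar> + \<bar>x - y\<bar>)"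
    if vs: "HJ_visc_sol H Uo F" for F
  proof -
    obtain C where C: "C-lipschitz_on ({0..\<tau>} \<times> UNIV) (\<lambda>(t, x). F t x)"
      using vs \<tau> unfolding HJ_visc_sol_def by blast
    have "\<bar>F t x - F s y\<bar> \<le> (C + 1) * (\<bar>t - s\<bar> + \<bar>x - y\<bar>)" if "t \<in> {0..\<tau>}" "s \<in> {0..\<tau>}" for t s x y
    proof -
      have "\<bar>F t x - F s y\<bar> \<le> C * dist (t, x) (s, y)"
        using lipschitz_onD[OF C, of "(t, x)" "(s, y)"] that by (simp add: dist_real_def)
      also have "\<dots> \<le> (C + 1) * (\<bar>t - s\<bar> + \<bar>x - y\<bar>)"
        using lipschitz_on_nonneg[OF C] norm_Pair_le[of "t - s" "x - y"] by (intro mult_mono) (auto simp: dist_norm)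
      finally show ?thesis .
    qed
    then show ?thesis using lipschitz_on_nonneg[OF C] by (intro exI[of _ "C + 1"]) auto
  qed
  obtain C1 where C1: "C1 > 0" "\<And>t s x y. t \<in> {0..\<tau>} \<Longrightarrow> s \<in> {0..\<tau>} \<Longrightarrow> \<bar>U t x - U s y\<bar> \<le> C1 * (\<bar>t - s\<bar> + \<bar>x - y\<bar>)"
    using lip[OF U] by blast
  obtain C2 where C2: "C2 > 0" "\<And>t s x y. t \<in> {0..\<tau>} \<Longrightarrow> s \<in> {0..\<tau>} \<Longrightarrow> \<bar>V t x - V s y\<bar> \<le> C2 * (\<bar>t - s\<bar> + \<bar>x - y\<bar>)"
    using lip[OF V] by blast
  define C where "C = max C1 C2"
  have C: "C > 0" using C1(1) by (simp add: C_def)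
  have LU: "\<bar>U t x - U s y\<bar> \<le> C * (\<bar>t - s\<bar> + \<bar>x - y\<bar>)" and LV: "\<bar>V t x - V s y\<bar> \<le> C * (\<bar>t - s\<bar> + \<bar>x - y\<bar>)"
    if "t \<in> {0..\<tau>}" "s \<in> {0..\<tau>}" for t s x y
  proof -
    have "C1 * (\<bar>t - s\<bar> + \<bar>x - y\<bar>) \<le> C * (\<bar>t - s\<bar> + \<bar>x - y\<bar>)" "C2 * (\<bar>t - s\<bar> + \<bar>x - y\<bar>) \<le> C * (\<bar>t - s\<bar> + \<bar>x - y\<bar>)"
      by (auto intro!: mult_right_mono simp: C_def)
    then show "\<bar>U t x - U s y\<bar> \<le> C * (\<bar>t - s\<bar> + \<bar>x - y\<bar>)" "\<bar>V t x - V s y\<bar> \<le> C * (\<bar>t - s\<bar> + \<bar>x - y\<bar>)"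
      using C1(2)[OF that, of x y] C2(2)[OF that, of x y] by auto
  qed
  have UV0: "U 0 x = V 0 x" for x using U V unfolding HJ_visc_sol_def by simp
  define M where "M = 2 * C * \<tau>"
  have M: "M > 0" using C \<tau> by (simp add: M_def)
  have UV: "U t x - V s y \<le> M + C * (\<bar>t - s\<bar> + \<bar>x - y\<bar>)" if "t \<in> {0..\<tau>}" "s \<in> {0..\<tau>}" for t s x y
  proof -
    have "U t x - V t x \<le> C * t + C * t"
      using LU[of t 0 x x] LV[of t 0 x x] that UV0[of x] by auto
    also have "\<dots> \<le> M" unfolding M_def using that C by (simp add: mult_left_mono)
    finally show ?thesis using LV[OF that, of x y] by (simp add: abs_le_iff)
  qed
  \<comment> \<open>With this rate the penalty is only \<open>\<sigma> / 2\<close> at t0, leaving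
    half of the gap, but from t0 + 1/2 on it exceeds \<open>M + 1\<close>.\<close>
  define m where "m = 4 * (M + 1) / \<sigma>"
  have m: "m > 0" using M \<sigma> by (simp add: m_def)
  define \<rho> where "\<rho> t = \<sigma> / 2 * exp (m * (t - t0))" for t
  define \<rho>' where "\<rho>' t = \<sigma> / 2 * m * exp (m * (t - t0))" for t
  have d\<rho>: "(\<rho> has_real_derivative \<rho>' t) (at t)" for t
    unfolding \<rho>_def \<rho>'_def by (auto intro!: derivative_eq_intros)
  have \<rho>0: "\<rho> t \<ge> 0" for t using \<sigma> by (simp add: \<rho>_def)
  \<comment> \<open>Least slope of the penalty at nonnegative times: the amount by which the
    inequality for U becomes strict.\<close>
  define \<mu>0 where "\<mu>0 = \<rho>' 0"
  have \<mu>0: "\<mu>0 > 0" unfolding \<mu>0_def \<rho>'_def using \<sigma> m by simp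
  have \<mu>\<rho>: "\<mu>0 \<le> \<rho>' t" if "t \<ge> 0" for t
    unfolding \<mu>0_def \<rho>'_def using \<sigma> m that by (intro mult_left_mono) (auto simp: right_diff_distrib)
  have \<rho>big: "\<rho> t > M + 1" if "t \<ge> t0 + 1 / 2" for t
  proof -
    have "m * (1 / 2) \<le> m * (t - t0)" using m that by (intro mult_left_mono) auto
    moreover have "m * (t - t0) < exp (m * (t - t0))" using exp_ge_add_one_self[of "m * (t - t0)"] by linarith
    ultimately have "\<sigma> / 2 * (m * (1 / 2)) < \<rho> t" unfolding \<rho>_def using \<sigma> by (intro mult_strict_left_mono) auto
    moreover have "\<sigma> / 2 * (m * (1 / 2)) = M + 1" unfolding m_def using \<sigma> by simp
    ultimately show ?thesis by simp
  qed
  obtain D where D: "D > 0" "\<And>x p y r. \<bar>p\<bar> \<le> 4 * C + 1 \<Longrightarrow> \<bar>r\<bar> \<le> 4 * C + 1 \<Longrightarrow> \<bar>H x p - H y r\<bar> \<le> D * (\<bar>x - y\<bar> + \<bar>p - r\<bar>)"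
    using lipschitz[of "4 * C + 1"] by metis
  define \<kappa> where "\<kappa> = min 1 (\<mu>0 / (4 * D))"
  have \<kappa>: "\<kappa> > 0" "\<kappa> \<le> 1" "D * \<kappa> \<le> \<mu>0 / 4"
  proof -
    show "\<kappa> > 0" "\<kappa> \<le> 1" using \<mu>0 D(1) by (auto simp: \<kappa>_def)
    have "D * \<kappa> \<le> D * (\<mu>0 / (4 * D))" using D(1) by (intro mult_left_mono) (auto simp: \<kappa>_def)
    then show "D * \<kappa> \<le> \<mu>0 / 4" using D(1) by simp
  qed
  \<comment> \<open>Penalty at infinity: at the maximum
    \<open>\<beta> * (x - x0)^2 \<le> M + 1\<close>, and with this \<open>\<beta>\<close> its
    derivative there is at most \<open>\<kappa>\<close>.\<close>
  define \<beta> where "\<beta> = \<kappa>\<^sup>2 / (4 * (M + 1))"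
  have \<beta>: "\<beta> > 0" "4 * \<beta> * (M + 1) = \<kappa>\<^sup>2" using \<kappa>(1) M by (auto simp: \<beta>_def field_simps)
  \<comment> \<open>Target for the distance of the doubled points. The four bounds keep s below
    \<open>\<tau>\<close>, exclude time 0, keep U - V below \<open>M + 1\<close>, and make the
    difference of Hamiltonians small.\<close>
  define w where "w = min (min (1 / 4) (\<sigma> / (4 * C))) (min (1 / C) (\<mu>0 / (4 * D)))"
  have w: "w > 0" "w \<le> 1 / 4" "C * w \<le> \<sigma> / 4" "C * w \<le> 1" "D * w \<le> \<mu>0 / 4"
  proof -
    show "w > 0" "w \<le> 1 / 4" using \<sigma> C \<mu>0 D(1) by (auto simp: w_def)
    have "C * w \<le> C * (\<sigma> / (4 * C))" using C by (intro mult_left_mono) (auto simp: w_def)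
    then show "C * w \<le> \<sigma> / 4" using C by simp
    have "C * w \<le> C * (1 / C)" using C by (intro mult_left_mono) (auto simp: w_def)
    then show "C * w \<le> 1" using C by simp
    have "D * w \<le> D * (\<mu>0 / (4 * D))" using D(1) by (intro mult_left_mono) (auto simp: w_def)
    then show "D * w \<le> \<mu>0 / 4" using D(1) by simp
  qed
  \<comment> \<open>With \<open>4 * C * \<epsilon> = w\<close> the two points of the maximum are
    within w, and the doubled momentum \<open>(x - y) / \<epsilon>\<close> is at most
    \<open>4 * C\<close>.\<close>
  define \<epsilon> where "\<epsilon> = w / (4 * C)"
  have \<epsilon>: "\<epsilon> > 0" "4 * C * \<epsilon> = w" using w(1) C by (auto simp: \<epsilon>_def)
  define \<Phi> where "\<Phi> z = U (fst (fst z)) (snd (fst z)) - V (fst (snd z)) (snd (snd z))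
      - ((fst (fst z) - fst (snd z))\<^sup>2 + (snd (fst z) - snd (snd z))\<^sup>2) / (2 * \<epsilon>)
      - \<beta> * (snd (fst z) - x0)\<^sup>2 - \<rho> (fst (fst z))" for z :: "(real \<times> real) \<times> (real \<times> real)"
  define S :: "((real \<times> real) \<times> (real \<times> real)) set" where "S = ({0..\<tau>} \<times> UNIV) \<times> ({0..\<tau>} \<times> UNIV)"
  define z0 where "z0 = ((t0, x0), (t0, x0))"
  have z0S: "z0 \<in> S" using t0 by (simp add: S_def z0_def \<tau>_def)
  have \<Phi>z0: "\<Phi> z0 = \<sigma> / 2" by (simp add: \<Phi>_def z0_def \<rho>_def \<sigma>_def field_simps)
  have cF: "continuous_on ({0..\<tau>} \<times> UNIV) (\<lambda>z. F (fst z) (snd z))" if vs: "HJ_visc_sol H Uo F" for F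
  proof -
    obtain C where "C-lipschitz_on ({0..\<tau>} \<times> UNIV) (\<lambda>(t, x). F t x)"
      using vs \<tau> unfolding HJ_visc_sol_def by blast
    then show ?thesis by (auto dest: lipschitz_on_continuous_on simp: case_prod_unfold)
  qed
  have cont: "continuous_on S \<Phi>"
  proof -
    have "continuous_on S (\<lambda>z. U (fst (fst z)) (snd (fst z)))"
      by (rule continuous_on_compose2[OF cF[OF U]]) (auto intro!: continuous_intros simp: S_def)
    moreover have "continuous_on S (\<lambda>z. V (fst (snd z)) (snd (snd z)))"
      by (rule continuous_on_compose2[OF cF[OF V]]) (auto intro!: continuous_intros simp: S_def)
    ultimately show ?thesis unfolding \<Phi>_def \<rho>_def using \<epsilon>(1) by (intro continuous_intros) auto
  qed
  define A where "A = M + C * \<tau> + C\<^sup>2 * \<epsilon> / 2"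
  have A: "A > 0" using M C \<tau> \<epsilon>(1) by (simp add: A_def add_pos_pos)
  \<comment> \<open>Outside \<open>K\<close> the function \<open>\<Phi>\<close> is not positive:
    either x is so far from x0 that the \<open>\<beta>\<close> penalty wins, or x is near and y is
    not, so that \<open>\<bar>x - y\<bar> \<ge> r\<close> and the doubling term wins.\<close>
  define r where "r = 2 * \<epsilon> * (C + M + C * \<tau>) + 1 + A / \<beta>"
  have r: "r \<ge> 1" "r \<ge> 2 * \<epsilon> * (C + M + C * \<tau>)" "r \<ge> A / \<beta>"
    using M C \<tau> \<epsilon>(1) A \<beta>(1) by (auto simp: r_def)
  define K where "K = ({0..\<tau>} \<times> {x0 - r..x0 + r}) \<times> ({0..\<tau>} \<times> {x0 - 2 * r..x0 + 2 * r})"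
  have KS: "compact K" "K \<subseteq> S" unfolding K_def S_def by (intro compact_Times compact_Icc, auto)
  have out: "\<Phi> z < \<Phi> z0" if "z \<in> S - K" for z
  proof -
    obtain t x s y where z: "z = ((t, x), (s, y))" by (metis surj_pair)
    have ts: "t \<in> {0..\<tau>}" "s \<in> {0..\<tau>}" using that by (auto simp: S_def z)
    define b where "b = \<bar>x - y\<bar>"
    have b0: "b \<ge> 0" by (simp add: b_def)
    have "C * \<bar>t - s\<bar> \<le> C * \<tau>" using ts C by (intro mult_left_mono) auto
    then have "U t x - V s y \<le> M + C * \<tau> + C * b" using UV[OF ts, of x y] by (simp add: b_def algebra_simps)
    moreover have "((t - s)\<^sup>2 + (x - y)\<^sup>2) / (2 * \<epsilon>) \<ge> b\<^sup>2 / (2 * \<epsilon>)"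
      using \<epsilon>(1) by (intro divide_right_mono) (auto simp: b_def)
    ultimately have \<Phi>: "\<Phi> z \<le> M + C * \<tau> + C * b - b\<^sup>2 / (2 * \<epsilon>) - \<beta> * (x - x0)\<^sup>2"
      using \<rho>0[of t] unfolding \<Phi>_def z by simp
    have "x \<notin> {x0 - r..x0 + r} \<or> (x \<in> {x0 - r..x0 + r} \<and> y \<notin> {x0 - 2 * r..x0 + 2 * r})" using that ts by (auto simp: S_def K_def z)
    then have "\<Phi> z \<le> 0"
    proof
      assume "x \<notin> {x0 - r..x0 + r}"
      then have xr: "\<bar>x - x0\<bar> \<ge> r" by auto
      have "0 \<le> (b - C * \<epsilon>)\<^sup>2 / (2 * \<epsilon>)" using \<epsilon>(1) by simp
      also have "(b - C * \<epsilon>)\<^sup>2 / (2 * \<epsilon>) = b\<^sup>2 / (2 * \<epsilon>) - C * b + C\<^sup>2 * \<epsilon> / 2"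
        using \<epsilon>(1) by (simp add: power2_eq_square field_simps)
      finally have "C * b - b\<^sup>2 / (2 * \<epsilon>) \<le> C\<^sup>2 * \<epsilon> / 2" by simp
      moreover have "A \<le> \<beta> * (x - x0)\<^sup>2"
      proof -
        have "A = \<beta> * (A / \<beta>)" using \<beta>(1) by simp
        also have "\<dots> \<le> \<beta> * (\<bar>x - x0\<bar> * 1)" using r(3) xr \<beta>(1) by (intro mult_left_mono) auto
        also have "\<dots> \<le> \<beta> * (\<bar>x - x0\<bar> * \<bar>x - x0\<bar>)" using r(1) xr \<beta>(1) by (intro mult_left_mono) auto
        finally show ?thesis by (simp add: power2_eq_square)
      qed
      ultimately show "\<Phi> z \<le> 0" using \<Phi> unfolding A_def by linarith
    next
      assume "x \<in> {x0 - r..x0 + r} \<and> y \<notin> {x0 - 2 * r..x0 + 2 * r}"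
      then have br: "b \<ge> r" by (auto simp: b_def)
      have "C * b + (M + C * \<tau>) * 1 \<le> C * b + (M + C * \<tau>) * b"
        using br r(1) M C \<tau> by (intro add_left_mono mult_left_mono) auto
      also have "\<dots> = b * (C + M + C * \<tau>)" by (simp add: algebra_simps)
      also have "\<dots> \<le> b * (b / (2 * \<epsilon>))"
        using br r(2) b0 \<epsilon>(1) by (intro mult_left_mono) (auto simp: field_simps)
      also have "\<dots> = b\<^sup>2 / (2 * \<epsilon>)" by (simp add: power2_eq_square)
      finally have "C * b + (M + C * \<tau>) - b\<^sup>2 / (2 * \<epsilon>) \<le> 0" by simp
      moreover have "0 \<le> \<beta> * (x - x0)\<^sup>2" using \<beta>(1) by simp
      ultimately show "\<Phi> z \<le> 0" using \<Phi> by linarith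
    qed
    then show ?thesis using \<Phi>z0 \<sigma> by simp
  qed
  obtain zm where zm: "zm \<in> S" "\<And>z. z \<in> S \<Longrightarrow> \<Phi> z \<le> \<Phi> zm"
    using exists_max_of_compact[OF KS cont z0S out] by blast
  obtain t x s y where z: "zm = ((t, x), (s, y))" by (metis surj_pair)
  have ts: "t \<in> {0..\<tau>}" "s \<in> {0..\<tau>}" using zm(1) by (auto simp: S_def z)
  have \<Phi>m: "\<Phi> zm \<ge> \<sigma> / 2" using zm(2)[OF z0S] \<Phi>z0 by simp
  define d where "d = \<bar>t - s\<bar> + \<bar>x - y\<bar>"
  have d: "d \<le> w"
  proof -
    \<comment> \<open>Against the diagonal point only V and the doubling term change, so the latter
      is at most \<open>C * d\<close>.\<close>
    have "((t, x), (t, x)) \<in> S" using ts by (simp add: S_def)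
    from zm(2)[OF this] have "((t - s)\<^sup>2 + (x - y)\<^sup>2) / (2 * \<epsilon>) \<le> V t x - V s y" unfolding \<Phi>_def z by simp
    also have "\<dots> \<le> C * d" using LV[OF ts, of x y] by (simp add: d_def abs_le_iff)
    finally have a: "(t - s)\<^sup>2 + (x - y)\<^sup>2 \<le> C * d * (2 * \<epsilon>)" using \<epsilon>(1) by (simp add: field_simps)
    have "d\<^sup>2 \<le> 2 * ((t - s)\<^sup>2 + (x - y)\<^sup>2)"
    proof -
      have "(a + b)\<^sup>2 \<le> 2 * (a\<^sup>2 + b\<^sup>2)" for a b :: real
        using sum_squares_bound[of a b] by (simp add: power2_sum)
      from this[of "\<bar>t - s\<bar>" "\<bar>x - y\<bar>"] show ?thesis unfolding d_def power2_abs .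
    qed
    also have "\<dots> \<le> 2 * (C * d * (2 * \<epsilon>))" using a by (intro mult_left_mono) auto
    finally have "d * d \<le> w * d" unfolding \<epsilon>(2)[symmetric] by (simp add: power2_eq_square mult_ac)
    then show ?thesis using w(1) by (cases "d > 0") auto
  qed
  have Cd: "C * d \<le> C * w" using d C by (intro mult_left_mono) auto
  have gap: "\<beta> * (x - x0)\<^sup>2 + \<rho> t + \<sigma> / 2 \<le> U t x - V s y"
  proof -
    define Q where "Q = ((t - s)\<^sup>2 + (x - y)\<^sup>2) / (2 * \<epsilon>)"
    have "Q \<ge> 0" using \<epsilon>(1) by (simp add: Q_def)
    moreover have "\<Phi> zm = U t x - V s y - Q - \<beta> * (x - x0)\<^sup>2 - \<rho> t" by (simp add: \<Phi>_def z Q_def)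
    ultimately show ?thesis using \<Phi>m by linarith
  qed
  have UVm: "U t x - V s y \<le> M + 1" using UV[OF ts, of x y] Cd w(4) by (simp add: d_def)
  have \<beta>x0: "0 \<le> \<beta> * (x - x0)\<^sup>2" using \<beta>(1) by simp
  have "\<not> t \<ge> t0 + 1 / 2"
  proof
    assume "t \<ge> t0 + 1 / 2"
    from \<rho>big[OF this] show False using gap UVm \<beta>x0 \<sigma> by linarith
  qed
  then have t1: "t < \<tau>" "s < \<tau>" using d w(2) unfolding d_def \<tau>_def by linarith+
  \<comment> \<open>At time 0 both solutions equal the datum, so the difference at the doubled
    points is at most \<open>C * w \<le> \<sigma> / 4\<close>, below the gap.\<close>
  have tpos: "t > 0"
  proof (rule ccontr)
    assume "\<not> t > 0"
    then have "t = 0" using ts by simp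
    then have "U t x - V s y = V t x - V s y" using UV0 by simp
    then have "U t x - V s y \<le> \<sigma> / 4" using LV[OF ts, of x y] Cd w(3) by (simp add: d_def abs_le_iff)
    then show False using gap \<beta>x0 \<rho>0[of t] \<sigma> by linarith
  qed
  have spos: "s > 0"
  proof (rule ccontr)
    assume "\<not> s > 0"
    then have "s = 0" using ts by simp
    then have "U t x - V s y = U t x - U s y" using UV0 by simp
    then have "U t x - V s y \<le> \<sigma> / 4" using LU[OF ts, of x y] Cd w(3) by (simp add: d_def abs_le_iff)
    then show False using gap \<beta>x0 \<rho>0[of t] \<sigma> by linarith
  qed
  \<comment> \<open>Each test function freezes one of the doubled points. The doubling term gives
    both the same time derivative, which cancels, and the same momentum \<open>p\<close>.\<close>
  define \<phi> where "\<phi> z = ((fst z - s)\<^sup>2 / (2 * \<epsilon>) + \<rho> (fst z)) + ((snd z - y)\<^sup>2 / (2 * \<epsilon>) + \<beta> * (snd z - x0)\<^sup>2)"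
    for z :: "real \<times> real"
  define \<psi> where "\<psi> z = - ((t - fst z)\<^sup>2 / (2 * \<epsilon>)) + - ((x - snd z)\<^sup>2 / (2 * \<epsilon>))" for z :: "real \<times> real"
  have \<phi>: "test_C1 \<phi>" "pdt \<phi> (t, x) = (t - s) / \<epsilon> + \<rho>' t" "pdx \<phi> (t, x) = (x - y) / \<epsilon> + 2 * \<beta> * (x - x0)"
  proof -
    have d: "((\<lambda>r. (r - s)\<^sup>2 / (2 * \<epsilon>) + \<rho> r) has_real_derivative (r - s) / \<epsilon> + \<rho>' r) (at r)"
      "((\<lambda>r. (r - y)\<^sup>2 / (2 * \<epsilon>) + \<beta> * (r - x0)\<^sup>2) has_real_derivative (r - y) / \<epsilon> + 2 * \<beta> * (r - x0)) (at r)" for r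
      using \<epsilon>(1) by (auto intro!: derivative_eq_intros d\<rho> simp: field_simps)
    have c: "continuous_on UNIV (\<lambda>r. (r - s) / \<epsilon> + \<rho>' r)" "continuous_on UNIV (\<lambda>r. (r - y) / \<epsilon> + 2 * \<beta> * (r - x0))"
      unfolding \<rho>'_def using \<epsilon>(1) by (auto intro!: continuous_intros)
    from separated_test_C1[OF d c] show "test_C1 \<phi>" "pdt \<phi> (t, x) = (t - s) / \<epsilon> + \<rho>' t"
      "pdx \<phi> (t, x) = (x - y) / \<epsilon> + 2 * \<beta> * (x - x0)" unfolding \<phi>_def[abs_def] by blast+
  qed
  have \<psi>: "test_C1 \<psi>" "pdt \<psi> (s, y) = (t - s) / \<epsilon>" "pdx \<psi> (s, y) = (x - y) / \<epsilon>"
  proof -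
    have d: "((\<lambda>r. - ((a - r)\<^sup>2 / (2 * \<epsilon>))) has_real_derivative (a - r) / \<epsilon>) (at r)" for a r
      using \<epsilon>(1) by (auto intro!: derivative_eq_intros simp: field_simps)
    have c: "continuous_on UNIV (\<lambda>r. (a - r) / \<epsilon>)" for a
      using \<epsilon>(1) by (auto intro!: continuous_intros)
    from separated_test_C1[OF d d c c] show "test_C1 \<psi>" "pdt \<psi> (s, y) = (t - s) / \<epsilon>" "pdx \<psi> (s, y) = (x - y) / \<epsilon>"
      unfolding \<psi>_def[abs_def] by blast+
  qed
  define p where "p = (x - y) / \<epsilon>"
  have sub: "((t - s) / \<epsilon> + \<rho>' t) + H x (p + 2 * \<beta> * (x - x0)) \<le> 0"
  proof -
    have "\<exists>e>0. \<forall>z\<in>ball (t, x) e. U (fst z) (snd z) - \<phi> z \<le> U t x - \<phi> (t, x)"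
    proof (intro exI[of _ "min t (\<tau> - t)"] conjI ballI)
      show "min t (\<tau> - t) > 0" using tpos t1 by simp
      fix z assume "z \<in> ball (t, x) (min t (\<tau> - t))"
      then have "\<bar>t - fst z\<bar> < min t (\<tau> - t)"
        using dist_fst_le[of "(t, x)" z] by (simp add: dist_real_def)
      then have "(z, (s, y)) \<in> S" using ts by (auto simp: S_def mem_Times_iff abs_if split: if_splits)
      from zm(2)[OF this] show "U (fst z) (snd z) - \<phi> z \<le> U t x - \<phi> (t, x)"
        unfolding \<Phi>_def z \<phi>_def add_divide_distrib by simp
    qed
    with U tpos \<phi>(1) have "pdt \<phi> (t, x) + H x (pdx \<phi> (t, x)) \<le> 0" unfolding HJ_visc_sol_def by blast
    then show ?thesis using \<phi>(2,3) by (simp add: p_def)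
  qed
  have sup: "(t - s) / \<epsilon> + H y p \<ge> 0"
  proof -
    have "\<exists>e>0. \<forall>z\<in>ball (s, y) e. V (fst z) (snd z) - \<psi> z \<ge> V s y - \<psi> (s, y)"
    proof (intro exI[of _ "min s (\<tau> - s)"] conjI ballI)
      show "min s (\<tau> - s) > 0" using spos t1 by simp
      fix z assume "z \<in> ball (s, y) (min s (\<tau> - s))"
      then have "\<bar>s - fst z\<bar> < min s (\<tau> - s)"
        using dist_fst_le[of "(s, y)" z] by (simp add: dist_real_def)
      then have "((t, x), z) \<in> S" using ts by (auto simp: S_def mem_Times_iff abs_if split: if_splits)
      from zm(2)[OF this] show "V (fst z) (snd z) - \<psi> z \<ge> V s y - \<psi> (s, y)"
        unfolding \<Phi>_def z \<psi>_def add_divide_distrib by simp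
    qed
    with V spos \<psi>(1) have "pdt \<psi> (s, y) + H y (pdx \<psi> (s, y)) \<ge> 0" unfolding HJ_visc_sol_def by blast
    then show ?thesis using \<psi>(2,3) by (simp add: p_def)
  qed
  have xy: "\<bar>x - y\<bar> \<le> w" using d by (simp add: d_def)
  have p: "\<bar>p\<bar> \<le> 4 * C"
    unfolding p_def using xy \<epsilon> by (simp add: field_simps)
  have bx: "\<bar>2 * \<beta> * (x - x0)\<bar> \<le> \<kappa>"
  proof (rule power2_le_imp_le)
    have "\<beta> * (x - x0)\<^sup>2 \<le> M + 1" using gap UVm \<rho>0[of t] \<sigma> by linarith
    then have "4 * \<beta> * (\<beta> * (x - x0)\<^sup>2) \<le> 4 * \<beta> * (M + 1)" using \<beta>(1) by (intro mult_left_mono) auto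
    then show "\<bar>2 * \<beta> * (x - x0)\<bar>\<^sup>2 \<le> \<kappa>\<^sup>2" unfolding \<beta>(2) power2_abs power_mult_distrib by (simp add: power2_eq_square[of \<beta>] mult.assoc)
  qed (use \<kappa> in simp)
  have "\<bar>H y p - H x (p + 2 * \<beta> * (x - x0))\<bar> \<le> D * (\<bar>y - x\<bar> + \<bar>p - (p + 2 * \<beta> * (x - x0))\<bar>)"
    by (rule D(2)) (use p bx \<kappa>(2) in linarith)+
  also have "\<dots> \<le> D * (w + \<kappa>)" using D(1) xy bx by (intro mult_left_mono) (auto simp: abs_minus_commute)
  also have "\<dots> \<le> \<mu>0 / 2" using w(5) \<kappa>(3) by (simp add: distrib_left)
  \<comment> \<open>Subtracting the two inequalities bounds the penalty slope by the difference of
    Hamiltonians, hence by half of its own minimum.\<close>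
  finally have "\<rho>' t \<le> \<mu>0 / 2" using sub sup by linarith
  then show False using \<mu>\<rho>[of t] tpos \<mu>0 by simp
qed

lemma visc_unique:
  assumes "HJ_visc_sol H Uo U" "HJ_visc_sol H Uo V" "t > 0"
  shows "U t = V t"
  using visc_comparison[OF assms] visc_comparison[OF assms(2,1,3)] by (intro ext antisym)

end

lemma (in cauchy) SHJ_eq_u:
  assumes "t > 0" shows "SHJ H t Uo = u t"
  unfolding SHJ_def
proof (rule the_equality)
  show "\<exists>U. HJ_visc_sol H Uo U \<and> u t = U t" using u_visc_sol by blast
  show "V = u t" if "\<exists>U. HJ_visc_sol H Uo U \<and> V = U t" for V
    using that visc_unique[OF _ u_visc_sol assms] by blast
qed

section \<open>Time reversal and the reachable profiles\<close>

lemma integral_reverse: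
  fixes f :: "real \<Rightarrow> real"
  assumes "f integrable_on {0..T}"
  shows "integral {0..T} (\<lambda>s. f (T - s)) = integral {0..T} f"
proof -
  have "(f has_integral integral {0..T} f) (cbox 0 T)" using assms by auto
  from has_integral_affinity[OF this, of "-1" T]
  have "((\<lambda>s. f (T - s)) has_integral integral {0..T} f) ((\<lambda>x. T - x) ` {0..T})" by simp
  moreover have "(\<lambda>x. T - x) ` {0..T} = {0..T}"
  proof (intro equalityI subsetI)
    fix x assume "x \<in> {0..T}"
    then show "x \<in> (\<lambda>x. T - x) ` {0..T}" by (intro image_eqI[of _ _ "T - x"]) auto
  qed auto
  ultimately show ?thesis by (simp add: integral_unique)
qed

text \<open>\<open>C1_differentiable_on\<close> asks for two-sided derivatives also at 0 and T,
  whereas \<open>HS_sol\<close> uses derivatives within [0, T]. Extending the derivative by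
  constants and integrating bridges the two.\<close>

lemma C1_extension:
  fixes f :: "real \<Rightarrow> real"
  assumes T: "T > 0" and f: "\<And>t. t \<in> {0..T} \<Longrightarrow> (f has_real_derivative f' t) (at t within {0..T})"
    and c: "continuous_on {0..T} f'"
  obtains g where "\<And>t. t \<in> {0..T} \<Longrightarrow> g t = f t" "g C1_differentiable_on {0..T}"
proof -
  define k where "k s = f' (max 0 (min T s))" for s
  \<comment> \<open>Starting the integral at -1 makes 0 an interior point.\<close>
  define G where "G t = integral {-1..t} k" for t
  have ck: "continuous_on {-1..T + 1} k" unfolding k_def
    by (rule continuous_on_compose2[OF c]) (use T in \<open>auto intro!: continuous_intros\<close>)
  have dG: "(G has_real_derivative f' t) (at t)" if t: "t \<in> {0..T}" for t
  proof -
    have "(G has_real_derivative k t) (at t within {-1..T + 1})"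
      unfolding G_def by (rule integral_has_real_derivative[OF ck]) (use t in auto)
    moreover have "at t within {-1..T + 1} = at t" by (rule at_within_interior) (use t in auto)
    moreover have "k t = f' t" using t by (simp add: k_def)
    ultimately show ?thesis by simp
  qed
  have "\<exists>c. \<forall>t\<in>{0..T}. f t - G t = c"
  proof (rule has_field_derivative_zero_constant)
    fix t assume "t \<in> {0..T}"
    from DERIV_diff[OF f[OF this] has_field_derivative_at_within[OF dG[OF this]]]
    show "((\<lambda>t. f t - G t) has_real_derivative 0) (at t within {0..T})" by simp
  qed simp
  then obtain c0 where c0: "\<And>t. t \<in> {0..T} \<Longrightarrow> f t - G t = c0" by blast
  show ?thesis
  proof (rule that[of "\<lambda>t. G t + c0"])
    show "G t + c0 = f t" if "t \<in> {0..T}" for t using c0[OF that] by simp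
    show "(\<lambda>t. G t + c0) C1_differentiable_on {0..T}" unfolding C1_differentiable_on_def
    proof (intro exI[of _ f'] conjI ballI c)
      fix t assume "t \<in> {0..T}"
      from DERIV_add[OF dG[OF this] DERIV_const[of c0]]
      show "((\<lambda>t. G t + c0) has_vector_derivative f' t) (at t)"
        by (simp add: has_real_derivative_iff_has_vector_derivative)
    qed
  qed
qed

context ham begin

lemma action_HSab:
  assumes "T > 0" "HSab 0 T q p"
  shows "action H T q = integral {0..T} (\<lambda>s. ell (q s) (p s))"
  unfolding action_def
proof (rule integral_cong)
  fix s assume s: "s \<in> {0..T}"
  have "vector_derivative q (at s within {0..T}) = Hp (q s) (p s)"
    by (rule vector_derivative_within_closed_interval)
      (use assms s in \<open>auto simp: HSab_def has_real_derivative_iff_has_vector_derivative\<close>)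
  then show "Lag H (q s) (vector_derivative q (at s within {0..T})) = ell (q s) (p s)" by (simp add: Lag_Hp)
qed

lemma RT_HSab: "q \<in> RT H T \<Longrightarrow> \<exists>p. HSab 0 T q p"
  unfolding RT_def HS_sol_iff by blast

text \<open>Membership in \<open>RT\<close> depends on values outside [0, T], so the extremal is
  replaced by an extension of its restriction; end points and action are unaffected.\<close>

lemma HSab_RT:
  assumes T: "T > 0" and HS: "HSab 0 T q p"
  shows "\<exists>q'\<in>RT H T. q' 0 = q 0 \<and> q' T = q T \<and> action H T q' = integral {0..T} (\<lambda>s. ell (q s) (p s))"
proof -
  note c = HSab_continuous[OF HS]
  have d: "(q has_real_derivative Hp (q t) (p t)) (at t within {0..T})"
    "(p has_real_derivative - Hx (q t) (p t)) (at t within {0..T})" if "t \<in> {0..T}" for t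
    using HS that unfolding HSab_def by auto
  obtain q' where q': "\<And>t. t \<in> {0..T} \<Longrightarrow> q' t = q t" "q' C1_differentiable_on {0..T}"
    by (rule C1_extension[OF T d(1)]) (auto intro!: continuous_intros c)
  obtain p' where p': "\<And>t. t \<in> {0..T} \<Longrightarrow> p' t = p t" "p' C1_differentiable_on {0..T}"
    by (rule C1_extension[OF T d(2)]) (auto intro!: continuous_intros c)
  have HS': "HSab 0 T q' p'"
    unfolding HSab_def
  proof (intro ballI conjI)
    fix t assume t: "t \<in> {0..T}"
    show "(q' has_real_derivative Hp (q' t) (p' t)) (at t within {0..T})"
      unfolding q'(1)[OF t] p'(1)[OF t]
      by (rule has_field_derivative_transform_within[OF d(1)[OF t] zero_less_one t]) (simp add: q'(1))
    show "(p' has_real_derivative - Hx (q' t) (p' t)) (at t within {0..T})"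
      unfolding q'(1)[OF t] p'(1)[OF t]
      by (rule has_field_derivative_transform_within[OF d(2)[OF t] zero_less_one t]) (simp add: p'(1))
  qed
  have "action H T q' = integral {0..T} (\<lambda>s. ell (q s) (p s))"
    unfolding action_HSab[OF T HS'] by (rule integral_cong) (simp add: q'(1) p'(1))
  then show ?thesis
    using HS' q' p' T unfolding RT_def HS_sol_iff by (intro bexI[of _ q']) auto
qed

lemma rev_partials:
  "dHx (\<lambda>x p. H x (- p)) x p = Hx x (- p)" "dHp (\<lambda>x p. H x (- p)) x p = - Hp x (- p)"
proof -
  show "dHx (\<lambda>x p. H x (- p)) x p = Hx x (- p)" unfolding dHx_def ..
  have "((\<lambda>r. H x (- r)) has_real_derivative Hp x (- p) * (- 1)) (at p)"
    by (rule DERIV_chain2[where f="H x"]) (auto intro!: H_dp derivative_eq_intros)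
  then show "dHp (\<lambda>x p. H x (- p)) x p = - Hp x (- p)"
    unfolding dHp_def[of "\<lambda>x p. H x (- p)"] using DERIV_imp_deriv by fastforce
qed

lemma ham_rev: "ham (\<lambda>x p. H x (- p))"
proof (unfold_locales, unfold rev_partials)
  show "((\<lambda>z. H (fst z) (- snd z)) has_derivative (\<lambda>h. Hx x (- p) * fst h + - Hp x (- p) * snd h)) (at (x, p))" for x p
  proof -
    have a: "((\<lambda>z::real \<times> real. (fst z, - snd z)) has_derivative (\<lambda>h. (fst h, - snd h))) (at (x, p))"
      by (auto intro!: derivative_eq_intros)
    have b: "((\<lambda>z. H (fst z) (snd z)) has_derivative (\<lambda>h. Hx x (- p) * fst h + Hp x (- p) * snd h))
        (at (fst (x, p), - snd (x, p)))"
      using joint[of x "- p"] by simp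
    from has_derivative_compose[OF a b] show ?thesis by simp
  qed
  fix B :: real
  show "\<exists>D. \<forall>x p. \<bar>p\<bar> \<le> B \<longrightarrow> \<bar>H x (- p)\<bar> \<le> D \<and> \<bar>Hx x (- p)\<bar> \<le> D \<and> \<bar>- Hp x (- p)\<bar> \<le> D"
  proof -
    obtain D where "\<forall>x p. \<bar>p\<bar> \<le> B \<longrightarrow> \<bar>H x p\<bar> \<le> D \<and> \<bar>Hx x p\<bar> \<le> D \<and> \<bar>Hp x p\<bar> \<le> D" using bnd by blast
    then show ?thesis by (intro exI[of _ D]) simp
  qed
  show "\<exists>D. \<forall>x p y r. \<bar>p\<bar> \<le> B \<longrightarrow> \<bar>r\<bar> \<le> B \<longrightarrow>
      \<bar>Hx x (- p) - Hx y (- r)\<bar> \<le> D * (\<bar>x - y\<bar> + \<bar>p - r\<bar>) \<and>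
      \<bar>- Hp x (- p) - - Hp y (- r)\<bar> \<le> D * (\<bar>x - y\<bar> + \<bar>p - r\<bar>)"
  proof -
    obtain D where D: "\<forall>x p y r. \<bar>p\<bar> \<le> B \<longrightarrow> \<bar>r\<bar> \<le> B \<longrightarrow>
        \<bar>Hx x p - Hx y r\<bar> \<le> D * (\<bar>x - y\<bar> + \<bar>p - r\<bar>) \<and>
        \<bar>Hp x p - Hp y r\<bar> \<le> D * (\<bar>x - y\<bar> + \<bar>p - r\<bar>)" using lip by blast
    show ?thesis
    proof (intro exI[of _ D] allI impI)
      fix x p y r :: real assume "\<bar>p\<bar> \<le> B" "\<bar>r\<bar> \<le> B"
      then show "\<bar>Hx x (- p) - Hx y (- r)\<bar> \<le> D * (\<bar>x - y\<bar> + \<bar>p - r\<bar>) \<and>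
        \<bar>- Hp x (- p) - - Hp y (- r)\<bar> \<le> D * (\<bar>x - y\<bar> + \<bar>p - r\<bar>)"
        using D[rule_format, of "- p" "- r" x y] by (simp add: abs_minus_commute)
    qed
  qed
  show "\<exists>c>0. \<forall>x p r. \<bar>p\<bar> \<le> B \<longrightarrow> \<bar>r\<bar> \<le> B \<longrightarrow> p \<le> r \<longrightarrow> c * (r - p) \<le> - Hp x (- r) - - Hp x (- p)"
  proof -
    obtain c where c: "c > 0" "\<forall>x p r. \<bar>p\<bar> \<le> B \<longrightarrow> \<bar>r\<bar> \<le> B \<longrightarrow> p \<le> r \<longrightarrow> c * (r - p) \<le> Hp x r - Hp x p"
      using umono by blast
    show ?thesis
    proof (intro exI[of _ c] conjI allI impI c(1))
      fix x p r :: real assume "\<bar>p\<bar> \<le> B" "\<bar>r\<bar> \<le> B" "p \<le> r"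
      then show "c * (r - p) \<le> - Hp x (- r) - - Hp x (- p)" using c(2)[rule_format, of "- r" "- p" x] by simp
    qed
  qed
  show "\<exists>r>0. \<forall>x. B < - Hp x (- r) \<and> - Hp x (- (- r)) < - B"
  proof -
    obtain r where r: "r > 0" "\<And>x. Hp x r > B \<and> Hp x (- r) < - B" using coer by blast
    have "B < - Hp x (- r) \<and> - Hp x (- (- r)) < - B" for x using r(2)[of x] by auto
    with r(1) show ?thesis by blast
  qed
qed

end

section \<open>The terminal value problem and the set \<open>Gset\<close>\<close>

locale terminal_problem = ham +
  fixes W :: "real \<Rightarrow> real" and K T :: real
  assumes W_lip: "\<And>x y. \<bar>W x - W y\<bar> \<le> K * \<bar>x - y\<bar>" and T_pos: "T > 0"

text \<open>Reversing time turns the maximization defining \<^const>\<open>Uostar\<close> into the minimization problem for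
  the Hamiltonian \<open>H(x, -p)\<close> with datum \<open>-W\<close>.\<close>

sublocale terminal_problem \<subseteq> rev: cauchy "\<lambda>x p. H x (- p)" "\<lambda>x. - W x" K
proof (rule cauchy.intro[OF ham_rev], unfold_locales)
  show "\<bar>- W x - - W y\<bar> \<le> K * \<bar>x - y\<bar>" for x y using W_lip[of x y] by (simp add: abs_minus_commute)
qed

context terminal_problem begin

lemma rev_ell: "rev.ell x p = ell x (- p)"
  unfolding rev.ell_def ell_def rev_partials by simp

lemma rev_HSab_iff: "rev.HSab 0 T q p \<longleftrightarrow> HSab 0 T (\<lambda>t. q (T - t)) (\<lambda>t. - p (T - t))"
proof -
  have shift: "((\<lambda>t. f (T - t)) has_real_derivative - D) (at t within {0..T})"
    if "(f has_real_derivative D) (at (T - t) within {0..T})" "t \<in> {0..T}" for f D t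
  proof -
    have "(f has_real_derivative D) (at (T - t) within (\<lambda>t. T - t) ` {0..T})"
      by (rule has_field_derivative_subset[OF that(1)]) auto
    moreover have "((\<lambda>t. T - t) has_real_derivative - 1) (at t within {0..T})" by (auto intro!: derivative_eq_intros)
    ultimately have "(f \<circ> (\<lambda>t. T - t) has_real_derivative D * - 1) (at t within {0..T})" by (rule DERIV_image_chain)
    then show ?thesis by (simp add: o_def)
  qed
  have in0: "T - t \<in> {0..T}" if "t \<in> {0..T}" for t using that by auto
  show ?thesis
  proof
    assume "rev.HSab 0 T q p"
    then have *: "(q has_real_derivative - Hp (q t) (- p t)) (at t within {0..T})"
      "(p has_real_derivative - Hx (q t) (- p t)) (at t within {0..T})" if "t \<in> {0..T}" for t
      using that unfolding rev.HSab_def rev_partials by auto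
    show "HSab 0 T (\<lambda>t. q (T - t)) (\<lambda>t. - p (T - t))" unfolding HSab_def
    proof (intro ballI conjI)
      fix t assume t: "t \<in> {0..T}"
      show "((\<lambda>t. q (T - t)) has_real_derivative Hp (q (T - t)) (- p (T - t))) (at t within {0..T})"
        using shift[OF *(1)[OF in0[OF t]] t] by simp
      show "((\<lambda>t. - p (T - t)) has_real_derivative - Hx (q (T - t)) (- p (T - t))) (at t within {0..T})"
        using DERIV_minus[OF shift[OF *(2)[OF in0[OF t]] t]] by simp
    qed
  next
    assume "HSab 0 T (\<lambda>t. q (T - t)) (\<lambda>t. - p (T - t))"
    then have *: "((\<lambda>t. q (T - t)) has_real_derivative Hp (q (T - t)) (- p (T - t))) (at t within {0..T})"
      "((\<lambda>t. - p (T - t)) has_real_derivative - Hx (q (T - t)) (- p (T - t))) (at t within {0..T})" if "t \<in> {0..T}" for t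
      using that unfolding HSab_def by auto
    show "rev.HSab 0 T q p" unfolding rev.HSab_def rev_partials
    proof (intro ballI conjI)
      fix t assume t: "t \<in> {0..T}"
      show "(q has_real_derivative - Hp (q t) (- p t)) (at t within {0..T})"
        using shift[OF *(1)[OF in0[OF t]] t] by simp
      show "(p has_real_derivative - Hx (q t) (- p t)) (at t within {0..T})"
        using DERIV_minus[OF shift[OF *(2)[OF in0[OF t]] t]] by simp
    qed
  qed
qed

lemma rev_HSab: "HSab 0 T q p \<Longrightarrow> rev.HSab 0 T (\<lambda>t. q (T - t)) (\<lambda>t. - p (T - t))"
  unfolding rev_HSab_iff by simp

lemma rev_action:
  assumes "HSab 0 T q p"
  shows "integral {0..T} (\<lambda>s. rev.ell (q (T - s)) (- p (T - s))) = integral {0..T} (\<lambda>s. ell (q s) (p s))"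
  using integral_reverse[OF HSab_ell_integrable[OF assms]] by (simp add: rev_ell)

lemma rev_action':
  assumes "rev.HSab 0 T q p"
  shows "integral {0..T} (\<lambda>s. ell (q (T - s)) (- p (T - s))) = integral {0..T} (\<lambda>s. rev.ell (q s) (p s))"
  using rev_action[OF assms[unfolded rev_HSab_iff]] by simp

lemma rev_u_le:
  assumes "HSab 0 T q p"
  shows "W (q T) - integral {0..T} (\<lambda>s. ell (q s) (p s)) \<le> - rev.u T (q 0)"
proof -
  have "rev.u T (q (T - T)) \<le> - W (q (T - 0)) + integral {0..T} (\<lambda>s. rev.ell (q (T - s)) (- p (T - s)))"
    using rev.u_le[OF less_imp_le[OF T_pos] rev.HSab_C1c[OF rev_HSab[OF assms]]] unfolding rev.HSab_cost by simp
  then show ?thesis unfolding rev_action[OF assms] by simp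
qed

text \<open>The supremum runs over (HS) solutions only, the infimum in \<open>rev.u\<close> over all
  C1 curves; they match because the infimum is attained at an extremal.\<close>

lemma Uostar_eq: "Uostar H T W x = - rev.u T x"
  unfolding Uostar_def
proof (rule cSup_eq_maximum)
  obtain q p where m: "rev.Mini T x q p" using rev.Mini_exists[OF T_pos] by blast
  then have HS: "rev.HSab 0 T q p" and q: "q T = x"
    and u: "rev.u T x = - W (q 0) + integral {0..T} (\<lambda>s. rev.ell (q s) (p s))" by (auto simp: rev.Mini_def)
  obtain q' where q': "q' \<in> RT H T" "q' 0 = q (T - 0)" "q' T = q (T - T)"
    "action H T q' = integral {0..T} (\<lambda>s. ell (q (T - s)) (- p (T - s)))"
    using HSab_RT[OF T_pos HS[unfolded rev_HSab_iff]] by blast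
  then have "- rev.u T x = W (q' T) - action H T q'" "q' 0 = x"
    unfolding q'(4) rev_action'[OF HS] u using q by simp_all
  then show "- rev.u T x \<in> {W (q T) - action H T q |q. q \<in> RT H T \<and> q 0 = x}" using q'(1) by blast
next
  fix z assume "z \<in> {W (q T) - action H T q |q. q \<in> RT H T \<and> q 0 = x}"
  then obtain q where q: "z = W (q T) - action H T q" "q \<in> RT H T" "q 0 = x" by blast
  obtain p where HS: "HSab 0 T q p" using RT_HSab[OF q(2)] by blast
  show "z \<le> - rev.u T x" using rev_u_le[OF HS] unfolding q(1) action_HSab[OF T_pos HS] q(3) .
qed

lemma Uostar_lip: "\<exists>C. \<forall>x y. \<bar>Uostar H T W x - Uostar H T W y\<bar> \<le> C * \<bar>x - y\<bar>"
proof -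
  obtain C where "\<And>t x y. t \<ge> 0 \<Longrightarrow> \<bar>rev.u t x - rev.u t y\<bar> \<le> (K + 2 * rev.Rad + C * t) * \<bar>x - y\<bar>"
    by (rule rev.u_lipschitz_x) (rule that; assumption)
  from this[OF less_imp_le[OF T_pos]]
  have "\<bar>- rev.u T x - - rev.u T y\<bar> \<le> (K + 2 * rev.Rad + C * T) * \<bar>x - y\<bar>" for x y
    by (simp add: abs_minus_commute)
  then show ?thesis unfolding Uostar_eq by blast
qed

lemma Gset_iff: "(x, y) \<in> Gset H T W \<longleftrightarrow>
    (\<exists>q p. HSab 0 T q p \<and> q 0 = x \<and> q T = y \<and> Uostar H T W x = W y - integral {0..T} (\<lambda>s. ell (q s) (p s)))"
proof
  assume "(x, y) \<in> Gset H T W"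
  then obtain q where q: "q \<in> RT H T" "q 0 = x" "q T = y" "Uostar H T W x = W y - action H T q" unfolding Gset_def by blast
  obtain p where HS: "HSab 0 T q p" using RT_HSab[OF q(1)] by blast
  show "\<exists>q p. HSab 0 T q p \<and> q 0 = x \<and> q T = y \<and> Uostar H T W x = W y - integral {0..T} (\<lambda>s. ell (q s) (p s))"
    using HS q action_HSab[OF T_pos HS] by auto
next
  assume "\<exists>q p. HSab 0 T q p \<and> q 0 = x \<and> q T = y \<and> Uostar H T W x = W y - integral {0..T} (\<lambda>s. ell (q s) (p s))"
  then obtain q p where q: "HSab 0 T q p" "q 0 = x" "q T = y" "Uostar H T W x = W y - integral {0..T} (\<lambda>s. ell (q s) (p s))" by blast
  obtain q' where "q' \<in> RT H T" "q' 0 = x" "q' T = y" "action H T q' = integral {0..T} (\<lambda>s. ell (q s) (p s))"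
    using HSab_RT[OF T_pos q(1)] q(2,3) by blast
  then show "(x, y) \<in> Gset H T W" using q(4) unfolding Gset_def by auto
qed

lemma Gset_rev: "(x, y) \<in> Gset H T W \<longleftrightarrow> (\<exists>q p. rev.Mini T x q p \<and> q 0 = y)"
proof
  assume "(x, y) \<in> Gset H T W"
  then obtain q p where q: "HSab 0 T q p" "q 0 = x" "q T = y" "Uostar H T W x = W y - integral {0..T} (\<lambda>s. ell (q s) (p s))"
    unfolding Gset_iff by blast
  have "rev.Mini T x (\<lambda>t. q (T - t)) (\<lambda>t. - p (T - t))"
    unfolding rev.Mini_def rev_action[OF q(1)] using rev_HSab[OF q(1)] q(2-4) Uostar_eq[of x] by simp
  then show "\<exists>q p. rev.Mini T x q p \<and> q 0 = y" using q(3)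
    by (intro exI[of _ "\<lambda>t. q (T - t)"] exI[of _ "\<lambda>t. - p (T - t)"]) simp
next
  assume "\<exists>q p. rev.Mini T x q p \<and> q 0 = y"
  then obtain q p where q: "rev.Mini T x q p" "q 0 = y" by blast
  then have HS: "rev.HSab 0 T q p" by (simp add: rev.Mini_def)
  show "(x, y) \<in> Gset H T W" unfolding Gset_iff
    by (rule exI[of _ "\<lambda>t. q (T - t)"], rule exI[of _ "\<lambda>t. - p (T - t)"])
      (use HS[unfolded rev_HSab_iff] q rev_action'[OF HS] Uostar_eq[of x] in \<open>simp add: rev.Mini_def\<close>)
qed

lemma Gset_total: "\<exists>y. (x, y) \<in> Gset H T W"
  unfolding Gset_rev using rev.Mini_exists[OF T_pos] by blast

lemma Gset_near: "(x, y) \<in> Gset H T W \<Longrightarrow> \<bar>y - x\<bar> \<le> rev.Bd * T"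
  unfolding Gset_rev using rev.Mini_speed(1)[OF _ T_pos, of x _ _ T 0] T_pos
  by (force simp: rev.Mini_def)

lemma Gset_compact:
  assumes X: "X \<longlonglongrightarrow> x" and G: "\<And>n. (X n, Y n) \<in> Gset H T W"
  obtains r y where "strict_mono (r :: nat \<Rightarrow> nat)" "(x, y) \<in> Gset H T W" "(\<lambda>n. Y (r n)) \<longlonglongrightarrow> y"
proof -
  obtain q p where m: "\<And>n. rev.Mini T (X n) (q n) (p n)" and q0: "\<And>n. q n 0 = Y n"
    using G unfolding Gset_rev by metis
  obtain r qq pp where r: "strict_mono (r :: nat \<Rightarrow> nat)" and mm: "rev.Mini T x qq pp"
    and l: "\<And>s. s \<in> {0..T} \<Longrightarrow> (\<lambda>n. q (r n) s) \<longlonglongrightarrow> qq s"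
    by (rule rev.Mini_compact[OF T_pos X m]) (rule that; assumption)
  have "(\<lambda>n. Y (r n)) \<longlonglongrightarrow> qq 0" using l[of 0] T_pos by (simp add: q0)
  moreover have "(x, qq 0) \<in> Gset H T W" unfolding Gset_rev using mm by blast
  ultimately show ?thesis using r that by blast
qed

text \<open>A multivalued intermediate value theorem. At the supremum \<open>x\<close> of
  \<open>A\<close>, limits from within \<open>A\<close> and from the right of \<open>x\<close> give
  section values on both sides of y, and the section over \<open>x\<close> is an interval by
  assumption.\<close>

lemma Gset_onto:
  assumes convex: "\<And>x y' y'' y. (x, y') \<in> Gset H T W \<Longrightarrow> (x, y'') \<in> Gset H T W \<Longrightarrow> y \<in> {y'..y''} \<Longrightarrow> (x, y) \<in> Gset H T W"
  shows "\<exists>x. (x, y) \<in> Gset H T W"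
proof -
  define A where "A = {x. \<exists>y'\<le>y. (x, y') \<in> Gset H T W}"
  \<comment> \<open>Largest displacement in time T, by \<open>Gset_near\<close>: sections over y - M
    lie below y, and \<open>A\<close> is bounded by y + M.\<close>
  define M where "M = rev.Bd * T"
  have ne: "A \<noteq> {}"
  proof -
    obtain y' where "(y - M, y') \<in> Gset H T W" using Gset_total by blast
    moreover from Gset_near[OF this] have "y' \<le> y" by (simp add: M_def)
    ultimately show ?thesis unfolding A_def by blast
  qed
  have bdd: "bdd_above A"
  proof (rule bdd_aboveI[of _ "y + M"])
    fix x assume "x \<in> A"
    then obtain y' where "y' \<le> y" "(x, y') \<in> Gset H T W" unfolding A_def by blast
    then show "x \<le> y + M" using Gset_near[of x y'] by (simp add: M_def)
  qed
  define x where "x = Sup A"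
  have "\<exists>a\<in>A. x - inverse (real (Suc n)) < a" for n
    using less_cSup_iff[OF ne bdd, of "x - inverse (real (Suc n))"] unfolding x_def by simp
  then obtain X where X: "\<And>n. X n \<in> A" "\<And>n. x - inverse (real (Suc n)) < X n" by metis
  have Xx: "X \<longlonglongrightarrow> x"
  proof (rule tendsto_sandwich[OF always_eventually always_eventually])
    show "\<forall>n. x - inverse (real (Suc n)) \<le> X n" using X(2) by (auto intro: less_imp_le)
    show "\<forall>n. X n \<le> x" unfolding x_def using cSup_upper[OF X(1) bdd] by blast
    show "(\<lambda>n. x - inverse (real (Suc n))) \<longlonglongrightarrow> x"
      using tendsto_diff[OF tendsto_const LIMSEQ_inverse_real_of_nat, of x] by simp
  qed simp
  obtain Y where Y: "\<And>n. Y n \<le> y" "\<And>n. (X n, Y n) \<in> Gset H T W" using X(1) unfolding A_def by (auto simp: set_eq_iff) metis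
  obtain r y1 where r: "(x, y1) \<in> Gset H T W" "(\<lambda>n. Y (r n)) \<longlonglongrightarrow> y1"
    by (rule Gset_compact[OF Xx Y(2)]) (rule that; assumption)
  have y1: "y1 \<le> y" by (rule LIMSEQ_le_const2[OF r(2)]) (use Y(1) in blast)
  \<comment> \<open>Points to the right of the supremum are not in \<open>A\<close>, so their
    section values exceed y and the limit is at least y.\<close>
  define X' where "X' n = x + inverse (real (Suc n))" for n
  have X'x: "X' \<longlonglongrightarrow> x" unfolding X'_def using tendsto_add[OF tendsto_const LIMSEQ_inverse_real_of_nat, of x] by simp
  have "\<forall>n. \<exists>z. (X' n, z) \<in> Gset H T W" using Gset_total by blast
  then obtain Z where Z: "\<And>n. (X' n, Z n) \<in> Gset H T W" by metis
  have Zy: "y \<le> Z n" for n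
  proof (rule ccontr)
    assume "\<not> y \<le> Z n"
    then have "X' n \<in> A" unfolding A_def using Z[of n] by (intro CollectI exI[of _ "Z n"]) auto
    then have "X' n \<le> x" unfolding x_def by (rule cSup_upper[OF _ bdd])
    then show False by (simp add: X'_def)
  qed
  obtain r' y2 where r': "(x, y2) \<in> Gset H T W" "(\<lambda>n. Z (r' n)) \<longlonglongrightarrow> y2"
    by (rule Gset_compact[OF X'x Z]) (rule that; assumption)
  have "y \<le> y2" by (rule LIMSEQ_le_const[OF r'(2)]) (use Zy in blast)
  with convex[OF r(1) r'(1), of y] y1 show ?thesis by auto
qed

text \<open>The evolution of \<open>Uostar\<close> never lies below W, because a minimizer ending at
  y is itself a candidate in the supremum at its starting point. Only the reverse inequality carries
  information.\<close>

lemma Uostar_IHJ_iff: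
  assumes "cauchy H (Uostar H T W) C"
  shows "Uostar H T W \<in> IHJ H T W \<longleftrightarrow> (\<forall>y. cauchy.u H (Uostar H T W) T y \<le> W y)"
proof -
  interpret s: cauchy H "Uostar H T W" C by (rule assms)
  have "W y \<le> s.u T y" for y
  proof -
    obtain q p where "s.Mini T y q p" using s.Mini_exists[OF T_pos] by blast
    then show ?thesis using rev_u_le[of q p] Uostar_eq[of "q 0"] by (simp add: s.Mini_def)
  qed
  moreover have "C-lipschitz_on UNIV (Uostar H T W)"
    using s.Uo_lip s.K_nonneg by (simp add: lipschitz_on_def dist_real_def)
  ultimately show ?thesis unfolding IHJ_def using s.SHJ_eq_u[OF T_pos] by (auto simp: fun_eq_iff intro: antisym)
qed

theorem reachability:
  "Uostar H T W \<in> IHJ H T W \<longleftrightarrow> IHJ H T W \<noteq> {}" (is "?one \<longleftrightarrow> ?two")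
  "IHJ H T W \<noteq> {} \<longleftrightarrow> (\<forall>xo xT' xT'' xT. (xo, xT') \<in> Gset H T W \<longrightarrow> (xo, xT'') \<in> Gset H T W \<longrightarrow>
     xT \<in> {xT'..xT''} \<longrightarrow> (xo, xT) \<in> Gset H T W)" (is "_ \<longleftrightarrow> ?three")
  "IHJ H T W \<noteq> {} \<Longrightarrow> (\<forall>x. \<exists>l. left_trace (deriv W) x l) \<and> mono (pi_map H T (deriv W))"
proof -
  obtain C where C: "\<And>x y. \<bar>Uostar H T W x - Uostar H T W y\<bar> \<le> C * \<bar>x - y\<bar>" using Uostar_lip by blast
  interpret s: cauchy H "Uostar H T W" C by unfold_locales (rule C)
  note one = Uostar_IHJ_iff[OF s.cauchy_axioms]
  have datum: "\<exists>K'. cauchy H Uo K' \<and> cauchy.u H Uo T = W" if Uo: "Uo \<in> IHJ H T W" for Uo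
  proof -
    obtain K' where K': "K'-lipschitz_on UNIV Uo" and S: "SHJ H T Uo = W" using Uo unfolding IHJ_def by blast
    have c: "cauchy H Uo K'"
      by unfold_locales (use lipschitz_onD[OF K'] in \<open>simp add: dist_real_def\<close>)
    then show ?thesis using S cauchy.SHJ_eq_u[OF c T_pos] by auto
  qed
  have two_one: ?one if two: "?two"
  proof -
    obtain Uo where "Uo \<in> IHJ H T W" using two by blast
    then obtain K' where c: "cauchy H Uo K'" "cauchy.u H Uo T = W" using datum by blast
    interpret c: cauchy H Uo K' by (rule c(1))
    show ?one unfolding one
    proof
      fix y
      obtain q p where m: "c.Mini T y q p" using c.Mini_exists[OF T_pos] by blast
      then have HS: "HSab 0 T q p" and y: "q T = y" and u: "W y = Uo (q 0) + integral {0..T} (\<lambda>s. ell (q s) (p s))"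
        using c(2) by (auto simp: c.Mini_def)
      \<comment> \<open>A maximizing curve for \<open>Uostar\<close> at \<open>q 0\<close> is also a
        competitor for the value function of \<open>Uo\<close>, whence
        \<open>Uostar \<le> Uo\<close> at this point.\<close>
      obtain y' where "(q 0, y') \<in> Gset H T W" using Gset_total by blast
      then obtain q' p' where q': "HSab 0 T q' p'" "q' 0 = q 0" "q' T = y'"
        "Uostar H T W (q 0) = W y' - integral {0..T} (\<lambda>s. ell (q' s) (p' s))" unfolding Gset_iff by blast
      have "W y' \<le> Uo (q 0) + integral {0..T} (\<lambda>s. ell (q' s) (p' s))"
        using c.u_le[OF less_imp_le[OF T_pos] HSab_C1c[OF q'(1)]] q'(2,3) unfolding c(2) HSab_cost by simp
      then have "Uostar H T W (q 0) \<le> Uo (q 0)" using q'(4) by simp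
      moreover have "s.u T (q T) \<le> Uostar H T W (q 0) + integral {0..T} (\<lambda>s. ell (q s) (p s))"
        using s.u_le[OF less_imp_le[OF T_pos] HSab_C1c[OF HS]] unfolding HSab_cost .
      ultimately show "s.u T y \<le> W y" using u y by simp
    qed
  qed
  then show 12: "?one \<longleftrightarrow> ?two" by blast
  have one_three: ?three if ?one
  proof (intro allI impI)
    fix x y' y'' y assume G: "(x, y') \<in> Gset H T W" "(x, y'') \<in> Gset H T W" and y: "y \<in> {y'..y''}"
    have uW: "s.u T = W" using that s.SHJ_eq_u[OF T_pos] by (auto simp: IHJ_def)
    \<comment> \<open>Once \<open>s.u T = W\<close>, the equation defining \<open>Gset\<close> is
      the one defining \<open>s.Mini\<close> with end point z.\<close>
    have mini: "\<exists>q p. s.Mini T z q p \<and> q 0 = x" if z: "(x, z) \<in> Gset H T W" for z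
    proof -
      obtain q p where q: "HSab 0 T q p" "q 0 = x" "q T = z" "Uostar H T W x = W z - integral {0..T} (\<lambda>s. ell (q s) (p s))"
        using z unfolding Gset_iff by blast
      then have "s.Mini T z q p" unfolding s.Mini_def uW by simp
      then show ?thesis using q(2) by blast
    qed
    obtain q1 p1 where 1: "s.Mini T y' q1 p1" "q1 0 = x" using mini[OF G(1)] by blast
    obtain q2 p2 where 2: "s.Mini T y'' q2 p2" "q2 0 = x" using mini[OF G(2)] by blast
    obtain q p where m: "s.Mini T y q p" using s.Mini_exists[OF T_pos] by blast
    show "(x, y) \<in> Gset H T W"
    proof (cases "y = y' \<or> y = y''")
      case False
      then have "y' < y" "y < y''" using y by auto
      \<comment> \<open>The weak order of the initial points is enough, as both neighbours start at
        x.\<close>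
      then have "q 0 = x"
        using s.Mini_ordered(2)[OF 1(1) m _ T_pos, of 0] s.Mini_ordered(2)[OF m 2(1) _ T_pos, of 0] 1(2) 2(2) T_pos by simp
      then show ?thesis unfolding Gset_iff
        using m by (intro exI[of _ q] exI[of _ p]) (simp add: s.Mini_def uW)
    qed (use G in auto)
  qed
  have three_one: ?one if three: ?three
    unfolding one
  proof
    fix y
    obtain x where "(x, y) \<in> Gset H T W" using Gset_onto[of y] three by blast
    then obtain q p where q: "HSab 0 T q p" "q 0 = x" "q T = y" "Uostar H T W x = W y - integral {0..T} (\<lambda>s. ell (q s) (p s))"
      unfolding Gset_iff by blast
    \<comment> \<open>The curve realizing the pair (x, y) is a competitor for \<open>s.u T y\<close>
      with cost exactly W y.\<close>
    show "s.u T y \<le> W y"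
      using s.u_le[OF less_imp_le[OF T_pos] HSab_C1c[OF q(1)]] q(2-4) unfolding HSab_cost by simp
  qed
  show "?two \<longleftrightarrow> ?three" using 12 one_three three_one by blast
  show "(\<forall>x. \<exists>l. left_trace (deriv W) x l) \<and> mono (pi_map H T (deriv W))" if two: ?two
  proof -
    obtain Uo where "Uo \<in> IHJ H T W" using two by blast
    then obtain K' where c: "cauchy H Uo K'" "cauchy.u H Uo T = W" using datum by blast
    interpret c: cauchy H Uo K' by (rule c(1))
    show ?thesis using c.left_trace_u[OF T_pos] c.mono_pi_map[OF T_pos] unfolding c(2) by blast
  qed
qed

end

theorem theorem3p2:
  fixes H :: "real \<Rightarrow> real \<Rightarrow> real" and T :: real and W :: "real \<Rightarrow> real"
  assumes "C3 H" and "CNH H" and "CVX H"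
    and "T > 0"
    and "\<exists>C. C-lipschitz_on UNIV W"
  shows "(Uostar H T W \<in> IHJ H T W \<longleftrightarrow> IHJ H T W \<noteq> {}) \<and>
         (IHJ H T W \<noteq> {} \<longleftrightarrow>
            (\<forall>xo xT' xT'' xT. (xo, xT') \<in> Gset H T W \<longrightarrow> (xo, xT'') \<in> Gset H T W \<longrightarrow>
                xT \<in> {xT'..xT''} \<longrightarrow> (xo, xT) \<in> Gset H T W)) \<and>
         ((Uostar H T W \<in> IHJ H T W \<or> IHJ H T W \<noteq> {} \<or>
            (\<forall>xo xT' xT'' xT. (xo, xT') \<in> Gset H T W \<longrightarrow> (xo, xT'') \<in> Gset H T W \<longrightarrow>
                xT \<in> {xT'..xT''} \<longrightarrow> (xo, xT) \<in> Gset H T W))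
          \<longrightarrow> (\<forall>x. \<exists>l. left_trace (deriv W) x l) \<and> mono (pi_map H T (deriv W)))"
proof -
  obtain K where K: "K-lipschitz_on UNIV W" using assms(5) by blast
  have "terminal_problem H W K T"
    by (rule terminal_problem.intro[OF ham_of_hyps[OF assms(1-3)]], unfold_locales)
      (use lipschitz_onD[OF K] assms(4) in \<open>simp_all add: dist_real_def\<close>)
  from terminal_problem.reachability[OF this] show ?thesis by blast
qed

end
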